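(* Let $X$ and $X'$ be CAT(0) cube complexes with finitely many cells, each of top dimension at most $2$. Suppose there is a bijection $\varphi\colon (\partial X)^0\to(\partial X')^0$ between the sets of vertices of their combinatorial boundaries such that $d_X(u,w)=d_{X'}(\varphi(u),\varphi(w))$ for all $u,w\in(\partial X)^0$. Then $X$ and $X'$ have the same combinatorial type. In other words, the combinatorial type of a finite CAT(0) cube complex $X$ of top dimension at most $2$ is reconstructible from the matrix $D$ of pairwise distances between vertices on the combinatorial boundary of $X$.
   Context: A cube complex is a regular CW complex whose $n$-cells are $n$-cubes $[0,1]^n$, with combinatorial isometries as gluing maps. For a vertex $v$, $\mathrm{link}(v)$ is the simplicial complex whose vertices are the edges containing $v$, and in which $e_1,\dots,e_n$ span an $(n-1)$-simplex if and only if there is an $n$-cell containing $v$ whose edges at $v$ are exactly $e_1,\dots,e_n$. A simplicial complex is flag if any finite set of pairwise adjacent vertices spans a simplex. A cube complex is CAT(0) if it is simply connected and all of its vertex links are flag simplicial complexes. For a complex $X$ whose maximum cell dimension is $k$, the combinatorial boundary $\partial X$ is the downward closure (i.e. the set of all faces, of all dimensions) of the set of cells of dimension less than $k$ that are contained in at most one cell of dimension $k$. $(\partial X)^0$ is its set of vertices. $d_X$ is the graph distance in the $1$-skeleton of the whole complex $X$. Two cube complexes $X,Y$ have the same combinatorial type if there are, for each $i$, bijections $f_i$ from the $i$-cells of $X$ to the $i$-cells of $Y$ such that two cells of $X$ are incident if and only if their images are incident.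
   Formalization: That vertex links are simplicial complexes is taken to include that distinct cells at a vertex span distinct simplices; otherwise two, or three, squares glued along their whole boundary would both be CAT(0) with empty boundary, contradicting the claim. *)

theory Defs
  imports "HOL-Analysis.Analysis"
begin

text \<open>
  The cube \<open>[0,1]\<^sup>n\<close> is modelled inside \<open>nat \<Rightarrow> real\<close> (with the product topology) as the
  set of functions vanishing from index \<open>n\<close> on.  On this set the product topology is the
  Euclidean one.
\<close>

definition cube :: "nat \<Rightarrow> (nat \<Rightarrow> real) set" where
  "cube n = {x. (\<forall>i<n. 0 \<le> x i \<and> x i \<le> 1) \<and> (\<forall>i\<ge>n. x i = 0)}"

definition open_cube :: "nat \<Rightarrow> (nat \<Rightarrow> real) set" where
  "open_cube n = {x. (\<forall>i<n. 0 < x i \<and> x i < 1) \<and> (\<forall>i\<ge>n. x i = 0)}"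

definition cube_face :: "nat \<Rightarrow> nat set \<Rightarrow> (nat \<Rightarrow> real) \<Rightarrow> (nat \<Rightarrow> real) set" where
  "cube_face n I a = {x \<in> cube n. \<forall>i\<in>I. x i = a i}"

text \<open>
  An isometry of a unit cube onto a face of a unit cube automatically maps faces to faces, so
  these are exactly the combinatorial isometries.
\<close>

definition cube_isometry ::
    "nat \<Rightarrow> nat \<Rightarrow> (nat \<Rightarrow> real) set \<Rightarrow> ((nat \<Rightarrow> real) \<Rightarrow> (nat \<Rightarrow> real)) \<Rightarrow> bool" where
  "cube_isometry m n F g \<longleftrightarrow> g ` cube m = F \<and>
     (\<forall>x\<in>cube m. \<forall>y\<in>cube m.
        L2_set (\<lambda>i. g x i - g y i) {..<n} = L2_set (\<lambda>i. x i - y i) {..<m})"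

text \<open>
  Cells are indexed by elements of a set; \<open>chart X c\<close> is the characteristic map of the cell
  \<open>c\<close>, only relevant on \<open>cube (cdim X c)\<close>.
\<close>

record ('c, 'a) cube_data =
  cells :: "'c set"
  cdim :: "'c \<Rightarrow> nat"
  chart :: "'c \<Rightarrow> (nat \<Rightarrow> real) \<Rightarrow> 'a"

definition closed_cell :: "('c, 'a) cube_data \<Rightarrow> 'c \<Rightarrow> 'a set" where
  "closed_cell X c = chart X c ` cube (cdim X c)"

definition open_cell :: "('c, 'a) cube_data \<Rightarrow> 'c \<Rightarrow> 'a set" where
  "open_cell X c = chart X c ` open_cube (cdim X c)"

definition realization :: "('c, 'a) cube_data \<Rightarrow> 'a set" where
  "realization X = (\<Union>c\<in>cells X. closed_cell X c)"

text \<open>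
  The underlying space is a subspace of an ambient Hausdorff space.  Regularity of the CW
  complex is injectivity of the characteristic maps on closed cubes (which makes them
  homeomorphisms onto the closed cells, by compactness).  The gluing condition says that every
  face of a cell is, up to an isometry, another cell; it implies that the open cells cover
  the space and that the closure-finiteness axiom holds.  The last conjunct is the weak topology.
\<close>

definition cube_complex :: "('c, 'a::t2_space) cube_data \<Rightarrow> bool" where
  "cube_complex X \<longleftrightarrow>
     (\<forall>c\<in>cells X. continuous_on (cube (cdim X c)) (chart X c) \<and>
                  inj_on (chart X c) (cube (cdim X c))) \<and>
     (\<forall>c\<in>cells X. \<forall>d\<in>cells X. c \<noteq> d \<longrightarrow> open_cell X c \<inter> open_cell X d = {}) \<and>
     (\<forall>c\<in>cells X. \<forall>I a. I \<subseteq> {..<cdim X c} \<longrightarrow> a ` I \<subseteq> {0, 1} \<longrightarrow>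
        (\<exists>d\<in>cells X. cdim X d = cdim X c - card I \<and>
           (\<exists>g. cube_isometry (cdim X d) (cdim X c) (cube_face (cdim X c) I a) g \<and>
                (\<forall>x\<in>cube (cdim X d). chart X d x = chart X c (g x))))) \<and>
     (\<forall>S\<subseteq>realization X.
        (\<forall>c\<in>cells X. closedin (top_of_set (closed_cell X c)) (S \<inter> closed_cell X c)) \<longrightarrow>
        closedin (top_of_set (realization X)) S)"

definition face_of_cell :: "('c, 'a) cube_data \<Rightarrow> 'c \<Rightarrow> 'c \<Rightarrow> bool" where
  "face_of_cell X c d \<longleftrightarrow> c \<in> cells X \<and> d \<in> cells X \<and> closed_cell X c \<subseteq> closed_cell X d"

definition incident :: "('c, 'a) cube_data \<Rightarrow> 'c \<Rightarrow> 'c \<Rightarrow> bool" where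
  "incident X c d \<longleftrightarrow> face_of_cell X c d \<or> face_of_cell X d c"

definition cells_of_dim :: "('c, 'a) cube_data \<Rightarrow> nat \<Rightarrow> 'c set" where
  "cells_of_dim X n = {c \<in> cells X. cdim X c = n}"

definition edges_at :: "('c, 'a) cube_data \<Rightarrow> 'c \<Rightarrow> 'c set" where
  "edges_at X v = {e \<in> cells_of_dim X 1. face_of_cell X v e}"

definition corner :: "('c, 'a) cube_data \<Rightarrow> 'c \<Rightarrow> 'c \<Rightarrow> 'c set" where
  "corner X v c = {e \<in> edges_at X v. face_of_cell X e c}"

definition cells_at :: "('c, 'a) cube_data \<Rightarrow> 'c \<Rightarrow> 'c set" where
  "cells_at X v = {c \<in> cells X. 1 \<le> cdim X c \<and> face_of_cell X v c}"

definition link :: "('c, 'a) cube_data \<Rightarrow> 'c \<Rightarrow> 'c set set" where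
  "link X v = corner X v ` cells_at X v"

definition simplicial_complex :: "'b set \<Rightarrow> 'b set set \<Rightarrow> bool" where
  "simplicial_complex V K \<longleftrightarrow>
     (\<forall>\<sigma>\<in>K. finite \<sigma> \<and> \<sigma> \<noteq> {} \<and> \<sigma> \<subseteq> V) \<and>
     (\<forall>x\<in>V. {x} \<in> K) \<and>
     (\<forall>\<sigma>\<in>K. \<forall>\<tau>\<subseteq>\<sigma>. \<tau> \<noteq> {} \<longrightarrow> \<tau> \<in> K)"

definition flag :: "'b set \<Rightarrow> 'b set set \<Rightarrow> bool" where
  "flag V K \<longleftrightarrow>
     (\<forall>\<sigma>\<subseteq>V. finite \<sigma> \<longrightarrow> \<sigma> \<noteq> {} \<longrightarrow> (\<forall>x\<in>\<sigma>. \<forall>y\<in>\<sigma>. x \<noteq> y \<longrightarrow> {x, y} \<in> K) \<longrightarrow> \<sigma> \<in> K)"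

text \<open>
  That a vertex link is a simplicial complex includes that different cells at the vertex give
  different simplices (the injectivity condition).  Without it, several squares glued along their
  entire common boundary would be admitted, since only the sets of edges spanned by cells would be
  visible.  Nonemptiness is part of simple connectivity, but \<open>simply_connected {}\<close> holds
  in the library.
\<close>

definition CAT0_cube_complex :: "('c, 'a::t2_space) cube_data \<Rightarrow> bool" where
  "CAT0_cube_complex X \<longleftrightarrow>
     cube_complex X \<and>
     realization X \<noteq> {} \<and> simply_connected (realization X) \<and>
     (\<forall>v\<in>cells_of_dim X 0.
        inj_on (corner X v) (cells_at X v) \<and>
        simplicial_complex (edges_at X v) (link X v) \<and>
        flag (edges_at X v) (link X v))"

definition top_dim :: "('c, 'a) cube_data \<Rightarrow> nat" where
  "top_dim X = Max (cdim X ` cells X)"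

definition comb_boundary :: "('c, 'a) cube_data \<Rightarrow> 'c set" where
  "comb_boundary X = {c. \<exists>b\<in>cells X. cdim X b < top_dim X \<and>
     (\<exists>\<^sub>\<le>\<^sub>1 t. t \<in> cells_of_dim X (top_dim X) \<and> face_of_cell X b t) \<and> face_of_cell X c b}"

definition boundary_vertices :: "('c, 'a) cube_data \<Rightarrow> 'c set" where
  "boundary_vertices X = comb_boundary X \<inter> cells_of_dim X 0"

definition skeleton_adj :: "('c, 'a) cube_data \<Rightarrow> ('c \<times> 'c) set" where
  "skeleton_adj X = {(u, v). u \<in> cells_of_dim X 0 \<and> v \<in> cells_of_dim X 0 \<and> u \<noteq> v \<and>
     (\<exists>e\<in>cells_of_dim X 1. face_of_cell X u e \<and> face_of_cell X v e)}"

text \<open>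
  The length of a shortest walk; only meaningful for vertices in the same component.
\<close>

definition graph_dist :: "('c, 'a) cube_data \<Rightarrow> 'c \<Rightarrow> 'c \<Rightarrow> nat" where
  "graph_dist X u v = (LEAST n. (u, v) \<in> skeleton_adj X ^^ n)"

definition same_combinatorial_type :: "('c, 'a) cube_data \<Rightarrow> ('d, 'b) cube_data \<Rightarrow> bool" where
  "same_combinatorial_type X Y \<longleftrightarrow>
     (\<exists>f :: nat \<Rightarrow> 'c \<Rightarrow> 'd.
        (\<forall>i. bij_betw (f i) (cells_of_dim X i) (cells_of_dim Y i)) \<and>
        (\<forall>i j. \<forall>c\<in>cells_of_dim X i. \<forall>d\<in>cells_of_dim X j.
           incident X c d \<longleftrightarrow> incident Y (f i c) (f j d)))"

end

theory Submission
  imports Defs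
begin

text \<open>
  Both reconstructions rest on the geometry of the graph of \<open>X\<close>, and this geometry follows from
  one rewriting argument.  Push a walk across a square by exchanging two consecutive edges of the
  square for the two others.  If two walks that are related by such swaps end with different edges
  \<open>a\<close> and \<open>b\<close>, then \<open>a\<close> and \<open>b\<close> span a square and the walks can be swapped to arrive through
  it (\<open>exchange_cases\<close>): a longer chain of exchanges would give three squares that meet pairwise
  at a vertex, so by the flag condition a 3-cube, which the dimension excludes.  Call a walk reduced if it cannot be swapped
  to one with a backtrack.  Every edge acts on the swap classes of reduced walks from a base
  vertex, by prolongation or deletion, and the two ways around a square act equally
  (\<open>act_square\<close>); so these classes form the universal cover.  As \<open>X\<close> is simply
  connected, the monodromy of this action is trivial, and hence two reduced walks with
  the same ends differ by swaps only (\<open>reduced_unique\<close>).  In particular geodesics are the reduced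
  walks, and two edges that descend to a common target span a square (\<open>quadrangle\<close>).  From the
  quadrangle condition follow the half-spaces of the hyperplanes, and that a choice of half-spaces
  that meet pairwise is a vertex (\<open>consistent_orientation\<close>).

  Let the top dimension be two.  The edge of a hyperplane that is farthest from a given one
  lies in at most one square, so each hyperplane crosses the boundary
  (\<open>boundary_representative\<close>); and one can ascend from a vertex off the boundary, away from any base
  vertex, so each nonempty intersection of two half-spaces contains a boundary vertex
  (\<open>boundary_meets_quarter\<close>).  The boundary distances thus tell which choices of sides of boundary
  edges meet pairwise, that is, the vertices, and two of them are adjacent if they are separated by
  one hyperplane (\<open>code_image\<close>, \<open>adjacent_iff_code\<close>).  Let the top dimension be one.  Every vertex of
  the tree lies between two leaves, and its distances to all leaves are determined by its
  position between these two (\<open>tree_code_image\<close>).  The top dimension itself is visible: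
  a point has no boundary, and only in a complex with squares do two adjacent boundary vertices
  coexist with a third one.  Finally the graph determines the complex since the squares are
  its four-cycles.

  The topological part turns simple connectivity of the realization into the triviality of
  monodromy.  States on the vertices that are transported along the edges compatibly with the squares
  extend to the cells and form a local system; along a homotopy its sections can be continued
  uniquely, so a section along a null-homotopic loop closes up (\<open>trivial_monodromy\<close>).
\<close>

section \<open>Square complexes and the exchange of edges across squares\<close>

text \<open>Darts are oriented edges.  The relation \<open>sq p a q b\<close> says that \<open>p\<close>, \<open>a\<close> and \<open>q\<close>, \<open>b\<close> are the
  two ways from a corner of a square to the opposite one.  The last axiom is the flag condition in
  the absence of 3-cubes.\<close>

locale square_complex =
  fixes V :: "'v set" and D :: "'d set"
    and src tgt :: "'d \<Rightarrow> 'v" and rev :: "'d \<Rightarrow> 'd"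
    and sq :: "'d \<Rightarrow> 'd \<Rightarrow> 'd \<Rightarrow> 'd \<Rightarrow> bool"
  assumes src_V: "d \<in> D \<Longrightarrow> src d \<in> V"
    and rev_D: "d \<in> D \<Longrightarrow> rev d \<in> D"
    and rev_rev: "d \<in> D \<Longrightarrow> rev (rev d) = d"
    and src_rev: "d \<in> D \<Longrightarrow> src (rev d) = tgt d"
    and sq_D: "sq p a q b \<Longrightarrow> p \<in> D \<and> a \<in> D \<and> q \<in> D \<and> b \<in> D"
    and sq_ends: "sq p a q b \<Longrightarrow> src p = src q \<and> tgt p = src a \<and> tgt q = src b \<and> tgt a = tgt b"
    and sq_neq: "sq p a q b \<Longrightarrow> p \<noteq> q"
    and sq_sym: "sq p a q b \<Longrightarrow> sq q b p a"
    and sq_rot: "sq p a q b \<Longrightarrow> sq (rev p) q a (rev b)"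
    and sq_unique: "sq p a q b \<Longrightarrow> sq p a' q b' \<Longrightarrow> a = a' \<and> b = b'"
    and no_cube: "sq p a q b \<Longrightarrow> sq q c r d \<Longrightarrow> sq p e r f \<Longrightarrow> False"
begin

lemma tgt_rev: "d \<in> D \<Longrightarrow> tgt (rev d) = src d"
  by (metis rev_D rev_rev src_rev)

lemma tgt_V: "d \<in> D \<Longrightarrow> tgt d \<in> V"
  by (metis rev_D src_V src_rev)

text \<open>This is adjacency in the link of the common source.\<close>

definition span_square :: "'d \<Rightarrow> 'd \<Rightarrow> bool" where
  "span_square p q \<longleftrightarrow> (\<exists>a b. sq p a q b)"

lemma span_square_sym: "span_square p q \<Longrightarrow> span_square q p"
  unfolding span_square_def using sq_sym by blast

lemma no_triangle: "span_square p q \<Longrightarrow> span_square q r \<Longrightarrow> span_square p r \<Longrightarrow> False"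
  unfolding span_square_def using no_cube by blast

lemma sq_rot2: "sq p a q b \<Longrightarrow> sq (rev a) (rev p) (rev b) (rev q)"
  using sq_rot[OF sq_sym[OF sq_rot]] by blast

lemma sq_not_back: "sq p a q b \<Longrightarrow> a \<noteq> rev p"
  using sq_neq sq_rot by metis

lemma sq_last_neq: "sq p a q b \<Longrightarrow> a \<noteq> b"
  using sq_neq[OF sq_rot2] by blast

lemma sq_first_last:
  assumes s: "sq p a q b" and s': "sq p a q' b'"
  shows "q = q' \<and> b = b'"
proof -
  have "q = q'" "rev b = rev b'" using sq_unique[OF sq_rot[OF s] sq_rot[OF s']] by simp_all
  moreover have "b \<in> D" "b' \<in> D" using sq_D[OF s] sq_D[OF s'] by blast+
  ultimately show ?thesis using rev_rev by metis
qed

text \<open>Walks are lists of darts with the last dart at the head, so that extending a walk is \<open>#\<close>.\<close>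

fun walk :: "'d list \<Rightarrow> 'v \<Rightarrow> 'v \<Rightarrow> bool" where
  "walk [] x y \<longleftrightarrow> x = y \<and> x \<in> V"
| "walk (a # w) x y \<longleftrightarrow> a \<in> D \<and> tgt a = y \<and> walk w x (src a)"

inductive swap :: "'d list \<Rightarrow> 'd list \<Rightarrow> bool" where
  swap_sq: "sq p a q b \<Longrightarrow> swap (a # p # z) (b # q # z)"
| swap_Cons: "swap u u' \<Longrightarrow> swap (a # u) (a # u')"

abbreviation swaps :: "'d list \<Rightarrow> 'd list \<Rightarrow> bool" (infix \<open>\<sim>\<close> 50) where
  "u \<sim> u' \<equiv> swap\<^sup>*\<^sup>* u u'"

lemma swap_sym: "swap u u' \<Longrightarrow> swap u' u"
  by (induction rule: swap.induct) (auto intro: swap.intros sq_sym)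

lemma swaps_sym: "u \<sim> u' \<Longrightarrow> u' \<sim> u"
  by (induction rule: rtranclp_induct) (auto intro: converse_rtranclp_into_rtranclp swap_sym)

lemma swaps_trans [trans]: "u \<sim> v \<Longrightarrow> v \<sim> w \<Longrightarrow> u \<sim> w"
  by (rule rtranclp_trans)

lemma swaps_Cons: "u \<sim> u' \<Longrightarrow> a # u \<sim> a # u'"
  by (induction rule: rtranclp_induct) (auto intro: rtranclp.rtrancl_into_rtrancl swap_Cons)

lemma swaps_sq: "sq p a q b \<Longrightarrow> a # p # z \<sim> b # q # z"
  by (auto intro: swap_sq)

lemma swap_length: "swap u u' \<Longrightarrow> length u = length u'"
  by (induction rule: swap.induct) auto

lemma swaps_length: "u \<sim> u' \<Longrightarrow> length u = length u'"
  by (induction rule: rtranclp_induct) (auto dest: swap_length)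

lemma swap_walk: "swap u u' \<Longrightarrow> walk u x y \<Longrightarrow> walk u' x y"
proof (induction arbitrary: y rule: swap.induct)
  case (swap_sq p a q b z)
  then show ?case using sq_D[OF swap_sq(1)] sq_ends[OF swap_sq(1)] by auto
qed auto

lemma swaps_walk: "u \<sim> u' \<Longrightarrow> walk u x y \<Longrightarrow> walk u' x y"
  by (induction rule: rtranclp_induct) (auto dest: swap_walk)

definition exchange :: "'d list \<Rightarrow> 'd list \<Rightarrow> bool" where
  "exchange w w' \<longleftrightarrow> (\<exists>a u b u'. w = a # u \<and> w' = b # u' \<and>
     ((a = b \<and> u \<sim> u') \<or> (\<exists>z p q. sq p a q b \<and> u \<sim> p # z \<and> u' \<sim> q # z)))"

text \<open>Compose two exchanges \<open>a \<leadsto> b \<leadsto> c\<close> of the last edge.  The shorter walks to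
  the source of \<open>b\<close> may agree in their last edge; then the two squares coincide and \<open>c\<close> is \<open>a\<close>.
  Otherwise, by induction, these last edges span a third square, and the three squares meet
  pairwise at the source of \<open>b\<close>.\<close>

lemma exchange_trans:
  assumes IH: "\<And>w w'. length w = n \<Longrightarrow> w \<sim> w' \<Longrightarrow> w \<noteq> [] \<Longrightarrow> exchange w w'"
    and "exchange w1 w2" "exchange w2 w3" and len: "length w2 = Suc n"
  shows "exchange w1 w3"
proof -
  from assms(2) obtain a u b u' where w12: "w1 = a # u" "w2 = b # u'"
    "(a = b \<and> u \<sim> u') \<or> (\<exists>z p q. sq p a q b \<and> u \<sim> p # z \<and> u' \<sim> q # z)"
    unfolding exchange_def by blast
  from assms(3) w12(2) obtain c u'' where w23: "w3 = c # u''"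
    "(b = c \<and> u' \<sim> u'') \<or> (\<exists>z p q. sq p b q c \<and> u' \<sim> p # z \<and> u'' \<sim> q # z)"
    unfolding exchange_def by blast
  show ?thesis
  proof (cases "a = b \<and> u \<sim> u' \<or> b = c \<and> u' \<sim> u''")
    case True
    with w12(3) w23(2) show ?thesis
      unfolding exchange_def w12(1) w23(1) by (metis swaps_sym swaps_trans)
  next
    case False
    with w12(3) obtain z p q where 1: "sq p a q b" "u \<sim> p # z" "u' \<sim> q # z" by blast
    from False w23(2) obtain y r s where 2: "sq r b s c" "u' \<sim> r # y" "u'' \<sim> s # y" by blast
    have qr: "q # z \<sim> r # y"
      using 1(3) 2(2) by (metis swaps_sym swaps_trans)
    have "length (q # z) = n"
      using len w12(2) swaps_length[OF 1(3)] by simp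
    then have "exchange (q # z) (r # y)" using IH qr by blast
    then consider (same) "q = r" "z \<sim> y" | (diff) t s' where "sq t q s' r"
      unfolding exchange_def by auto
    then show ?thesis
    proof cases
      case same
      have "p = s" "a = c"
        using sq_first_last[OF sq_sym[OF 1(1)]] 2(1) same(1) by blast+
      moreover have "u \<sim> u''"
        using 1(2) 2(3) same(2) \<open>p = s\<close> by (metis swaps_Cons swaps_sym swaps_trans)
      ultimately show ?thesis unfolding exchange_def w12(1) w23(1) by blast
    next
      case diff
      have "span_square (rev q) b" using sq_rot[OF sq_sym[OF 1(1)]] unfolding span_square_def by blast
      moreover have "span_square (rev r) b" using sq_rot[OF 2(1)] unfolding span_square_def by blast
      moreover have "span_square (rev q) (rev r)" using sq_rot2[OF diff] unfolding span_square_def by blast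
      ultimately show ?thesis using no_triangle span_square_sym by blast
    qed
  qed
qed

lemma swap_exchange: "swap w w' \<Longrightarrow> exchange w w'"
proof (induction rule: swap.induct)
  case (swap_sq p a q b z)
  then show ?case unfolding exchange_def by blast
next
  case (swap_Cons u u' a)
  then show ?case unfolding exchange_def by blast
qed

lemma exchange_aux: "length w = n \<Longrightarrow> w \<sim> w' \<Longrightarrow> w \<noteq> [] \<Longrightarrow> exchange w w'"
proof (induction n arbitrary: w w')
  case 0
  then show ?case by simp
next
  case (Suc n)
  from Suc.prems(2,1,3) show ?case
  proof (induction rule: rtranclp_induct)
    case base
    then show ?case unfolding exchange_def by (cases w) auto
  next
    case (step y z)
    then show ?case
      using exchange_trans[of n w y z] Suc.IH swap_exchange[OF step(2)] swaps_length[OF step(1)]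
      by auto
  qed
qed

lemma exchange_cases:
  assumes "a # u \<sim> b # u'"
  obtains (same) "a = b" "u \<sim> u'"
  | (square) z p q where "sq p a q b" "u \<sim> p # z" "u' \<sim> q # z"
  using exchange_aux[OF refl assms] unfolding exchange_def by auto

lemma swaps_Cons_cancel: "a # u \<sim> a # u' \<Longrightarrow> u \<sim> u'"
  by (erule exchange_cases) (auto dest: sq_last_neq)

section \<open>Reduced walks\<close>

inductive backtrack :: "'d list \<Rightarrow> bool" where
  backtrack_here: "x \<in> D \<Longrightarrow> backtrack (x # rev x # z)"
| backtrack_Cons: "backtrack u \<Longrightarrow> backtrack (a # u)"

definition reduced :: "'d list \<Rightarrow> bool" where
  "reduced w \<longleftrightarrow> (\<forall>w'. w \<sim> w' \<longrightarrow> \<not> backtrack w')"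

lemma reduced_swaps: "reduced w \<Longrightarrow> w \<sim> w' \<Longrightarrow> reduced w'"
  unfolding reduced_def by (metis swaps_trans)

lemma reduced_Cons: "reduced (a # w) \<Longrightarrow> reduced w"
  unfolding reduced_def by (metis swaps_Cons backtrack_Cons)

lemma not_reduced_back: "x \<in> D \<Longrightarrow> \<not> reduced (x # rev x # z)"
  unfolding reduced_def by (auto intro: backtrack_here)

lemma not_backtrack_Nil: "\<not> backtrack []"
  by (auto elim: backtrack.cases)

lemma reduced_Nil: "reduced []"
  unfolding reduced_def using swaps_length not_backtrack_Nil by (metis length_0_conv)

text \<open>A backtrack in a walk that is swap-equivalent to \<open>e # w\<close> can be moved to its end.  By the exchange
  property the two walks arrive through a common square unless their last edges agree.  If the
  backtrack is not at the very end then it lies in the shorter walk to the other corner of this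
  square, where the induction hypothesis applies.\<close>

lemma not_reduced_Cons:
  assumes "e \<in> D" "reduced w" "\<not> reduced (e # w)"
  shows "\<exists>w'. w \<sim> rev e # w'"
  using assms
proof (induction "length w" arbitrary: w e rule: less_induct)
  case less
  obtain u where u: "e # w \<sim> u" "backtrack u"
    using less.prems(3) unfolding reduced_def by blast
  from u(2) obtain b u' where ub: "u = b # u'" by (cases rule: backtrack.cases) auto
  from u(1)[unfolded ub] show ?case
  proof (cases rule: exchange_cases)
    case same
    from u(2)[unfolded ub] show ?thesis
    proof (cases rule: backtrack.cases)
      case (backtrack_here z)
      then show ?thesis using same by blast
    next
      case backtrack_Cons
      then show ?thesis using same less.prems(2) unfolding reduced_def by blast
    qed
  next
    case (square z p q)
    note D = sq_D[OF square(1)]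
    have z: "reduced z"
      using reduced_Cons reduced_swaps[OF less.prems(2) square(2)] by blast
    from u(2)[unfolded ub] show ?thesis
    proof (cases rule: backtrack.cases)
      case (backtrack_here u'')
      have "q # z \<sim> rev b # u''" using square(3) backtrack_here by (metis swaps_sym)
      then show ?thesis
      proof (cases rule: exchange_cases)
        case same
        have "b = rev q" using same D rev_rev by metis
        then show ?thesis using sq_not_back[OF sq_sym[OF square(1)]] by blast
      next
        case s2: (square y r s)
        \<comment> \<open>Both squares have the corner spanned by \<open>rev q\<close> and \<open>b\<close>.\<close>
        have "sq (rev q) (rev r) b (rev s)"
          using sq_rot2[OF s2(1)] D rev_rev by simp
        moreover have "sq (rev q) p b (rev e)"
          by (rule sq_rot[OF sq_sym[OF square(1)]])
        ultimately have "rev r = p" using sq_unique by blast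
        then have "r = rev p" using sq_D[OF s2(1)] rev_rev by metis
        then have "w \<sim> p # rev p # y"
          using square(2) s2(2) by (metis swaps_Cons swaps_trans)
        then show ?thesis
          using reduced_swaps[OF less.prems(2)] not_reduced_back D by blast
      qed
    next
      case backtrack_Cons
      then have "\<not> reduced (q # z)" using square(3) swaps_sym unfolding reduced_def by blast
      moreover have "length z < length w" using swaps_length[OF square(2)] by simp
      ultimately obtain z' where "z \<sim> rev q # z'" using less.hyps z D by blast
      then have "w \<sim> p # rev q # z'" using square(2) by (metis swaps_Cons swaps_trans)
      also have "p # rev q # z' \<sim> rev e # b # z'"
        by (rule swaps_sq[OF sq_rot[OF sq_sym[OF square(1)]]])
      finally show ?thesis by blast
    qed
  qed
qed

section \<open>The action of darts on classes of reduced walks\<close>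

definition swap_class :: "'d list \<Rightarrow> 'd list set" where
  "swap_class w = {w'. w \<sim> w'}"

lemma swap_class_eq: "swap_class u = swap_class v \<longleftrightarrow> u \<sim> v"
  unfolding swap_class_def by (auto intro: swaps_trans dest: swaps_sym)

definition states :: "'v \<Rightarrow> 'v \<Rightarrow> 'd list set set" where
  "states x y = {swap_class w |w. walk w x y \<and> reduced w}"

text \<open>Prolongation by \<open>e\<close>, or deletion of the last edge if some representative ends with the reverse of
  \<open>e\<close>.  With this action the classes form the universal cover.\<close>

definition act :: "'d \<Rightarrow> 'd list set \<Rightarrow> 'd list set" where
  "act e S = (if \<exists>w'. rev e # w' \<in> S then swap_class (SOME w'. rev e # w' \<in> S)
              else swap_class (e # (SOME w. w \<in> S)))"

lemma act_delete:
  assumes "w \<sim> rev e # w'"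
  shows "act e (swap_class w) = swap_class w'"
proof -
  have ex: "\<exists>w'. rev e # w' \<in> swap_class w" using assms unfolding swap_class_def by blast
  define w'' where "w'' = (SOME w'. rev e # w' \<in> swap_class w)"
  have "rev e # w'' \<in> swap_class w" unfolding w''_def by (rule someI_ex[OF ex])
  then have "rev e # w'' \<sim> rev e # w'"
    using assms unfolding swap_class_def by (auto intro: swaps_trans dest: swaps_sym)
  then have "w'' \<sim> w'" by (rule swaps_Cons_cancel)
  then show ?thesis using ex unfolding act_def w''_def by (simp add: swap_class_eq)
qed

lemma act_append:
  assumes "reduced (e # w)" "e \<in> D"
  shows "act e (swap_class w) = swap_class (e # w)"
proof -
  have nex: "\<not> (\<exists>w'. rev e # w' \<in> swap_class w)"
  proof
    assume "\<exists>w'. rev e # w' \<in> swap_class w"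
    then obtain w' where "e # w \<sim> e # rev e # w'" unfolding swap_class_def by (auto intro: swaps_Cons)
    then show False using reduced_swaps[OF assms(1)] not_reduced_back[OF assms(2)] by blast
  qed
  define w'' where "w'' = (SOME w'. w' \<in> swap_class w)"
  have "w \<in> swap_class w" unfolding swap_class_def by simp
  then have "w'' \<in> swap_class w" unfolding w''_def by (rule someI)
  then have "e # w'' \<sim> e # w" unfolding swap_class_def by (auto intro: swaps_Cons swaps_sym)
  then show ?thesis using nex unfolding act_def w''_def[symmetric] by (simp add: swap_class_eq)
qed

lemma act_cases:
  assumes "reduced w" "e \<in> D"
  obtains (append) "reduced (e # w)" "act e (swap_class w) = swap_class (e # w)"
  | (delete) w' where "w \<sim> rev e # w'" "act e (swap_class w) = swap_class w'" "reduced w'"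
  using act_append act_delete not_reduced_Cons[OF assms(2,1)] assms reduced_Cons reduced_swaps
  by metis

lemma act_states:
  assumes "e \<in> D" "S \<in> states x (src e)"
  shows "act e S \<in> states x (tgt e)" "act (rev e) (act e S) = S"
proof -
  obtain w where w: "S = swap_class w" "walk w x (src e)" "reduced w"
    using assms(2) unfolding states_def by blast
  have "act e S \<in> states x (tgt e) \<and> act (rev e) (act e S) = S"
    using w(3) assms(1)
  proof (cases rule: act_cases)
    case append
    moreover have "walk (e # w) x (tgt e)" using w assms by simp
    moreover have "act (rev e) (swap_class (e # w)) = swap_class w"
      by (rule act_delete) (simp add: rev_rev assms(1))
    ultimately show ?thesis unfolding states_def w(1) by auto
  next
    case (delete w')
    have "walk (rev e # w') x (src e)" using swaps_walk[OF delete(1) w(2)] .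
    then have p: "walk w' x (tgt e)" using assms(1) src_rev by auto
    have "act (rev e) (swap_class w') = swap_class (rev e # w')"
      by (rule act_append) (use reduced_swaps[OF w(3) delete(1)] rev_D assms(1) in auto)
    moreover have "swap_class w = swap_class (rev e # w')"
      using delete(1) by (simp add: swap_class_eq)
    ultimately show ?thesis using delete p unfolding states_def w(1) by auto
  qed
  then show "act e S \<in> states x (tgt e)" "act (rev e) (act e S) = S" by blast+
qed

text \<open>If the prolongation by \<open>p\<close> is followed by a deletion, then the deleted edge was exchanged with
  \<open>p\<close> across the given square, and on the other way around the deletion comes first.\<close>

lemma act_square_append:
  assumes sq: "sq p a q b" and w: "reduced w" and pw: "reduced (p # w)"
  shows "act a (act p (swap_class w)) = act b (act q (swap_class w))"
proof -
  note D = sq_D[OF sq]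
  have 1: "act p (swap_class w) = swap_class (p # w)" using act_append pw D by blast
  from pw D have "a \<in> D" by blast
  with pw show ?thesis
  proof (cases rule: act_cases)
    case append
    have red: "reduced (b # q # w)" using reduced_swaps[OF append(1) swaps_sq[OF sq]] .
    then have "act b (act q (swap_class w)) = swap_class (b # q # w)"
      using act_append reduced_Cons D by metis
    also have "\<dots> = swap_class (a # p # w)" using swaps_sq[OF sq] by (simp add: swap_class_eq swaps_sym)
    finally show ?thesis using append 1 by simp
  next
    case (delete u)
    from delete(1) show ?thesis
    proof (cases rule: exchange_cases)
      case same
      then show ?thesis using sq_not_back[OF sq] D rev_rev by metis
    next
      case (square y r s)
      \<comment> \<open>This is the given square, with the corner spanned by \<open>rev p\<close> and \<open>a\<close>.\<close>
      have "sq (rev p) (rev r) a (rev s)" using sq_rot2[OF square(1)] D rev_rev by simp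
      then have "q = rev r" "rev b = rev s" using sq_unique[OF sq_rot[OF sq]] by blast+
      then have r: "r = rev q" and s: "s = b"
        using sq_D[OF square(1)] D rev_rev by metis+
      have "act q (swap_class w) = swap_class y" using square(2) r by (metis act_delete)
      moreover have "reduced (b # y)"
        using reduced_swaps[OF delete(3) square(3)] s by simp
      then have "act b (swap_class y) = swap_class (b # y)" using act_append D by blast
      moreover have "swap_class u = swap_class (b # y)" using square(3) s by (simp add: swap_class_eq)
      ultimately show ?thesis using 1 delete(2) by simp
    qed
  qed
qed

text \<open>If both ways start with a deletion then the walk arrives at the corner through the opposite
  corner of the square, and both ways lead back to the latter.\<close>

lemma act_square:
  assumes sq: "sq p a q b" and w: "reduced w"
  shows "act a (act p (swap_class w)) = act b (act q (swap_class w))"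
proof -
  note D = sq_D[OF sq]
  consider "reduced (p # w)" | "reduced (q # w)" | "\<not> reduced (p # w)" "\<not> reduced (q # w)" by blast
  then show ?thesis
  proof cases
    case 3
    obtain w' where w': "w \<sim> rev p # w'" using not_reduced_Cons 3(1) w D by blast
    obtain w'' where w'': "w \<sim> rev q # w''" using not_reduced_Cons 3(2) w D by blast
    have "rev p # w' \<sim> rev q # w''" using w' w'' by (metis swaps_sym swaps_trans)
    then show ?thesis
    proof (cases rule: exchange_cases)
      case same
      then have "p = q" using D rev_rev by metis
      then show ?thesis using sq_neq[OF sq] by blast
    next
      case (square y r s)
      have "sq p (rev r) q (rev s)" using sq_rot2[OF square(1)] D rev_rev by simp
      then have "a = rev r" "b = rev s" using sq_unique[OF sq] by blast+
      then have "r = rev a" "s = rev b" using sq_D[OF square(1)] rev_rev by metis+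
      then show ?thesis using w' w'' square by (metis act_delete)
    qed
  qed (use act_square_append[OF sq w] act_square_append[OF sq_sym[OF sq] w] in auto)
qed

end

section \<open>Simply connected square complexes\<close>

text \<open>Simple connectivity enters as the triviality of the monodromy of every system of state
  spaces that is transported along darts compatibly with the squares.  The states that matter are
  the classes of reduced walks.\<close>

fun transport :: "('d \<Rightarrow> 's \<Rightarrow> 's) \<Rightarrow> 'd list \<Rightarrow> 's \<Rightarrow> 's" where
  "transport T [] s = s"
| "transport T (a # w) s = T a (transport T w s)"

locale sc_square_complex = square_complex V D src tgt rev sq
  for V :: "'v set" and D :: "'d set" and src tgt :: "'d \<Rightarrow> 'v" and rev :: "'d \<Rightarrow> 'd"
    and sq :: "'d \<Rightarrow> 'd \<Rightarrow> 'd \<Rightarrow> 'd \<Rightarrow> bool" +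
  assumes connected: "x \<in> V \<Longrightarrow> y \<in> V \<Longrightarrow> \<exists>w. walk w x y"
    and monodromy: "\<lbrakk>\<And>d s. d \<in> D \<Longrightarrow> s \<in> \<Omega> (src d) \<Longrightarrow> T d s \<in> \<Omega> (tgt d) \<and> T (rev d) (T d s) = s;
       \<And>p a q b s. sq p a q b \<Longrightarrow> s \<in> \<Omega> (src p) \<Longrightarrow> T a (T p s) = T b (T q s);
       walk w x x; s \<in> \<Omega> x\<rbrakk> \<Longrightarrow> transport T w s = (s :: 'd list set)"
begin

lemma walk_append: "walk u y z \<Longrightarrow> walk w x y \<Longrightarrow> walk (u @ w) x z"
  by (induction u arbitrary: z) auto

lemma walk_V: "walk w x y \<Longrightarrow> x \<in> V \<and> y \<in> V"
  by (induction w arbitrary: y) (auto intro: tgt_V)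

fun inv_walk :: "'d list \<Rightarrow> 'd list" where
  "inv_walk [] = []"
| "inv_walk (a # w) = inv_walk w @ [rev a]"

lemma inv_walk: "walk w x y \<Longrightarrow> walk (inv_walk w) y x"
proof (induction w arbitrary: y)
  case (Cons a w)
  then have "walk [rev a] y (src a)" using rev_D src_rev tgt_rev src_V tgt_V by auto
  moreover have "walk (inv_walk w) (src a) x" using Cons by auto
  ultimately show ?case unfolding inv_walk.simps by (intro walk_append)
qed auto

lemma length_inv_walk [simp]: "length (inv_walk w) = length w"
  by (induction w) auto

lemma transport_append: "transport T (u @ w) s = transport T u (transport T w s)"
  by (induction u) auto

lemma transport_states: "walk w x y \<Longrightarrow> s \<in> states v x \<Longrightarrow> transport act w s \<in> states v y"
  by (induction w arbitrary: y) (auto simp: act_states)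

lemma transport_inv: "walk w x y \<Longrightarrow> s \<in> states v x \<Longrightarrow> transport act (inv_walk w) (transport act w s) = s"
proof (induction w arbitrary: y)
  case (Cons a w)
  then have "transport act w s \<in> states v (src a)" using transport_states by auto
  moreover have "transport act (inv_walk w) (transport act w s) = s" "a \<in> D" using Cons by auto
  ultimately show ?case by (simp add: transport_append act_states)
qed simp

lemma transport_reduced: "walk w x y \<Longrightarrow> reduced w \<Longrightarrow> transport act w (swap_class []) = swap_class w"
proof (induction w arbitrary: y)
  case (Cons a w)
  then have "transport act w (swap_class []) = swap_class w" using reduced_Cons by auto
  then show ?case using Cons.prems act_append by simp
qed simp

text \<open>Transport the class of the trivial walk along \<open>w\<close> and back along \<open>w'\<close>.  The monodromy of this closed
  walk is trivial, and transport along a reduced walk leads to its own class.\<close>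

lemma reduced_unique:
  assumes w: "walk w x y" "reduced w" and w': "walk w' x y" "reduced w'"
  shows "w \<sim> w'"
proof -
  have xV: "x \<in> V" using walk_V[OF w(1)] by blast
  have s0: "swap_class [] \<in> states x x" using xV reduced_Nil unfolding states_def by force
  have cl: "transport act (inv_walk w' @ w) (swap_class []) = swap_class []"
  proof (rule monodromy[where \<Omega> = "states x" and x = x])
    show "walk (inv_walk w' @ w) x x" using walk_append inv_walk[OF w'(1)] w(1) by blast
  next
    fix p a q b s assume "sq p a q b" "s \<in> states x (src p)"
    then show "act a (act p s) = act b (act q s)" unfolding states_def using act_square by auto
  qed (use act_states s0 in auto)
  have st: "swap_class w \<in> states x y" using w unfolding states_def by blast
  have "transport act (inv_walk w') (swap_class w) = swap_class []"
    using cl transport_reduced[OF w] by (simp add: transport_append)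
  moreover have "transport act (inv_walk w') (swap_class w') = swap_class []"
    using transport_inv[OF w'(1) s0] transport_reduced[OF w'] by simp
  moreover have "transport act (inv_walk (inv_walk w')) (transport act (inv_walk w') s) = s"
    if "s \<in> states x y" for s using transport_inv[OF inv_walk[OF w'(1)] that] .
  moreover have "swap_class w' \<in> states x y" using w' unfolding states_def by blast
  ultimately have "swap_class w = swap_class w'" using st by metis
  then show ?thesis by (simp add: swap_class_eq)
qed

section \<open>Distances\<close>

definition distance :: "'v \<Rightarrow> 'v \<Rightarrow> nat" where
  "distance x y = (LEAST n. \<exists>w. walk w x y \<and> length w = n)"

lemma distance_walk:
  assumes "x \<in> V" "y \<in> V"
  obtains w where "walk w x y" "length w = distance x y"
  using LeastI_ex[of "\<lambda>n. \<exists>w. walk w x y \<and> length w = n"] connected[OF assms] unfolding distance_def by blast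

lemma distance_le: "walk w x y \<Longrightarrow> distance x y \<le> length w"
  unfolding distance_def by (rule Least_le) blast

lemma backtrack_shorten: "backtrack w \<Longrightarrow> walk w x y \<Longrightarrow> \<exists>w'. walk w' x y \<and> length w' < length w"
proof (induction arbitrary: y rule: backtrack.induct)
  case (backtrack_here a z)
  then have "walk z x y" using src_rev tgt_rev rev_D by auto
  then show ?case by (intro exI[of _ z]) auto
next
  case (backtrack_Cons u a)
  then obtain w' where "walk w' x (src a)" "length w' < length u" by auto
  then show ?case using backtrack_Cons.prems by (intro exI[of _ "a # w'"]) auto
qed

lemma shortest_reduced:
  assumes "walk w x y" "length w = distance x y"
  shows "reduced w"
  unfolding reduced_def
proof (intro allI impI notI)
  fix w' assume "w \<sim> w'" "backtrack w'"
  then obtain w'' where "walk w'' x y" "length w'' < length w"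
    using backtrack_shorten swaps_walk[OF _ assms(1)] swaps_length by metis
  then show False using distance_le assms(2) by fastforce
qed

lemma reduced_length:
  assumes "walk w x y" "reduced w"
  shows "length w = distance x y"
proof -
  obtain w' where w': "walk w' x y" "length w' = distance x y" using distance_walk walk_V[OF assms(1)] by blast
  then have "w \<sim> w'" using reduced_unique assms shortest_reduced by blast
  then show ?thesis using swaps_length w' by metis
qed

lemma distance_sym:
  assumes "x \<in> V" "y \<in> V"
  shows "distance x y = distance y x"
proof -
  have "distance x y \<le> distance y x" if "x \<in> V" "y \<in> V" for x y
    using distance_walk[OF that(2,1)] distance_le[OF inv_walk] length_inv_walk by metis
  then show ?thesis using assms by (simp add: order_antisym)
qed

lemma distance_triangle: "x \<in> V \<Longrightarrow> y \<in> V \<Longrightarrow> z \<in> V \<Longrightarrow> distance x z \<le> distance x y + distance y z"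
  using distance_walk[of x y] distance_walk[of y z] distance_le[OF walk_append]
  by (metis add.commute length_append)

lemma distance_self [simp]: "x \<in> V \<Longrightarrow> distance x x = 0"
  using distance_le[of "[]" x x] by simp

lemma distance_0: "x \<in> V \<Longrightarrow> y \<in> V \<Longrightarrow> distance x y = 0 \<longleftrightarrow> x = y"
  using distance_walk[of x y] by (metis distance_self length_0_conv walk.simps(1))

text \<open>Up to swaps, a dart prolongs a geodesic or deletes its last edge.  In particular the graph is
  bipartite.\<close>

lemma distance_step:
  assumes "e \<in> D" "x \<in> V"
  shows "distance x (tgt e) = Suc (distance x (src e)) \<or> distance x (src e) = Suc (distance x (tgt e))"
proof -
  obtain w where w: "walk w x (src e)" "length w = distance x (src e)"
    using distance_walk src_V assms by blast
  have r: "reduced w" using shortest_reduced w by blast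
  show ?thesis
  proof (cases "reduced (e # w)")
    case True
    moreover have "walk (e # w) x (tgt e)" using w assms by simp
    ultimately show ?thesis using reduced_length w by (metis length_Cons)
  next
    case False
    then obtain w' where w': "w \<sim> rev e # w'" using not_reduced_Cons r assms by blast
    then have "walk (rev e # w') x (src e)" "reduced (rev e # w')"
      using swaps_walk w reduced_swaps r by blast+
    then have "walk w' x (tgt e)" "reduced w'" using src_rev assms reduced_Cons by auto
    then show ?thesis using reduced_length swaps_length[OF w'] w by force
  qed
qed

lemma dart_unique:
  assumes "e \<in> D" "f \<in> D" "src e = src f" "tgt e = tgt f"
  shows "e = f"
proof -
  have ne: "src g \<noteq> tgt g" if "g \<in> D" for g using distance_step[OF that, of "src g"] src_V[OF that] by (metis n_not_Suc_n)
  have red: "reduced [g]" if "g \<in> D" for g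
  proof (rule shortest_reduced)
    show g: "walk [g] (src g) (tgt g)" using that src_V by auto
    show "length [g] = distance (src g) (tgt g)"
      using distance_le[OF g] distance_0[of "src g" "tgt g"] ne that src_V tgt_V by (metis One_nat_def Suc_leI
        le_antisym length_Cons list.size(3) not_gr_zero)
  qed
  have "[e] \<sim> [f]" by (rule reduced_unique[of _ "src e" "tgt e"]) (use assms red src_V in auto)
  then show ?thesis by (cases rule: exchange_cases) (auto dest: swaps_length)
qed

lemma distance_dart: "e \<in> D \<Longrightarrow> distance (src e) (tgt e) = 1"
  using distance_step[of e "src e"] src_V by auto

lemma distance_1:
  assumes "x \<in> V" "y \<in> V" "distance x y = 1"
  obtains e where "e \<in> D" "src e = x" "tgt e = y"
proof -
  obtain w where "walk w x y" "length w = 1" using distance_walk assms by metis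
  then show ?thesis using that by (cases w) auto
qed

lemma last_dart:
  assumes "x \<in> V" "y \<in> V" "x \<noteq> y"
  obtains e where "e \<in> D" "tgt e = y" "distance x y = Suc (distance x (src e))"
proof -
  obtain w where w: "walk w x y" "length w = distance x y" using distance_walk assms by blast
  then obtain e w' where e: "w = e # w'" using assms by (cases w) auto
  have "length w' = distance x (src e)"
    using reduced_length[of w' x "src e"] reduced_Cons shortest_reduced[OF w] w e by auto
  then show ?thesis using that w e by auto
qed

text \<open>Geodesics through \<open>e\<close> and through \<open>f\<close> are reduced walks with the same ends, so they differ by
  swaps, and the exchange property provides the square.\<close>

lemma quadrangle:
  assumes "x \<in> V" "e \<in> D" "f \<in> D" "tgt e = tgt f" "e \<noteq> f"
    and de: "distance x (tgt e) = Suc (distance x (src e))" and df: "distance x (tgt f) = Suc (distance x (src f))"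
  shows "\<exists>p q. sq p e q f \<and> distance x (src e) = Suc (distance x (src p))"
proof -
  obtain u where u: "walk u x (src e)" "length u = distance x (src e)" using distance_walk src_V assms by blast
  obtain v where v: "walk v x (src f)" "length v = distance x (src f)" using distance_walk src_V assms by blast
  have "walk (e # u) x (tgt e)" "walk (f # v) x (tgt e)" using u v assms by auto
  moreover have "reduced (e # u)" "reduced (f # v)"
    using shortest_reduced[OF calculation(1)] shortest_reduced[OF calculation(2)] u v assms by auto
  ultimately have "e # u \<sim> f # v" using reduced_unique by blast
  then show ?thesis
  proof (cases rule: exchange_cases)
    case (square z p q)
    have "walk (p # z) x (src e)" "reduced (p # z)"
      using swaps_walk[OF square(2)] reduced_swaps[OF shortest_reduced[OF u] square(2)] u by auto
    then have "distance x (src e) = Suc (distance x (src p))"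
      using reduced_length[of "p # z" x "src e"] reduced_length[of z x "src p"] reduced_Cons by auto
    then show ?thesis using square by blast
  qed (use assms in auto)
qed

end

context sc_square_complex
begin

section \<open>Half-spaces\<close>

definition half_space :: "'d \<Rightarrow> 'v set" where
  "half_space e = {x \<in> V. distance x (src e) < distance x (tgt e)}"

lemma half_space_D:
  assumes "e \<in> D"
  shows "x \<in> half_space e \<longleftrightarrow> x \<in> V \<and> distance x (tgt e) = Suc (distance x (src e))"
    "x \<in> V \<Longrightarrow> x \<notin> half_space e \<longleftrightarrow> distance x (src e) = Suc (distance x (tgt e))"
  unfolding half_space_def using distance_step[OF assms, of x] by auto

lemma half_space_V: "x \<in> half_space e \<Longrightarrow> x \<in> V"
  unfolding half_space_def by blast

lemma half_space_rev: "e \<in> D \<Longrightarrow> half_space (rev e) = V - half_space e"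
proof (rule set_eqI)
  fix x assume e: "e \<in> D"
  show "x \<in> half_space (rev e) \<longleftrightarrow> x \<in> V - half_space e"
    using distance_step[OF e, of x] by (cases "x \<in> V") (auto simp: half_space_def src_rev tgt_rev e)
qed

lemma src_half_space: "e \<in> D \<Longrightarrow> src e \<in> half_space e"
  unfolding half_space_def using src_V distance_dart by simp

lemma tgt_half_space: "e \<in> D \<Longrightarrow> tgt e \<notin> half_space e"
  unfolding half_space_def using tgt_V by simp

text \<open>If \<open>x\<close> were in \<open>half_space p\<close> but not in \<open>half_space b\<close>, then \<open>tgt p\<close> would be the common target of
  the descending darts \<open>p\<close> and \<open>rev a\<close>.  The square is the one that they span, so by the quadrangle
  condition its last corner \<open>tgt q\<close> would be closer to \<open>x\<close> than \<open>src p\<close>; but it is farther.\<close>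

lemma half_space_sq_le:
  assumes sq: "sq p a q b" and x: "x \<in> half_space p"
  shows "x \<in> half_space b"
proof (rule ccontr)
  assume nb: "x \<notin> half_space b"
  note D = sq_D[OF sq] and E = sq_ends[OF sq]
  have xV: "x \<in> V" using x half_space_V by blast
  have 1: "distance x (tgt p) = Suc (distance x (src p))" using x half_space_D D by blast
  have 2: "distance x (src b) = Suc (distance x (tgt b))" using nb half_space_D D xV by blast
  have q: "distance x (src b) = Suc (distance x (src p)) \<or> distance x (src p) = Suc (distance x (src b))"
    using distance_step[of q x] D xV E by metis
  have a: "distance x (tgt a) = Suc (distance x (tgt p)) \<or> distance x (tgt p) = Suc (distance x (tgt a))"
    using distance_step[of a x] D xV E by metis
  have "distance x (src b) = Suc (distance x (tgt a))" using 2 E by simp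
  then have k: "distance x (tgt p) = Suc (distance x (src p))" "distance x (tgt a) = distance x (src p)"
    "distance x (src b) = Suc (distance x (src p))"
    using 1 q a by linarith+
  \<comment> \<open>The vertex \<open>tgt p\<close> has the descending edges \<open>p\<close> and \<open>rev a\<close>.\<close>
  have "tgt p = tgt (rev a)" "p \<noteq> rev a" using E D tgt_rev sq_not_back[OF sq] rev_rev by metis+
  moreover have "distance x (tgt (rev a)) = Suc (distance x (src (rev a)))" using k E D src_rev tgt_rev by simp
  ultimately obtain r s where rs: "sq r p s (rev a)" "distance x (src p) = Suc (distance x (src r))"
    using quadrangle[OF xV _ _ _ _ 1] D rev_D by metis
  have "sq (rev p) (rev r) a (rev s)" using sq_rot2[OF rs(1)] D rev_rev by simp
  then have "rev r = q" using sq_unique[OF sq_rot[OF sq]] by blast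
  then have "src r = tgt q" using sq_D[OF rs(1)] tgt_rev by metis
  then have "distance x (src r) = distance x (src b)" using E by simp
  then show False using rs(2) k by linarith
qed

lemma half_space_sq:
  assumes "sq p a q b"
  shows "half_space p = half_space b" "half_space q = half_space a"
proof -
  have "half_space p = half_space b" if sq: "sq p a q b" for p a q b
  proof -
    note D = sq_D[OF sq]
    have sq': "sq b (rev a) (rev q) p" by (rule sq_sym[OF sq_rot[OF sq_sym[OF sq]]])
    then show ?thesis using half_space_sq_le[OF sq'] half_space_sq_le[OF sq] by blast
  qed
  then show "half_space p = half_space b" "half_space q = half_space a"
    using assms sq_sym by blast+
qed

text \<open>An edge that leaves a half-space is opposite, in a square, to another one that is closer to
  \<open>e\<close>: the square is spanned by the two edges at its source that descend to \<open>tgt e\<close>, one of them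
  the edge itself.  By induction a ladder of squares leads to \<open>e\<close>.\<close>

lemma ladder_step:
  assumes e: "e \<in> D" and f: "f \<in> D" and c: "src f \<in> half_space e" and d: "tgt f \<notin> half_space e"
    and ne: "src f \<noteq> src e"
  obtains g s q where "sq g s q f" "src g \<in> half_space e" "tgt g \<notin> half_space e"
    "distance (src e) (src f) = Suc (distance (src e) (src g))"
proof -
  have V: "src e \<in> V" "tgt e \<in> V" "src f \<in> V" "tgt f \<in> V" using e f src_V tgt_V by auto
  have 1: "distance (tgt e) (src f) = Suc (distance (src e) (src f))"
    using c half_space_D(1)[OF e] distance_sym V by metis
  have 2: "distance (src e) (tgt f) = Suc (distance (tgt e) (tgt f))"
    using d half_space_D(2)[OF e] distance_sym V by metis
  have f1: "distance (src e) (tgt f) = Suc (distance (src e) (src f)) \<or>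
      distance (src e) (src f) = Suc (distance (src e) (tgt f))" using distance_step f V by blast
  have f2: "distance (tgt e) (tgt f) = Suc (distance (tgt e) (src f)) \<or>
      distance (tgt e) (src f) = Suc (distance (tgt e) (tgt f))" using distance_step f V by blast
  have k: "distance (src e) (tgt f) = Suc (distance (src e) (src f))"
     "distance (tgt e) (tgt f) = distance (src e) (src f)" using 1 2 f1 f2 by linarith+
  obtain g where g: "g \<in> D" "tgt g = src f" "distance (src e) (src f) = Suc (distance (src e) (src g))"
    by (rule last_dart[OF V(1,3)]) (use ne in auto)
  have "distance (tgt e) (src g) = distance (src e) (src f)"
  proof -
    have "distance (tgt e) (src g) \<le> Suc (distance (src e) (src g))"
      using distance_triangle[of "tgt e" "src e" "src g"] distance_dart[OF e] distance_sym V src_V[OF g(1)] by simp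
    moreover have "distance (tgt e) (tgt g) \<le> Suc (distance (tgt e) (src g))"
      using distance_step[OF g(1) V(2)] by auto
    ultimately show ?thesis using g 1 by simp
  qed
  then have 3: "distance (tgt e) (tgt g) = Suc (distance (tgt e) (src g))" using g 1 by simp
  have 4: "distance (tgt e) (tgt (rev f)) = Suc (distance (tgt e) (src (rev f)))"
    using f k 1 by (simp add: tgt_rev src_rev)
  have "g \<noteq> rev f" using g k f src_rev by force
  then obtain q r where qr: "sq q g r (rev f)" "distance (tgt e) (src g) = Suc (distance (tgt e) (src q))"
    using quadrangle[OF V(2) g(1) rev_D[OF f] _ _ 3 4] g(2) tgt_rev f by auto
  note D = sq_D[OF qr(1)] and E = sq_ends[OF qr(1)]
  \<comment> \<open>The rung before \<open>f\<close> is \<open>rev q\<close>, from \<open>src g\<close>.\<close>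
  have s: "sq (rev q) r g f" using sq_rot[OF qr(1)] rev_rev f by simp
  have gV: "src g \<in> V" using g src_V by blast
  have h1: "src (rev q) = src g" using D E src_rev by simp
  have h2: "tgt (rev q) = src q" using D tgt_rev by simp
  have sg: "src g \<in> half_space e"
    using half_space_D(1)[OF e] gV qr(2) g(3) \<open>distance (tgt e) (src g) = distance (src e) (src f)\<close>
      distance_sym V by simp
  have "distance (src e) (src q) \<ge> distance (src e) (src f)"
  proof -
    have "distance (src e) (tgt r) \<le> Suc (distance (src e) (src r))"
      using distance_step[of r "src e"] V D by auto
    moreover have "tgt r = tgt f" using E f src_rev by simp
    ultimately show ?thesis using E k by simp
  qed
  moreover have "Suc (distance (tgt e) (src q)) = distance (src e) (src f)"
    using qr(2) \<open>distance (tgt e) (src g) = distance (src e) (src f)\<close> by simp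
  ultimately have "src q \<notin> half_space e"
    unfolding half_space_def using distance_sym V src_V D by simp
  then show ?thesis using that[OF s] h1 h2 sg g(3) by simp
qed

lemma half_space_crossing:
  assumes "e \<in> D" "f \<in> D" "src f \<in> half_space e" "tgt f \<notin> half_space e"
  shows "half_space f = half_space e"
  using assms(2-)
proof (induction "distance (src e) (src f)" arbitrary: f rule: less_induct)
  case less
  have V: "src e \<in> V" "tgt e \<in> V" "src f \<in> V" "tgt f \<in> V" using assms(1) less.prems src_V tgt_V by auto
  show ?case
  proof (cases "src f = src e")
    case True
    have "distance (src e) (tgt f) = Suc (distance (tgt e) (tgt f))"
      using less.prems(3) half_space_D(2)[OF assms(1)] distance_sym V by metis
    moreover have "distance (src e) (tgt f) = 1" using distance_dart[OF less.prems(1)] True by simp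
    ultimately have "tgt f = tgt e" using distance_0 V by simp
    then show ?thesis using dart_unique[OF less.prems(1) assms(1) True] by simp
  next
    case False
    with ladder_step[OF assms(1) less.prems] obtain g s q where g: "sq g s q f"
      "src g \<in> half_space e" "tgt g \<notin> half_space e"
      "distance (src e) (src f) = Suc (distance (src e) (src g))" by metis
    then show ?thesis using less.hyps[of g] sq_D[OF g(1)] half_space_sq(1)[OF g(1)] by simp
  qed
qed

text \<open>The target of \<open>f\<close> is a neighbour of the source of \<open>e\<close> that is closer to the target of \<open>e\<close>.\<close>

lemma parallel_at_vertex:
  assumes "e \<in> D" "f \<in> D" "src e = src f" "half_space e = half_space f"
  shows "e = f"
proof -
  have V: "src e \<in> V" "tgt e \<in> V" "tgt f \<in> V" using assms src_V tgt_V by auto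
  have "distance (tgt f) (src e) = Suc (distance (tgt f) (tgt e))"
    using half_space_D(2)[OF assms(1) V(3)] tgt_half_space assms by blast
  then have "distance (tgt f) (tgt e) = 0" using distance_dart[OF assms(2)] assms(3) distance_sym[OF V(1,3)] by simp
  then have "tgt f = tgt e" using distance_0 V by blast
  then show ?thesis using dart_unique assms by metis
qed

lemma separating_dart:
  assumes "x \<in> V" "y \<in> V" "x \<noteq> y"
  obtains e where "e \<in> D" "src e = x" "y \<notin> half_space e" "distance y x = Suc (distance y (tgt e))"
proof -
  obtain e where e: "e \<in> D" "tgt e = x" "distance y x = Suc (distance y (src e))"
    using last_dart assms by metis
  then show ?thesis
    using that[of "rev e"] src_rev tgt_rev rev_D half_space_D(1)[of "rev e" y] assms
    by (simp add: half_space_rev)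
qed

section \<open>Consistent orientations are vertices\<close>

text \<open>Take a vertex \<open>x\<close> on the wrong side of as few half-spaces as possible.  Among the edges that leave
  a half-space on whose wrong side \<open>x\<close> is, take one with target as close as possible to \<open>x\<close>.  If the
  target is \<open>x\<close> then crossing the edge backwards is an improvement.  Otherwise the first edge from
  the target towards \<open>x\<close> either leaves such a half-space as well, or spans a square with the edge,
  whose opposite side is closer to \<open>x\<close>.\<close>

lemma consistent_orientation:
  assumes fin: "finite V" and x0: "x0 \<in> V" and C: "C \<subseteq> D"
    and total: "\<And>e. e \<in> D \<Longrightarrow> \<exists>f\<in>C. half_space f = half_space e \<or> half_space f = half_space (rev e)"
    and meet: "\<And>e f. e \<in> C \<Longrightarrow> f \<in> C \<Longrightarrow> half_space e \<inter> half_space f \<noteq> {}"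
  shows "\<exists>x\<in>V. \<forall>e\<in>C. x \<in> half_space e"
proof -
  define H where "H = half_space ` C"
  have finH: "finite H"
    by (rule finite_subset[of _ "Pow V"]) (auto simp: H_def fin dest: half_space_V)
  define wrong where "wrong x = card {h \<in> H. x \<notin> h}" for x
  obtain x where x: "x \<in> V" and min: "\<And>y. y \<in> V \<Longrightarrow> wrong x \<le> wrong y"
    using ex_has_least_nat[of "\<lambda>x. x \<in> V" x0 wrong] x0 by blast
  show ?thesis
  proof (rule ccontr)
    assume "\<not> ?thesis"
    then obtain e0 where e0: "e0 \<in> C" "x \<notin> half_space e0" using x by blast
    define Q where "Q f \<longleftrightarrow> f \<in> D \<and> half_space f \<in> H \<and> x \<notin> half_space f" for f
    have "Q e0" unfolding Q_def H_def using e0 C by blast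
    then obtain f where f: "Q f" and fmin: "\<And>g. Q g \<Longrightarrow> distance x (tgt f) \<le> distance x (tgt g)"
      using ex_has_least_nat[of Q e0 "\<lambda>f. distance x (tgt f)"] by blast
    have fD: "f \<in> D" "half_space f \<in> H" "x \<notin> half_space f" using f Q_def by auto
    have V: "src f \<in> V" "tgt f \<in> V" using fD src_V tgt_V by auto
    show False
    proof (cases "x = tgt f")
      case True
      have "{h \<in> H. src f \<notin> h} \<subset> {h \<in> H. x \<notin> h}"
      proof
        show "{h \<in> H. src f \<notin> h} \<subseteq> {h \<in> H. x \<notin> h}"
        proof safe
          fix h assume h: "h \<in> H" "src f \<notin> h" "x \<in> h"
          then obtain k where k: "k \<in> C" "h = half_space k" unfolding H_def by blast
          have kD: "k \<in> D" using k C by blast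
          have "half_space (rev f) = h"
            using half_space_crossing[OF kD rev_D[OF fD(1)]] h k True fD(1) src_rev tgt_rev by simp
          moreover have "half_space f \<inter> h \<noteq> {}" using meet fD(2) h(1) unfolding H_def by blast
          ultimately show False using half_space_rev[OF fD(1)] by blast
        qed
        show "{h \<in> H. src f \<notin> h} \<noteq> {h \<in> H. x \<notin> h}" using fD src_half_space by blast
      qed
      then have "wrong (src f) < wrong x" unfolding wrong_def using finH by (simp add: psubset_card_mono)
      then show False using min[OF V(1)] by simp
    next
      case False
      then obtain g where g: "g \<in> D" "src g = tgt f" "x \<notin> half_space g"
        "distance x (tgt f) = Suc (distance x (tgt g))"
        using separating_dart[OF V(2) x] by metis
      have closer: "\<not> Q g"
      proof
        assume "Q g"
        from fmin[OF this] show False using g(4) by simp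
      qed
      obtain k where k: "k \<in> C" "half_space k = half_space g \<or> half_space k = half_space (rev g)"
        using total[OF g(1)] by blast
      have "half_space k \<in> H" unfolding H_def using k(1) by (rule imageI)
      moreover have "half_space g \<notin> H" using closer g(1,3) unfolding Q_def by simp
      ultimately have "half_space (rev g) \<in> H" using k(2) by metis
      then obtain z where z: "z \<in> half_space f" "z \<in> half_space (rev g)"
        using meet fD(2) unfolding H_def by blast
      have zV: "z \<in> V" using z half_space_V by blast
      have 1: "distance z (tgt f) = Suc (distance z (src f))" using z half_space_D(1)[OF fD(1)] by blast
      have 2: "distance z (tgt (rev g)) = Suc (distance z (src (rev g)))"
        using z half_space_D(1)[OF rev_D[OF g(1)]] by blast
      have "f \<noteq> rev g"
      proof
        assume "f = rev g"
        then have "half_space f = V - half_space g" using half_space_rev[OF g(1)] by simp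
        then show False using fD(3) g(3) x by blast
      qed
      then obtain p q where pq: "sq p f q (rev g)"
        using quadrangle[OF zV fD(1) rev_D[OF g(1)] _ _ 1 2] g(1,2) tgt_rev by auto
      note D = sq_D[OF pq] and E = sq_ends[OF pq]
      have "half_space q = half_space f" using half_space_sq(2)[OF pq] .
      moreover have "tgt q = tgt g" using E g src_rev by simp
      ultimately have "Q q" unfolding Q_def using fD D by simp
      then show False using fmin[of q] g(4) \<open>tgt q = tgt g\<close> by simp
    qed
  qed
qed

end

section \<open>Reconstruction from boundary distances\<close>

text \<open>The vertices in terms of boundary distances: a side of each edge between boundary vertices
  is chosen, represented by the edge directed away from it, such that any two of the chosen
  half-spaces meet in the boundary.\<close>

definition orientations :: "'i set \<Rightarrow> ('i \<Rightarrow> 'i \<Rightarrow> nat) \<Rightarrow> ('i \<times> 'i) set set" where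
  "orientations I \<delta> = {S. S \<subseteq> {(i, j). i \<in> I \<and> j \<in> I \<and> \<delta> i j = 1} \<and>
     (\<forall>i\<in>I. \<forall>j\<in>I. \<delta> i j = 1 \<longrightarrow> ((i, j) \<in> S \<longleftrightarrow> (j, i) \<notin> S)) \<and>
     (\<forall>(i, j)\<in>S. \<forall>(k, l)\<in>S. \<exists>t\<in>I. \<delta> t i < \<delta> t j \<and> \<delta> t k < \<delta> t l)}"

text \<open>The boundary vertices are enumerated by \<open>\<beta>\<close> so that two complexes can be described in terms of the
  same index set.  A vertex off the boundary is assumed to have two edges that do not span a
  square, as this is what one needs to ascend from it.\<close>

locale bounded_complex = sc_square_complex V D src tgt rev sq
  for V :: "'v set" and D :: "'d set" and src tgt :: "'d \<Rightarrow> 'v" and rev :: "'d \<Rightarrow> 'd"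
    and sq :: "'d \<Rightarrow> 'd \<Rightarrow> 'd \<Rightarrow> 'd \<Rightarrow> bool" +
  fixes I :: "'i set" and \<beta> :: "'i \<Rightarrow> 'v"
  assumes finite_V: "finite V"
    and boundary_V: "i \<in> I \<Longrightarrow> \<beta> i \<in> V"
    and interior_vertex: "z \<in> V \<Longrightarrow> z \<notin> \<beta> ` I \<Longrightarrow>
      \<exists>p\<in>D. \<exists>q\<in>D. src p = z \<and> src q = z \<and> p \<noteq> q \<and> \<not> span_square p q"
begin

lemma two_descending:
  assumes "x \<in> V" "p \<in> D" "q \<in> D" "src p = src q" "p \<noteq> q"
    "distance x (src p) = Suc (distance x (tgt p))" "distance x (src q) = Suc (distance x (tgt q))"
  shows "span_square p q"
proof -
  have "rev p \<noteq> rev q" using assms(2,3,5) rev_rev by metis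
  then obtain r s where rs: "sq r (rev p) s (rev q)"
    using quadrangle[of x "rev p" "rev q"] assms
    by (auto simp only: src_rev tgt_rev rev_D)
  have "sq p (rev r) q (rev s)" using sq_rot2[OF rs] rev_rev assms(2,3) by simp
  then show ?thesis unfolding span_square_def by blast
qed

text \<open>Two descending edges would span a square.\<close>

lemma ascending:
  assumes "z \<in> V" "z \<notin> \<beta> ` I" "x \<in> V"
  obtains e where "e \<in> D" "src e = z" "distance x (tgt e) = Suc (distance x z)"
proof -
  obtain p q where pq: "p \<in> D" "q \<in> D" "src p = z" "src q = z" "p \<noteq> q" "\<not> span_square p q"
    using interior_vertex assms by blast
  then show ?thesis
    using two_descending[OF assms(3), of p q] distance_step[OF pq(1) assms(3)] distance_step[OF pq(2) assms(3)]
      that by metis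
qed

lemma farthest:
  assumes "P x" "\<And>y. P y \<Longrightarrow> y \<in> V"
  obtains z where "P z" "\<And>y. P y \<Longrightarrow> distance v y \<le> distance v z"
proof -
  have "\<exists>z. P z \<and> (\<forall>y. P y \<longrightarrow> distance v y \<le> distance v z)"
  proof (rule ex_has_greatest_nat[of P x "distance v" "Suc (Max (distance v ` V))"])
    show "P x" by (rule assms(1))
    show "\<forall>y. P y \<longrightarrow> distance v y < Suc (Max (distance v ` V))"
      using finite_V assms(2) by (auto simp: less_Suc_eq_le)
  qed
  then show ?thesis using that by blast
qed

text \<open>Geodesics can be prolonged up to the boundary, by ascending.\<close>

lemma extend_to_boundary:
  assumes "x \<in> V" "v \<in> V"
  obtains i where "i \<in> I" "distance v (\<beta> i) = distance v x + distance x (\<beta> i)"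
proof -
  define P where "P z \<longleftrightarrow> z \<in> V \<and> distance v z = distance v x + distance x z" for z
  have "P x" unfolding P_def using assms by simp
  then obtain z where z: "P z" and max: "\<And>y. P y \<Longrightarrow> distance v y \<le> distance v z"
    using farthest[of P x v] unfolding P_def by blast
  have zV: "z \<in> V" using z P_def by blast
  have "z \<in> \<beta> ` I"
  proof (rule ccontr)
    assume "z \<notin> \<beta> ` I"
    with ascending zV assms(2) obtain e where e: "e \<in> D" "src e = z" "distance v (tgt e) = Suc (distance v z)"
      by metis
    have "distance v (tgt e) \<le> distance v x + distance x (tgt e)" using distance_triangle assms tgt_V e by blast
    moreover have "distance x (tgt e) \<le> Suc (distance x z)" using distance_step[OF e(1) assms(1)] e(2) by auto
    ultimately have "P (tgt e)" using z e tgt_V unfolding P_def by auto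
    then show False using max e(3) by force
  qed
  then show ?thesis using that z unfolding P_def by auto
qed

end

text \<open>The two-dimensional case.  Two darts that span squares with \<open>f\<close> stand for two squares that
  contain \<open>f\<close>.\<close>

locale bounded_square_complex = bounded_complex V D src tgt rev sq I \<beta>
  for V :: "'v set" and D :: "'d set" and src tgt :: "'d \<Rightarrow> 'v" and rev :: "'d \<Rightarrow> 'd"
    and sq :: "'d \<Rightarrow> 'd \<Rightarrow> 'd \<Rightarrow> 'd \<Rightarrow> bool" and I :: "'i set" and \<beta> :: "'i \<Rightarrow> 'v" +
  assumes boundary_edge: "f \<in> D \<Longrightarrow> \<not> (src f \<in> \<beta> ` I \<and> tgt f \<in> \<beta> ` I) \<Longrightarrow>
      \<exists>q q'. q \<noteq> q' \<and> span_square f q \<and> span_square f q'"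
begin

text \<open>Take an edge of the hyperplane that is farthest from \<open>e\<close>.  If it were in two squares, then in
  both the opposite edge would be closer to \<open>e\<close>, so the two edges that lead to them would descend
  and span a square.  With the edge itself they form a triangle in the link.\<close>

lemma boundary_representative:
  assumes e: "e \<in> D"
  obtains f i j where "f \<in> D" "i \<in> I" "j \<in> I" "src f = \<beta> i" "tgt f = \<beta> j" "half_space f = half_space e"
proof -
  define P where "P x \<longleftrightarrow> (\<exists>f\<in>D. src f = x \<and> half_space f = half_space e)" for x
  have "P (src e)" unfolding P_def using e by blast
  then obtain x where "P x" and max: "\<And>y. P y \<Longrightarrow> distance (src e) y \<le> distance (src e) x"
    using farthest[of P "src e" "src e"] src_V unfolding P_def by blast
  then obtain f where f: "f \<in> D" "src f = x" "half_space f = half_space e" unfolding P_def by blast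
  have V: "src e \<in> V" using e src_V by blast
  have "src f \<in> \<beta> ` I \<and> tgt f \<in> \<beta> ` I"
  proof (rule ccontr)
    assume "\<not> ?thesis"
    from boundary_edge[OF f(1) this]
    obtain q q' where q: "q \<noteq> q'" "span_square f q" "span_square f q'" by blast
    have desc: "r \<in> D \<and> src r = src f \<and> distance (src e) (src r) = Suc (distance (src e) (tgt r))"
      if r: "span_square f r" for r
    proof -
      obtain a b where s: "sq f a r b" using r unfolding span_square_def by blast
      have r: "r \<in> D" "src r = x" "b \<in> D" "src b = tgt r"
        using sq_D[OF s] sq_ends[OF s] f(2) by simp_all
      have "half_space b = half_space e" using half_space_sq(1)[OF s] f(3) by simp
      then have "P (tgt r)" unfolding P_def using r(3,4) by blast
      from max[OF this] distance_step[OF r(1) V] show ?thesis using r f(2) by simp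
    qed
    have "span_square q q'" using two_descending[OF V _ _ _ q(1)] desc[OF q(2)] desc[OF q(3)] by metis
    then show False using no_triangle q by blast
  qed
  then show ?thesis using that f by blast
qed

text \<open>If the complements of the half-spaces meet as well, ascend away from a vertex \<open>v\<close> of both
  complements: this never crosses one of the hyperplanes, since crossing it
  would lead closer to \<open>v\<close>.  Otherwise each end of a boundary edge of the first hyperplane lies in
  one of the half-spaces, and the source of that edge in both: if not, the two half-spaces would be
  complementary.\<close>

lemma boundary_meets_quarter:
  assumes e: "e \<in> D" and f: "f \<in> D" and z: "z \<in> half_space e" "z \<in> half_space f"
  obtains i where "i \<in> I" "\<beta> i \<in> half_space e" "\<beta> i \<in> half_space f"
proof (cases "\<exists>v\<in>V. v \<notin> half_space e \<and> v \<notin> half_space f")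
  case True
  then obtain v where v: "v \<in> V" "v \<notin> half_space e" "v \<notin> half_space f" by blast
  define P where "P x \<longleftrightarrow> x \<in> half_space e \<and> x \<in> half_space f" for x
  obtain x where x: "P x" and max: "\<And>y. P y \<Longrightarrow> distance v y \<le> distance v x"
    using farthest[of P z v] z half_space_V unfolding P_def by blast
  have stay: "tgt g \<in> half_space h"
    if "g \<in> D" "h \<in> D" "src g \<in> half_space h" "v \<notin> half_space h" "distance v (tgt g) = Suc (distance v (src g))" for g h
  proof (rule ccontr)
    assume "tgt g \<notin> half_space h"
    then have "half_space g = half_space h" using half_space_crossing that by blast
    then show False using that v(1) half_space_D(1)[of g v] by blast
  qed
  have "x \<in> \<beta> ` I"
  proof (rule ccontr)
    assume "x \<notin> \<beta> ` I"
    moreover have "x \<in> V" using x half_space_V unfolding P_def by blast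
    ultimately obtain g where g: "g \<in> D" "src g = x" "distance v (tgt g) = Suc (distance v x)"
      using ascending v(1) by metis
    then have "P (tgt g)" using stay[of g] x e f v unfolding P_def by auto
    then show False using max g(3) by force
  qed
  then show ?thesis using that x unfolding P_def by blast
next
  case False
  obtain g i j where g: "g \<in> D" "i \<in> I" "j \<in> I" "src g = \<beta> i" "tgt g = \<beta> j" "half_space g = half_space e"
    using boundary_representative[OF e] by metis
  have i: "\<beta> i \<in> half_space e" using src_half_space g by metis
  have "\<beta> j \<notin> half_space e" using tgt_half_space g by metis
  then have j: "\<beta> j \<in> half_space f" using False boundary_V g by blast
  have "\<beta> i \<in> half_space f"
  proof (rule ccontr)
    assume "\<beta> i \<notin> half_space f"
    then have "half_space (rev g) = half_space f"
      using half_space_crossing[OF f rev_D[OF g(1)]] g j src_rev tgt_rev by simp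
    then show False using half_space_rev[OF g(1)] g(6) z by blast
  qed
  then show ?thesis using that i g by blast
qed

text \<open>The half-spaces that contain \<open>x\<close>, given by their boundary edges.\<close>

definition code :: "'v \<Rightarrow> ('i \<times> 'i) set" where
  "code x = {(i, j). i \<in> I \<and> j \<in> I \<and> distance (\<beta> i) (\<beta> j) = 1 \<and> distance x (\<beta> i) < distance x (\<beta> j)}"

lemma boundary_dart:
  assumes "i \<in> I" "j \<in> I" "distance (\<beta> i) (\<beta> j) = 1"
  obtains g where "g \<in> D" "src g = \<beta> i" "tgt g = \<beta> j"
  using distance_1[OF boundary_V boundary_V] assms by metis

lemma code_dart:
  assumes "i \<in> I" "j \<in> I" "g \<in> D" "src g = \<beta> i" "tgt g = \<beta> j" "x \<in> V"
  shows "(i, j) \<in> code x \<longleftrightarrow> x \<in> half_space g"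
  using assms distance_dart[OF assms(3)] unfolding code_def half_space_def by auto

lemma code_separates:
  assumes "e \<in> D" "x \<in> half_space e" "y \<in> V" "y \<notin> half_space e"
  obtains g i j where "g \<in> D" "i \<in> I" "j \<in> I" "src g = \<beta> i" "tgt g = \<beta> j" "half_space g = half_space e"
    "(i, j) \<in> code x - code y"
proof -
  obtain g i j where g: "g \<in> D" "i \<in> I" "j \<in> I" "src g = \<beta> i" "tgt g = \<beta> j" "half_space g = half_space e"
    using boundary_representative assms by metis
  then have "(i, j) \<in> code x - code y" using code_dart[of i j g] assms half_space_V by auto
  then show ?thesis using that g by blast
qed

lemma code_inj: "inj_on code V"
proof (rule inj_onI, rule ccontr)
  fix x y assume xy: "x \<in> V" "y \<in> V" "code x = code y" "x \<noteq> y"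
  then obtain e where "e \<in> D" "src e = x" "y \<notin> half_space e" using separating_dart by metis
  then show False using code_separates[of e x y] src_half_space xy by auto
qed

text \<open>Adjacent vertices are separated by the hyperplane of their edge only.  Along a longer geodesic the
  first two edges belong to different hyperplanes, and these differ on the boundary because
  the vertex between the two edges lies in a quarter, which contains a boundary vertex.\<close>

lemma adjacent_iff_code:
  assumes x: "x \<in> V" and y: "y \<in> V"
  shows "distance x y = 1 \<longleftrightarrow> code x \<noteq> code y \<and>
    (\<forall>(i, j) \<in> code x - code y. \<forall>(k, l) \<in> code x - code y. \<forall>t\<in>I.
       distance (\<beta> t) (\<beta> i) < distance (\<beta> t) (\<beta> j) \<longleftrightarrow> distance (\<beta> t) (\<beta> k) < distance (\<beta> t) (\<beta> l))"
    (is "_ \<longleftrightarrow> _ \<and> ?same")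
proof (intro iffI conjI)
  assume 1: "distance x y = 1"
  then show "code x \<noteq> code y" using x y inj_onD[OF code_inj, of x y] by auto
  obtain e where e: "e \<in> D" "src e = x" "tgt e = y" using distance_1 1 x y by metis
  have "distance (\<beta> t) (\<beta> i) < distance (\<beta> t) (\<beta> j) \<longleftrightarrow> \<beta> t \<in> half_space e"
    if "(i, j) \<in> code x - code y" "t \<in> I" for i j t
  proof -
    have ij: "i \<in> I" "j \<in> I" "distance (\<beta> i) (\<beta> j) = 1" using that unfolding code_def by auto
    obtain g where g: "g \<in> D" "src g = \<beta> i" "tgt g = \<beta> j" using boundary_dart ij by metis
    then have "x \<in> half_space g" "y \<notin> half_space g"
      using code_dart[of i j g] ij x y that by auto
    then have "half_space e = half_space g" using half_space_crossing g e by blast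
    then show ?thesis using boundary_V that(2) g unfolding half_space_def by auto
  qed
  then show ?same by blast
next
  assume rhs: "code x \<noteq> code y \<and> ?same"
  show "distance x y = 1"
  proof (rule ccontr)
    assume n1: "distance x y \<noteq> 1"
    have "x \<noteq> y" using rhs by blast
    then obtain e where e: "e \<in> D" "src e = x" "y \<notin> half_space e" "distance y x = Suc (distance y (tgt e))"
      using separating_dart x y by metis
    have V: "tgt e \<in> V" using e tgt_V by blast
    have "tgt e \<noteq> y" using n1 e distance_dart by blast
    then obtain f where f: "f \<in> D" "src f = tgt e" "y \<notin> half_space f" "distance y (tgt e) = Suc (distance y (tgt f))"
      using separating_dart V y by metis
    have Vf: "tgt f \<in> V" using f tgt_V by blast
    have xf: "x \<in> half_space f"
    proof -
      have "distance y x = Suc (Suc (distance y (tgt f)))" using e f by simp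
      moreover have "distance y x \<le> distance y (tgt f) + distance x (tgt f)"
        using distance_triangle[OF y Vf x] distance_sym[OF Vf x] by simp
      moreover have "distance x (src f) = 1" using e f distance_dart by auto
      ultimately show ?thesis unfolding half_space_def using x by simp
    qed
    obtain g i j where g: "g \<in> D" "i \<in> I" "j \<in> I" "src g = \<beta> i" "tgt g = \<beta> j"
      "half_space g = half_space e" "(i, j) \<in> code x - code y"
      using code_separates[OF e(1) _ y e(3), of x] e src_half_space by metis
    obtain h k l where h: "h \<in> D" "k \<in> I" "l \<in> I" "src h = \<beta> k" "tgt h = \<beta> l"
      "half_space h = half_space f" "(k, l) \<in> code x - code y"
      using code_separates[OF f(1) xf y f(3)] by metis
    have same: "\<beta> t \<in> half_space e \<longleftrightarrow> \<beta> t \<in> half_space f" if "t \<in> I" for t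
    proof -
      have "distance (\<beta> t) (\<beta> i) < distance (\<beta> t) (\<beta> j) \<longleftrightarrow> distance (\<beta> t) (\<beta> k) < distance (\<beta> t) (\<beta> l)"
        using rhs g(7) h(7) that by blast
      then have "\<beta> t \<in> half_space g \<longleftrightarrow> \<beta> t \<in> half_space h"
        unfolding half_space_def g(4,5) h(4,5) using boundary_V[OF that] by blast
      then show ?thesis using g h by simp
    qed
    have "tgt e \<in> half_space f" "tgt e \<in> half_space (rev e)"
      using f src_half_space[OF f(1)] src_half_space[OF rev_D[OF e(1)]] src_rev e(1) by auto
    then obtain t where "t \<in> I" "\<beta> t \<in> half_space f" "\<beta> t \<in> half_space (rev e)"
      using boundary_meets_quarter[OF f(1) rev_D[OF e(1)]] by metis
    then show False using same half_space_rev[OF e(1)] by blast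
  qed
qed

lemma code_image:
  assumes "V \<noteq> {}"
  shows "code ` V = orientations I (\<lambda>i j. distance (\<beta> i) (\<beta> j))"
proof (intro equalityI subsetI)
  fix S assume "S \<in> code ` V"
  then obtain x where x: "x \<in> V" "S = code x" by blast
  have "(i, j) \<in> S \<longleftrightarrow> (j, i) \<notin> S" if ij: "i \<in> I" "j \<in> I" "distance (\<beta> i) (\<beta> j) = 1" for i j
  proof -
    obtain g where "g \<in> D" "src g = \<beta> i" "tgt g = \<beta> j" using boundary_dart ij by metis
    then show ?thesis
      using distance_step[of g x] ij x distance_sym[OF boundary_V boundary_V] unfolding code_def by auto
  qed
  moreover have "\<exists>t\<in>I. distance (\<beta> t) (\<beta> i) < distance (\<beta> t) (\<beta> j) \<and> distance (\<beta> t) (\<beta> k) < distance (\<beta> t) (\<beta> l)"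
    if "(i, j) \<in> S" "(k, l) \<in> S" for i j k l
  proof -
    have I: "i \<in> I" "j \<in> I" "k \<in> I" "l \<in> I" "distance (\<beta> i) (\<beta> j) = 1" "distance (\<beta> k) (\<beta> l) = 1"
      using that x unfolding code_def by auto
    obtain g where g: "g \<in> D" "src g = \<beta> i" "tgt g = \<beta> j" using boundary_dart I by metis
    obtain h where h: "h \<in> D" "src h = \<beta> k" "tgt h = \<beta> l" using boundary_dart I by metis
    have "x \<in> half_space g" "x \<in> half_space h"
      using code_dart[OF _ _ g] code_dart[OF _ _ h] I that x by auto
    then obtain t where "t \<in> I" "\<beta> t \<in> half_space g" "\<beta> t \<in> half_space h"
      using boundary_meets_quarter g(1) h(1) by metis
    then show ?thesis using g h unfolding half_space_def by auto
  qed
  ultimately show "S \<in> orientations I (\<lambda>i j. distance (\<beta> i) (\<beta> j))"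
    unfolding orientations_def x(2) by (auto simp: code_def)
next
  fix S assume S: "S \<in> orientations I (\<lambda>i j. distance (\<beta> i) (\<beta> j))"
  then have Ssub: "\<And>i j. (i, j) \<in> S \<Longrightarrow> i \<in> I \<and> j \<in> I \<and> distance (\<beta> i) (\<beta> j) = 1"
    and Stot: "\<And>i j. i \<in> I \<Longrightarrow> j \<in> I \<Longrightarrow> distance (\<beta> i) (\<beta> j) = 1 \<Longrightarrow> (i, j) \<in> S \<longleftrightarrow> (j, i) \<notin> S"
    and Scon: "\<And>i j k l. (i, j) \<in> S \<Longrightarrow> (k, l) \<in> S \<Longrightarrow>
      \<exists>t\<in>I. distance (\<beta> t) (\<beta> i) < distance (\<beta> t) (\<beta> j) \<and> distance (\<beta> t) (\<beta> k) < distance (\<beta> t) (\<beta> l)"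
    unfolding orientations_def by blast+
  define C where "C = {g \<in> D. \<exists>(i, j)\<in>S. src g = \<beta> i \<and> tgt g = \<beta> j}"
  obtain x0 where "x0 \<in> V" using assms by blast
  have "\<exists>x\<in>V. \<forall>e\<in>C. x \<in> half_space e"
  proof (rule consistent_orientation[OF finite_V \<open>x0 \<in> V\<close>])
    show "C \<subseteq> D" unfolding C_def by blast
  next
    fix e assume e: "e \<in> D"
    obtain g i j where g: "g \<in> D" "i \<in> I" "j \<in> I" "src g = \<beta> i" "tgt g = \<beta> j" "half_space g = half_space e"
      using boundary_representative e by metis
    have d: "distance (\<beta> i) (\<beta> j) = 1" using distance_dart[OF g(1)] g by simp
    show "\<exists>f\<in>C. half_space f = half_space e \<or> half_space f = half_space (rev e)"
    proof (cases "(i, j) \<in> S")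
      case True
      then show ?thesis using g unfolding C_def by blast
    next
      case False
      then have "(j, i) \<in> S" using Stot g d by blast
      then have "rev g \<in> C" unfolding C_def using g rev_D src_rev tgt_rev by fastforce
      moreover have "half_space (rev g) = half_space (rev e)"
        using half_space_rev[OF g(1)] half_space_rev[OF e] g by simp
      ultimately show ?thesis by blast
    qed
  next
    fix e f assume "e \<in> C" "f \<in> C"
    then obtain i j k l where e: "e \<in> D" "(i, j) \<in> S" "src e = \<beta> i" "tgt e = \<beta> j"
      and f: "f \<in> D" "(k, l) \<in> S" "src f = \<beta> k" "tgt f = \<beta> l" unfolding C_def by blast
    then obtain t where "t \<in> I" "distance (\<beta> t) (\<beta> i) < distance (\<beta> t) (\<beta> j)"
      "distance (\<beta> t) (\<beta> k) < distance (\<beta> t) (\<beta> l)" using Scon by blast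
    then have "\<beta> t \<in> half_space e \<inter> half_space f" unfolding half_space_def using e f boundary_V by auto
    then show "half_space e \<inter> half_space f \<noteq> {}" by blast
  qed
  then obtain x where x: "x \<in> V" "\<And>e. e \<in> C \<Longrightarrow> x \<in> half_space e" by blast
  have sub: "(i, j) \<in> code x" if ij: "(i, j) \<in> S" for i j
  proof -
    obtain g where g: "g \<in> D" "src g = \<beta> i" "tgt g = \<beta> j" using boundary_dart Ssub[OF ij] by metis
    then have "g \<in> C" unfolding C_def using ij by blast
    then show ?thesis using x g code_dart Ssub[OF ij] by blast
  qed
  have "(i, j) \<in> S" if "(i, j) \<in> code x" for i j
  proof (rule ccontr)
    assume "(i, j) \<notin> S"
    moreover have "i \<in> I" "j \<in> I" "distance (\<beta> i) (\<beta> j) = 1" using that unfolding code_def by auto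
    ultimately have "(j, i) \<in> code x" using Stot sub by blast
    then show False using that unfolding code_def by auto
  qed
  then have "S = code x" using sub by auto
  then show "S \<in> code ` V" using x by blast
qed

end

text \<open>The distances to the leaves of the vertex between the leaves \<open>i\<close> and \<open>j\<close> at distance \<open>k\<close> from \<open>i\<close>:
  a geodesic to a third leaf continues one of those from \<open>i\<close> and \<open>j\<close> to that vertex.\<close>

definition tree_codes :: "'i set \<Rightarrow> ('i \<Rightarrow> 'i \<Rightarrow> nat) \<Rightarrow> ('i \<Rightarrow> nat) set" where
  "tree_codes I \<delta> = {\<lambda>t. if t \<in> I then max (\<delta> t i - k) (\<delta> t j - (\<delta> i j - k)) else 0 |i j k.
     i \<in> I \<and> j \<in> I \<and> k \<le> \<delta> i j}"

locale bounded_tree = bounded_complex V D src tgt rev sq I \<beta>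
  for V :: "'v set" and D :: "'d set" and src tgt :: "'d \<Rightarrow> 'v" and rev :: "'d \<Rightarrow> 'd"
    and sq :: "'d \<Rightarrow> 'd \<Rightarrow> 'd \<Rightarrow> 'd \<Rightarrow> bool" and I :: "'i set" and \<beta> :: "'i \<Rightarrow> 'v" +
  assumes no_square: "\<not> sq p a q b"
begin

lemma geodesic_crossing:
  assumes e: "e \<in> D" and t: "t \<in> V" "t \<notin> half_space e" and u: "u \<in> half_space e"
  obtains f where "f \<in> D" "src f \<in> half_space e" "tgt f \<notin> half_space e"
    "distance u t = Suc (distance u (src f) + distance (tgt f) t)"
proof -
  have "\<exists>f\<in>D. src f \<in> half_space e \<and> tgt f \<notin> half_space e \<and>
      distance u t = Suc (distance u (src f) + distance (tgt f) t)"
    using u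
  proof (induction "distance u t" arbitrary: u rule: less_induct)
    case less
    have uV: "u \<in> V" using less.prems half_space_V by blast
    have "u \<noteq> t" using less.prems t by blast
    then obtain g where g: "g \<in> D" "src g = u" "distance t u = Suc (distance t (tgt g))"
      using separating_dart[OF uV t(1)] by metis
    have gV: "tgt g \<in> V" using g tgt_V by blast
    have d: "distance u t = Suc (distance (tgt g) t)" using g distance_sym[OF t(1)] uV gV by simp
    show ?case
    proof (cases "tgt g \<in> half_space e")
      case True
      then obtain f where f: "f \<in> D" "src f \<in> half_space e" "tgt f \<notin> half_space e"
        "distance (tgt g) t = Suc (distance (tgt g) (src f) + distance (tgt f) t)"
        using less.hyps[of "tgt g"] d by auto
      have fV: "src f \<in> V" "tgt f \<in> V" using f src_V tgt_V by auto
      have "distance u (src f) \<le> Suc (distance (tgt g) (src f))"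
        using distance_triangle[OF uV gV fV(1)] distance_dart[OF g(1)] g(2) by simp
      moreover have "distance u t \<le> distance u (src f) + distance (src f) t" "distance (src f) t \<le> Suc (distance (tgt f) t)"
        using distance_triangle[OF uV fV(1) t(1)] distance_triangle[OF fV t(1)] distance_dart[OF f(1)] by auto
      ultimately have "distance u t = Suc (distance u (src f) + distance (tgt f) t)" using d f(4) by linarith
      then show ?thesis using f by blast
    next
      case False
      then show ?thesis using g less.prems d uV by (intro bexI[of _ g]) auto
    qed
  qed
  then show ?thesis using that by blast
qed

text \<open>Let \<open>e\<close> be the first edge from \<open>x\<close> towards \<open>t\<close>.  It is the only edge that crosses its hyperplane, as
  there are no squares, so \<open>x\<close> is between \<open>t\<close> and every vertex on its own side of \<open>e\<close>.  One of \<open>u\<close>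
  and \<open>w\<close> is on this side, since otherwise there would be a shortcut from \<open>u\<close> to \<open>w\<close> that
  avoids \<open>x\<close>.\<close>

lemma tree_between:
  assumes V: "x \<in> V" "u \<in> V" "w \<in> V" "t \<in> V" and btw: "distance u w = distance x u + distance x w"
  shows "distance t u = distance t x + distance x u \<or> distance t w = distance t x + distance x w"
proof (cases "x = t")
  case False
  then obtain e where e: "e \<in> D" "src e = x" "t \<notin> half_space e" "distance t x = Suc (distance t (tgt e))"
    using separating_dart V by metis
  have far: "distance t y = distance t x + distance x y" if y: "y \<in> half_space e" for y
  proof -
    obtain f where f: "f \<in> D" "src f \<in> half_space e" "tgt f \<notin> half_space e"
      "distance y t = Suc (distance y (src f) + distance (tgt f) t)" using geodesic_crossing e(1,3) V(4) y by metis
    have "src f = src e" using ladder_step[OF e(1) f(1-3)] no_square by metis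
    moreover have "half_space f = half_space e" using half_space_crossing e(1) f(1-3) by blast
    ultimately have "f = e" using parallel_at_vertex e f by blast
    then have "distance y t = Suc (distance y x + distance (tgt e) t)" using f e by simp
    then show ?thesis using e V distance_sym half_space_V[OF y] tgt_V by (metis add_Suc_right add.commute)
  qed
  show ?thesis
  proof (cases "u \<in> half_space e \<or> w \<in> half_space e")
    case True
    then show ?thesis using far by blast
  next
    case False
    have "distance u x = Suc (distance u (tgt e))" "distance w x = Suc (distance w (tgt e))"
      using False half_space_D(2)[OF e(1)] V e(2) by auto
    moreover have "distance u w \<le> distance u (tgt e) + distance w (tgt e)"
      using distance_triangle[of u "tgt e" w] distance_sym V tgt_V[OF e(1)] by metis
    ultimately show ?thesis using btw distance_sym V by fastforce
  qed
qed (use V in simp)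

definition tree_code :: "'v \<Rightarrow> 'i \<Rightarrow> nat" where
  "tree_code x = (\<lambda>t. if t \<in> I then distance x (\<beta> t) else 0)"

lemma tree_code_between:
  assumes x: "x \<in> V" and I: "i \<in> I" "j \<in> I"
    and btw: "distance (\<beta> i) (\<beta> j) = distance x (\<beta> i) + distance x (\<beta> j)"
  shows "tree_code x = (\<lambda>t. if t \<in> I then max (distance (\<beta> t) (\<beta> i) - distance x (\<beta> i))
    (distance (\<beta> t) (\<beta> j) - (distance (\<beta> i) (\<beta> j) - distance x (\<beta> i))) else 0)"
proof (rule ext)
  fix t
  have "distance x (\<beta> t) = max (distance (\<beta> t) (\<beta> i) - distance x (\<beta> i)) (distance (\<beta> t) (\<beta> j) - distance x (\<beta> j))"
    if t: "t \<in> I"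
  proof -
    have V: "\<beta> i \<in> V" "\<beta> j \<in> V" "\<beta> t \<in> V" using I t boundary_V by auto
    have "distance (\<beta> t) (\<beta> i) \<le> distance (\<beta> t) x + distance x (\<beta> i)" "distance (\<beta> t) (\<beta> j) \<le> distance (\<beta> t) x + distance x (\<beta> j)"
      using distance_triangle V x by blast+
    then show ?thesis using tree_between[OF x V btw] distance_sym[OF V(3) x] by auto
  qed
  then show "tree_code x t = (if t \<in> I then max (distance (\<beta> t) (\<beta> i) - distance x (\<beta> i))
    (distance (\<beta> t) (\<beta> j) - (distance (\<beta> i) (\<beta> j) - distance x (\<beta> i))) else 0)"
    unfolding tree_code_def btw by simp
qed

lemma point_between:
  assumes "u \<in> V" "w \<in> V" "k \<le> distance u w"
  obtains x where "x \<in> V" "distance x u = k" "distance u w = distance x u + distance x w"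
proof -
  have "\<exists>x\<in>V. distance x u = k \<and> distance u w = distance x u + distance x w"
    using assms
  proof (induction "distance u w - k" arbitrary: k)
    case 0
    then have "distance w u = k" "distance w w = 0" "distance u w = k" using distance_sym[of w u] by simp_all
    then show ?case using 0 by (intro bexI[of _ w]) simp_all
  next
    case (Suc n)
    have "n = distance u w - Suc k" "Suc k \<le> distance u w" using Suc.hyps(2) by linarith+
    from Suc.hyps(1)[OF this(1) Suc.prems(1,2) this(2)]
    obtain y where y: "y \<in> V" "distance y u = Suc k" "distance u w = distance y u + distance y w"
      by (elim bexE conjE) (rule that)
    then have "u \<noteq> y" by auto
    then obtain e where e: "e \<in> D" "tgt e = y" "distance u y = Suc (distance u (src e))"
      using last_dart Suc.prems y by metis
    have V: "src e \<in> V" using e src_V by blast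
    have k: "distance (src e) u = k" using e y distance_sym[OF Suc.prems(1)] V by simp
    have "distance u w \<le> distance u (src e) + distance (src e) w" using distance_triangle Suc.prems V by blast
    moreover have "distance (src e) w \<le> Suc (distance y w)"
      using distance_triangle[OF V y(1) Suc.prems(2)] distance_dart[OF e(1)] e(2) by simp
    ultimately have "distance u w = distance (src e) u + distance (src e) w"
      using k y distance_sym[OF V Suc.prems(1)] by linarith
    then show ?case using V k by blast
  qed
  then show ?thesis using that by blast
qed

lemma tree_code_image:
  assumes "V \<noteq> {}"
  shows "tree_code ` V = tree_codes I (\<lambda>i j. distance (\<beta> i) (\<beta> j))"
proof (intro equalityI subsetI)
  fix c assume "c \<in> tree_code ` V"
  then obtain x where x: "x \<in> V" "c = tree_code x" by blast
  obtain i where i: "i \<in> I" using extend_to_boundary[OF x(1) x(1)] by metis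
  obtain j where j: "j \<in> I" "distance (\<beta> i) (\<beta> j) = distance (\<beta> i) x + distance x (\<beta> j)"
    using extend_to_boundary[OF x(1) boundary_V[OF i]] by metis
  then have "distance (\<beta> i) (\<beta> j) = distance x (\<beta> i) + distance x (\<beta> j)" using distance_sym boundary_V i x by metis
  then show "c \<in> tree_codes I (\<lambda>i j. distance (\<beta> i) (\<beta> j))"
    unfolding tree_codes_def x(2) using tree_code_between[OF x(1) i j(1)] i j by fastforce
next
  fix c assume "c \<in> tree_codes I (\<lambda>i j. distance (\<beta> i) (\<beta> j))"
  then obtain i j k where I: "i \<in> I" "j \<in> I" "k \<le> distance (\<beta> i) (\<beta> j)"
    "c = (\<lambda>t. if t \<in> I then max (distance (\<beta> t) (\<beta> i) - k) (distance (\<beta> t) (\<beta> j) - (distance (\<beta> i) (\<beta> j) - k)) else 0)"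
    unfolding tree_codes_def by blast
  obtain x where x: "x \<in> V" "distance x (\<beta> i) = k" "distance (\<beta> i) (\<beta> j) = distance x (\<beta> i) + distance x (\<beta> j)"
    by (rule point_between[OF boundary_V[OF I(1)] boundary_V[OF I(2)] I(3)])
  have "tree_code x = c" unfolding I(4) tree_code_between[OF x(1) I(1,2) x(3)] x(2) ..
  then show "c \<in> tree_code ` V" using x(1) by blast
qed

text \<open>The geodesic from \<open>x\<close> to \<open>y\<close> extends to a leaf, where the two codes differ by exactly the distance.\<close>

lemma tree_code_dist:
  assumes "x \<in> V" "y \<in> V"
  shows "distance x y \<le> n \<longleftrightarrow> (\<forall>t\<in>I. tree_code x t \<le> tree_code y t + n)"
proof
  assume n: "distance x y \<le> n"
  show "\<forall>t\<in>I. tree_code x t \<le> tree_code y t + n"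
  proof
    fix t assume "t \<in> I"
    then show "tree_code x t \<le> tree_code y t + n"
      using distance_triangle[OF assms boundary_V[of t]] n unfolding tree_code_def by auto
  qed
next
  assume n: "\<forall>t\<in>I. tree_code x t \<le> tree_code y t + n"
  obtain i where "i \<in> I" "distance x (\<beta> i) = distance x y + distance y (\<beta> i)"
    using extend_to_boundary assms(2,1) by metis
  then show "distance x y \<le> n" using n unfolding tree_code_def by auto
qed

lemma tree_code_inj: "inj_on tree_code V"
proof (rule inj_onI)
  fix x y assume "x \<in> V" "y \<in> V" "tree_code x = tree_code y"
  then have "distance x y \<le> 0" using tree_code_dist[of x y 0] by simp
  then show "x = y" using distance_0 \<open>x \<in> V\<close> \<open>y \<in> V\<close> by simp
qed

lemma tree_code_adjacent:
  assumes "x \<in> V" "y \<in> V"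
  shows "distance x y = 1 \<longleftrightarrow> tree_code x \<noteq> tree_code y \<and> (\<forall>t\<in>I. tree_code x t \<le> tree_code y t + 1)"
proof -
  have "distance x y = 1 \<longleftrightarrow> x \<noteq> y \<and> distance x y \<le> 1" using distance_0[OF assms] by auto
  then show ?thesis using tree_code_dist[OF assms] tree_code_inj assms by (auto dest: inj_onD)
qed

end

section \<open>Sections of a local system along a homotopy\<close>

lemma simply_connected_imp_connected_general:
  fixes S :: "'a::topological_space set"
  assumes "simply_connected S"
  shows "connected S"
proof (intro path_connected_imp_connected, unfold path_connected_def, intro ballI)
  fix a b assume ab: "a \<in> S" "b \<in> S"
  have c: "path (\<lambda>x::real. c) \<and> pathfinish (\<lambda>x. c) = pathstart (\<lambda>x::real. c) \<and> path_image (\<lambda>x::real. c) \<subseteq> S"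
    if "c \<in> S" for c :: 'a
    using that unfolding path_def path_image_def pathstart_def pathfinish_def by auto
  have "homotopic_loops S (\<lambda>x. a) (\<lambda>x. b)"
    using assms c[OF ab(1)] c[OF ab(2)] unfolding simply_connected_def by blast
  then obtain h where h: "continuous_on ({0..1::real} \<times> {0..1::real}) h" "h \<in> ({0..1} \<times> {0..1}) \<rightarrow> S"
      "\<forall>x\<in>{0..1}. h (0, x) = a" "\<forall>x\<in>{0..1}. h (1, x) = b"
    unfolding homotopic_loops by blast
  have "continuous_on {0..1} (\<lambda>t. h (t, 0))"
    by (rule continuous_on_compose2[OF h(1)]) (auto intro!: continuous_intros)
  then show "\<exists>g. path g \<and> path_image g \<subseteq> S \<and> pathstart g = a \<and> pathfinish g = b"
    using h by (intro exI[of _ "\<lambda>t. h (t, 0)"])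
      (auto simp: path_def path_image_def pathstart_def pathfinish_def)
qed

text \<open>A local system on a space that is decomposed into cells: \<open>car x\<close> is the cell whose interior contains
  \<open>x\<close>, and \<open>res c\<close> restricts a state on a cell bijectively to a state on its face \<open>c\<close>.
  The first axiom says that the open stars of the cells are open.\<close>

locale local_system =
  fixes S :: "'a::topological_space set" and car :: "'a \<Rightarrow> 'c" and le :: "'c \<Rightarrow> 'c \<Rightarrow> bool"
    and fib :: "'c \<Rightarrow> 'f set" and res :: "'c \<Rightarrow> 'f \<Rightarrow> 'f"
  assumes open_star: "x \<in> S \<Longrightarrow> \<exists>U. open U \<and> x \<in> U \<and> (\<forall>y\<in>U \<inter> S. le (car x) (car y))"
    and res_fib: "le c d \<Longrightarrow> \<tau> \<in> fib d \<Longrightarrow> res c \<tau> \<in> fib c"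
    and res_surj: "le c d \<Longrightarrow> \<sigma> \<in> fib c \<Longrightarrow> \<exists>\<tau>\<in>fib d. res c \<tau> = \<sigma>"
    and res_inj: "le c d \<Longrightarrow> \<tau> \<in> fib d \<Longrightarrow> \<tau>' \<in> fib d \<Longrightarrow> res c \<tau> = res c \<tau>' \<Longrightarrow> \<tau> = \<tau>'"
    and res_res: "le b c \<Longrightarrow> le c d \<Longrightarrow> \<tau> \<in> fib d \<Longrightarrow> res b (res c \<tau>) = res b \<tau>"
    and res_id: "\<tau> \<in> fib c \<Longrightarrow> res c \<tau> = \<tau>"
begin

text \<open>The state on the cell of \<open>h z\<close> determines the states at all nearby points, whose cells have it as a
  face.\<close>

definition is_section :: "'z::topological_space set \<Rightarrow> ('z \<Rightarrow> 'a) \<Rightarrow> ('z \<Rightarrow> 'f) \<Rightarrow> bool" where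
  "is_section A h L \<longleftrightarrow> (\<forall>z\<in>A. L z \<in> fib (car (h z)) \<and>
     (\<exists>U. open U \<and> z \<in> U \<and> (\<forall>z'\<in>U \<inter> A. le (car (h z)) (car (h z')) \<and> res (car (h z)) (L z') = L z)))"

lemma is_section_fib: "is_section A h L \<Longrightarrow> z \<in> A \<Longrightarrow> L z \<in> fib (car (h z))"
  unfolding is_section_def by blast

lemma is_section_nbhd:
  assumes "is_section A h L" "z \<in> A"
  shows "\<exists>U. open U \<and> z \<in> U \<and>
    (\<forall>z'\<in>U \<inter> A. le (car (h z)) (car (h z')) \<and> res (car (h z)) (L z') = L z)"
  using bspec[OF assms(1)[unfolded is_section_def] assms(2)] by (rule conjunct2)

lemma is_sectionI:
  assumes "\<And>z. z \<in> A \<Longrightarrow> L z \<in> fib (car (h z))"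
    and "\<And>z. z \<in> A \<Longrightarrow> \<exists>U. open U \<and> z \<in> U \<and>
      (\<forall>z'\<in>U \<inter> A. le (car (h z)) (car (h z')) \<and> res (car (h z)) (L z') = L z)"
  shows "is_section A h L"
  unfolding is_section_def by (intro ballI conjI assms)

lemma is_section_subset:
  assumes L: "is_section A h L" and B: "B \<subseteq> A"
  shows "is_section B h L"
proof (rule is_sectionI)
  fix z assume z: "z \<in> B"
  then have zA: "z \<in> A" using B by blast
  show "L z \<in> fib (car (h z))" using is_section_fib[OF L zA] .
  obtain U where "open U" "z \<in> U"
    "\<forall>z'\<in>U \<inter> A. le (car (h z)) (car (h z')) \<and> res (car (h z)) (L z') = L z"
    using is_section_nbhd[OF L zA] by blast
  then show "\<exists>U. open U \<and> z \<in> U \<and>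
      (\<forall>z'\<in>U \<inter> B. le (car (h z)) (car (h z')) \<and> res (car (h z)) (L z') = L z)"
    using B by (intro exI[of _ U]) auto
qed

text \<open>Both agreement and disagreement are open, as restriction is injective.\<close>

lemma is_section_unique:
  assumes "connected A" "is_section A h L" "is_section A h L'" "z0 \<in> A" "L z0 = L' z0" "z \<in> A"
  shows "L z = L' z"
proof -
  define E where "E = {z \<in> A. L z = L' z}"
  define N where "N = {z \<in> A. L z \<noteq> L' z}"
  have both: "\<exists>U. open U \<and> z \<in> U \<and> (\<forall>z'\<in>U \<inter> A. L z' = L' z' \<longleftrightarrow> L z = L' z)" if z: "z \<in> A" for z
  proof -
    obtain U where U: "open U" "z \<in> U"
      "\<forall>z'\<in>U \<inter> A. le (car (h z)) (car (h z')) \<and> res (car (h z)) (L z') = L z"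
      using is_section_nbhd[OF assms(2) z] by blast
    obtain U' where U': "open U'" "z \<in> U'"
      "\<forall>z'\<in>U' \<inter> A. le (car (h z)) (car (h z')) \<and> res (car (h z)) (L' z') = L' z"
      using is_section_nbhd[OF assms(3) z] by blast
    have "L z' = L' z' \<longleftrightarrow> L z = L' z" if z': "z' \<in> (U \<inter> U') \<inter> A" for z'
    proof -
      have le: "le (car (h z)) (car (h z'))" and r: "res (car (h z)) (L z') = L z"
        and r': "res (car (h z)) (L' z') = L' z"
        using U(3) U'(3) z' by blast+
      have "L z' \<in> fib (car (h z'))" "L' z' \<in> fib (car (h z'))"
        using is_section_fib[OF assms(2)] is_section_fib[OF assms(3)] z' by blast+
      then show ?thesis using res_inj[OF le] r r' by metis
    qed
    then show ?thesis using U(1,2) U'(1,2) by (intro exI[of _ "U \<inter> U'"]) auto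
  qed
  have op: "openin (top_of_set A) {z \<in> A. (L z = L' z) = b}" for b
  proof (subst openin_subopen, intro ballI)
    fix z assume z: "z \<in> {z \<in> A. (L z = L' z) = b}"
    then obtain U where U: "open U" "z \<in> U" "\<forall>z'\<in>U \<inter> A. L z' = L' z' \<longleftrightarrow> L z = L' z" using both by blast
    then have "openin (top_of_set A) (A \<inter> U)" "z \<in> A \<inter> U" "A \<inter> U \<subseteq> {z \<in> A. (L z = L' z) = b}"
      using z by (auto simp: openin_open)
    then show "\<exists>T. openin (top_of_set A) T \<and> z \<in> T \<and> T \<subseteq> {z \<in> A. (L z = L' z) = b}" by blast
  qed
  have "openin (top_of_set A) E" "openin (top_of_set A) N"
    using op[of True] op[of False] unfolding E_def N_def by simp_all
  moreover have "A \<subseteq> E \<union> N" "E \<inter> N = {}" "E \<noteq> {}" unfolding E_def N_def using assms(4,5) by blast+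
  ultimately have "N = {}" using assms(1) unfolding connected_openin by blast
  then show ?thesis using assms(6) unfolding N_def by blast
qed

lemma is_section_cong:
  assumes L: "is_section A h L" and eq: "\<And>z. z \<in> A \<Longrightarrow> g z = h z \<and> N z = L z"
  shows "is_section A g N"
proof (rule is_sectionI)
  fix z assume z: "z \<in> A"
  show "N z \<in> fib (car (g z))" using is_section_fib[OF L z] eq[OF z] by simp
  show "\<exists>U. open U \<and> z \<in> U \<and>
      (\<forall>z'\<in>U \<inter> A. le (car (g z)) (car (g z')) \<and> res (car (g z)) (N z') = N z)"
    using is_section_nbhd[OF L z] eq z by simp
qed

lemma is_section_glue:
  assumes 1: "is_section A h L" and 2: "is_section B h M" and cl: "closed A" "closed B"
    and eq: "\<And>z. z \<in> A \<Longrightarrow> z \<in> B \<Longrightarrow> L z = M z"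
  shows "is_section (A \<union> B) h (\<lambda>z. if z \<in> A then L z else M z)" (is "is_section _ _ ?N")
proof (rule is_sectionI)
  fix z assume z: "z \<in> A \<union> B"
  have NB: "?N z = M z" if "z \<in> B" for z using eq that by auto
  show "?N z \<in> fib (car (h z))" using z is_section_fib[OF 1] is_section_fib[OF 2] by auto
  have "\<exists>U. open U \<and> z \<in> U \<and> (\<forall>z'\<in>U \<inter> A. le (car (h z)) (car (h z')) \<and> res (car (h z)) (L z') = ?N z)"
  proof (cases "z \<in> A")
    case True
    then show ?thesis using 1 unfolding is_section_def by simp
  next
    case False
    then show ?thesis using cl(1) by (intro exI[of _ "- A"]) auto
  qed
  then obtain U where U: "open U" "z \<in> U"
    "\<And>z'. z' \<in> U \<inter> A \<Longrightarrow> le (car (h z)) (car (h z')) \<and> res (car (h z)) (L z') = ?N z" by blast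
  have "\<exists>U. open U \<and> z \<in> U \<and> (\<forall>z'\<in>U \<inter> B. le (car (h z)) (car (h z')) \<and> res (car (h z)) (M z') = ?N z)"
  proof (cases "z \<in> B")
    case True
    then show ?thesis using 2 unfolding is_section_def NB[OF True] by simp
  next
    case False
    then show ?thesis using cl(2) by (intro exI[of _ "- B"]) auto
  qed
  then obtain U' where U': "open U'" "z \<in> U'"
    "\<And>z'. z' \<in> U' \<inter> B \<Longrightarrow> le (car (h z)) (car (h z')) \<and> res (car (h z)) (M z') = ?N z" by blast
  show "\<exists>U. open U \<and> z \<in> U \<and> (\<forall>z'\<in>U \<inter> (A \<union> B). le (car (h z)) (car (h z')) \<and> res (car (h z)) (?N z') = ?N z)"
    by (intro exI[of _ "U \<inter> U'"]) (use U U' NB in auto)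
qed

lemma is_section_compose:
  assumes L: "is_section A h L" and f: "continuous_on C f" "f ` C \<subseteq> A"
  shows "is_section C (h \<circ> f) (L \<circ> f)"
proof (rule is_sectionI)
  fix z assume z: "z \<in> C"
  then have fz: "f z \<in> A" using f by blast
  then show "(L \<circ> f) z \<in> fib (car ((h \<circ> f) z))" using is_section_fib[OF L] by simp
  obtain U where U: "open U" "f z \<in> U"
    "\<forall>z'\<in>U \<inter> A. le (car (h (f z))) (car (h z')) \<and> res (car (h (f z))) (L z') = L (f z)"
    using is_section_nbhd[OF L fz] by blast
  obtain W where W: "open W" "W \<inter> C = f -` U \<inter> C"
    using f(1)[unfolded continuous_on_open_invariant, rule_format, OF U(1)] by blast
  have "z \<in> W" using W(2) U(2) z by auto
  moreover have "f z' \<in> U \<and> f z' \<in> A" if "z' \<in> W \<inter> C" for z' using W(2) f(2) that by auto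
  ultimately show "\<exists>U. open U \<and> z \<in> U \<and> (\<forall>z'\<in>U \<inter> C. le (car ((h \<circ> f) z)) (car ((h \<circ> f) z')) \<and>
      res (car ((h \<circ> f) z)) ((L \<circ> f) z') = (L \<circ> f) z)"
    using U(3) W(1) by (intro exI[of _ W]) simp
qed

lemma star_preimage:
  assumes h: "continuous_on A h" "h ` A \<subseteq> S" and z: "z \<in> A"
  shows "\<exists>U. open U \<and> z \<in> U \<and> (\<forall>z'\<in>U \<inter> A. le (car (h z)) (car (h z')))"
proof -
  have hz: "h z \<in> S" using h(2) z by blast
  obtain U where U: "open U" "h z \<in> U" "\<forall>y\<in>U \<inter> S. le (car (h z)) (car y)"
    using open_star[OF hz] by blast
  obtain W where W: "open W" "W \<inter> A = h -` U \<inter> A"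
    using h(1)[unfolded continuous_on_open_invariant, rule_format, OF U(1)] by blast
  have "z \<in> W" using W(2) U(2) z by auto
  moreover have "h z' \<in> U \<inter> S" if "z' \<in> W \<inter> A" for z' using W(2) h(2) that by auto
  ultimately show ?thesis using U(3) W(1) by (intro exI[of _ W]) simp
qed

lemma is_section_restrict:
  assumes h: "continuous_on A h" "h ` A \<subseteq> S" and le: "\<And>z. z \<in> A \<Longrightarrow> le (car (h z)) c" and \<tau>: "\<tau> \<in> fib c"
  shows "is_section A h (\<lambda>z. res (car (h z)) \<tau>)"
proof (rule is_sectionI)
  fix z assume z: "z \<in> A"
  show "res (car (h z)) \<tau> \<in> fib (car (h z))" by (rule res_fib[OF le[OF z] \<tau>])
  obtain U where "open U" "z \<in> U" "\<And>z'. z' \<in> U \<inter> A \<Longrightarrow> le (car (h z)) (car (h z'))"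
    using star_preimage[OF h z] by blast
  then show "\<exists>U. open U \<and> z \<in> U \<and> (\<forall>z'\<in>U \<inter> A. le (car (h z)) (car (h z')) \<and>
      res (car (h z)) (res (car (h z')) \<tau>) = res (car (h z)) \<tau>)"
    using res_res[OF _ le \<tau>] by (intro exI[of _ U]) simp
qed

lemma is_section_extend:
  assumes h: "continuous_on A h" "h ` A \<subseteq> S" and le: "\<And>z. z \<in> A \<Longrightarrow> le c (car (h z))" and \<sigma>: "\<sigma> \<in> fib c"
  shows "is_section A h (\<lambda>z. SOME \<tau>. \<tau> \<in> fib (car (h z)) \<and> res c \<tau> = \<sigma>)" (is "is_section A h ?L")
proof -
  have L: "?L z \<in> fib (car (h z)) \<and> res c (?L z) = \<sigma>" if "z \<in> A" for z
    by (rule someI_ex) (use res_surj[OF le \<sigma>] that in blast)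
  show ?thesis
  proof (rule is_sectionI)
    fix z assume z: "z \<in> A"
    show "?L z \<in> fib (car (h z))" using L z by blast
    obtain U where U: "open U" "z \<in> U" "\<And>z'. z' \<in> U \<inter> A \<Longrightarrow> le (car (h z)) (car (h z'))"
      using star_preimage[OF h z] by blast
    have "res (car (h z)) (?L z') = ?L z" if z': "z' \<in> U \<inter> A" for z'
    proof (rule res_inj[OF le[OF z]])
      show "res (car (h z)) (?L z') \<in> fib (car (h z))" using res_fib U(3) z' L by blast
      show "?L z \<in> fib (car (h z))" using L z by blast
      show "res c (res (car (h z)) (?L z')) = res c (?L z)"
        using res_res[OF le[OF z] U(3)[OF z']] L z z' by auto
    qed
    then show "\<exists>U. open U \<and> z \<in> U \<and> (\<forall>z'\<in>U \<inter> A. le (car (h z)) (car (h z')) \<and> res (car (h z)) (?L z') = ?L z)"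
      using U by blast
  qed
qed

lemma is_section_join:
  assumes L: "is_section {0..1} p L" and M: "is_section {0..1} q M"
    and pq: "pathfinish p = pathstart q" "L 1 = M 0"
  shows "is_section {0..1} (p +++ q) (\<lambda>t. if t \<le> 1/2 then L (2 * t) else M (2 * t - 1))"
    (is "is_section _ _ ?N")
proof -
  have 1: "is_section {0..1/2} (p +++ q) ?N"
    by (rule is_section_cong[OF is_section_compose[OF L, of _ "\<lambda>t. 2 * t"]])
      (auto intro!: continuous_intros simp: joinpaths_def)
  have 2: "is_section {1/2..1} (p +++ q) ?N"
  proof (rule is_section_cong[OF is_section_compose[OF M, of _ "\<lambda>t. 2 * t - 1"]])
    fix t :: real assume t: "t \<in> {1/2..1}"
    show "(p +++ q) t = (q \<circ> (\<lambda>t. 2 * t - 1)) t \<and> ?N t = (M \<circ> (\<lambda>t. 2 * t - 1)) t"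
    proof (cases "t = 1/2")
      case True
      show ?thesis unfolding True using pq by (simp add: joinpaths_def pathstart_def pathfinish_def)
    next
      case False
      then show ?thesis using t by (simp add: joinpaths_def)
    qed
  qed (auto intro!: continuous_intros)
  have "{0..1/2} \<union> {1/2..1} = {0..1::real}" by auto
  then show ?thesis using is_section_glue[OF 1 2] by simp
qed

text \<open>The existence part of the continuation of sections.\<close>

definition extendable :: "'z::topological_space set \<Rightarrow> ('z \<Rightarrow> 'a) \<Rightarrow> bool" where
  "extendable A h \<longleftrightarrow> (\<forall>z\<in>A. \<forall>\<sigma>\<in>fib (car (h z)). \<exists>L. is_section A h L \<and> L z = \<sigma>)"

text \<open>Near a point the state is restricted to the cell \<open>c\<close> of that point and extended to the cells
  of the star again.\<close>

lemma extendable_local: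
  assumes h: "continuous_on A h" "h ` A \<subseteq> S" and le: "\<And>z. z \<in> A \<Longrightarrow> le c (car (h z))"
  shows "extendable A h"
  unfolding extendable_def
proof (intro ballI)
  fix z \<sigma> assume z: "z \<in> A" and \<sigma>: "\<sigma> \<in> fib (car (h z))"
  define L where "L = (\<lambda>z. SOME \<tau>. \<tau> \<in> fib (car (h z)) \<and> res c \<tau> = res c \<sigma>)"
  have r: "res c \<sigma> \<in> fib c" using res_fib[OF le[OF z] \<sigma>] .
  have "\<exists>\<tau>. \<tau> \<in> fib (car (h z)) \<and> res c \<tau> = res c \<sigma>" using \<sigma> by blast
  then have "L z \<in> fib (car (h z)) \<and> res c (L z) = res c \<sigma>"
    unfolding L_def by (rule someI_ex)
  then have "L z = \<sigma>" using res_inj[OF le[OF z] _ \<sigma>] by blast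
  moreover have "is_section A h L" unfolding L_def by (rule is_section_extend[OF h le r])
  ultimately show "\<exists>L. is_section A h L \<and> L z = \<sigma>" by blast
qed

lemma extendable_Un:
  assumes A: "extendable A h" "closed A" and B: "extendable B h" "closed B"
    and AB: "connected (A \<inter> B)" "A \<inter> B \<noteq> {}"
  shows "extendable (A \<union> B) h"
proof -
  have *: "\<exists>L. is_section (A \<union> B) h L \<and> L z = \<sigma>"
    if A: "extendable A h" "closed A" and B: "extendable B h" "closed B"
      and AB: "connected (A \<inter> B)" "A \<inter> B \<noteq> {}" and z: "z \<in> A" "\<sigma> \<in> fib (car (h z))" for A B z \<sigma>
  proof -
    obtain L where L: "is_section A h L" "L z = \<sigma>" using A z unfolding extendable_def by blast
    obtain w where w: "w \<in> A" "w \<in> B" using AB by blast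
    obtain M where M: "is_section B h M" "M w = L w"
      using B w is_section_fib[OF L(1) w(1)] unfolding extendable_def by blast
    have "L y = M y" if "y \<in> A" "y \<in> B" for y
      by (rule is_section_unique[OF AB(1), of h _ _ w])
        (use is_section_subset[OF L(1)] is_section_subset[OF M(1)] w M(2) that in auto)
    then have "is_section (A \<union> B) h (\<lambda>z. if z \<in> A then L z else M z)"
      by (intro is_section_glue L M A B)
    then show ?thesis using L z by (intro exI[of _ "\<lambda>z. if z \<in> A then L z else M z"]) auto
  qed
  show ?thesis unfolding extendable_def
    using *[OF A B AB] *[OF B A] AB by (auto simp: Un_commute Int_commute)
qed

text \<open>Continuation over the square, by bisection in each coordinate: sections on adjacent
  rectangles agree on the common side if they agree at one point of it.\<close>

lemma extendable_square:
  fixes h :: "real \<times> real \<Rightarrow> 'a"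
  assumes h: "continuous_on ({0..1} \<times> {0..1}) h" "h ` ({0..1} \<times> {0..1}) \<subseteq> S"
  shows "extendable ({0..1} \<times> {0..1}) h"
proof -
  \<comment> \<open>Over a given interval of the first coordinate, all sufficiently thin strips around the level
      \<open>y\<close> of the second coordinate are extendable.\<close>
  define thin where "thin y a b \<delta> \<longleftrightarrow> (\<forall>c d. c \<le> y \<longrightarrow> y \<le> d \<longrightarrow> d - c < \<delta> \<longrightarrow> 0 \<le> c \<longrightarrow> d \<le> 1 \<longrightarrow>
      extendable ({a..b} \<times> {c..d}) h)" for y a b \<delta>
  define P where "P y a b \<longleftrightarrow> (0 \<le> a \<longrightarrow> b \<le> 1 \<longrightarrow> (\<exists>\<delta>>0. thin y a b \<delta>))" for y a b
  have strip: "P y a b" if y: "0 \<le> y" "y \<le> 1" and ab: "a \<le> b" for a b y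
    using ab
  proof (induction a b rule: Bolzano)
    case (trans a b c)
    show ?case unfolding P_def
    proof (intro impI)
      assume ac: "0 \<le> a" "c \<le> 1"
      have "\<exists>\<delta>>0. thin y a b \<delta>" "\<exists>\<delta>>0. thin y b c \<delta>"
        using trans(1-4) ac unfolding P_def by simp_all
      then obtain \<delta> \<delta>' where d: "\<delta> > 0" "\<delta>' > 0" "thin y a b \<delta>" "thin y b c \<delta>'" by blast
      have "thin y a c (min \<delta> \<delta>')" unfolding thin_def
      proof (intro allI impI)
        fix c' d' assume c: "c' \<le> y" "y \<le> d'" "d' - c' < min \<delta> \<delta>'" "0 \<le> c'" "d' \<le> 1"
        have e: "extendable ({a..b} \<times> {c'..d'}) h" "extendable ({b..c} \<times> {c'..d'}) h"
          using d(3,4) c unfolding thin_def by simp_all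
        have "{a..c} = {a..b} \<union> {b..c}" using trans by auto
        then have 1: "{a..c} \<times> {c'..d'} = {a..b} \<times> {c'..d'} \<union> {b..c} \<times> {c'..d'}" by blast
        have 2: "{a..b} \<times> {c'..d'} \<inter> {b..c} \<times> {c'..d'} = {b} \<times> {c'..d'}" using trans by auto
        have "connected ({b} \<times> {c'..d'})" by (intro connected_Times) auto
        moreover have "{b} \<times> {c'..d'} \<noteq> {}" using c by auto
        ultimately show "extendable ({a..c} \<times> {c'..d'}) h"
          unfolding 1 using e 2 by (intro extendable_Un closed_Times) auto
      qed
      then show "\<exists>\<delta>>0. thin y a c \<delta>" using d(1,2) by (intro exI[of _ "min \<delta> \<delta>'"]) simp
    qed
  next
    case (local x)
    show ?case
    proof (cases "0 \<le> x \<and> x \<le> 1")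
      case False
      then show ?thesis unfolding P_def by (intro exI[of _ 1]) auto
    next
      case True
      then obtain U where U: "open U" "(x, y) \<in> U"
        "\<And>z. z \<in> U \<inter> {0..1} \<times> {0..1} \<Longrightarrow> le (car (h (x, y))) (car (h z))"
        using star_preimage[OF h, of "(x, y)"] y by auto
      obtain A B where AB: "open A" "open B" "x \<in> A" "y \<in> B" "A \<times> B \<subseteq> U"
        using open_prod_elim[OF U(1,2)] by (metis mem_Sigma_iff)
      obtain e where e: "e > 0" "ball x e \<subseteq> A" using AB(1,3) open_contains_ball by blast
      obtain e' where e': "e' > 0" "ball y e' \<subseteq> B" using AB(2,4) open_contains_ball by blast
      show ?thesis
      proof (intro exI[of _ e] conjI allI impI e(1))
        fix a b assume ab: "a \<le> x \<and> x \<le> b \<and> b - a < e"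
        then have "{a..b} \<subseteq> ball x e" by (auto simp: dist_real_def)
        then have sub1: "{a..b} \<subseteq> A" using e by blast
        show "P y a b" unfolding P_def thin_def
        proof (intro impI exI[of _ e'] conjI allI e'(1))
          fix c d assume "0 \<le> a" "b \<le> 1" and cd: "c \<le> y" "y \<le> d" "d - c < e'" "0 \<le> c" "d \<le> 1"
          then have "{c..d} \<subseteq> ball y e'" by (auto simp: dist_real_def)
          then have sub: "{a..b} \<times> {c..d} \<subseteq> U" using sub1 AB(5) e' by blast
          have Q: "{a..b} \<times> {c..d} \<subseteq> {0..1} \<times> {0..1}" using \<open>0 \<le> a\<close> \<open>b \<le> 1\<close> cd by auto
          show "extendable ({a..b} \<times> {c..d}) h"
          proof (rule extendable_local)
            show "continuous_on ({a..b} \<times> {c..d}) h" using h(1) Q by (rule continuous_on_subset)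
            show "h ` ({a..b} \<times> {c..d}) \<subseteq> S" using h(2) Q by blast
            show "le (car (h (x, y))) (car (h z))" if "z \<in> {a..b} \<times> {c..d}" for z
              using U(3)[of z] sub Q that by blast
          qed
        qed
      qed
    qed
  qed
  define R where "R c d \<longleftrightarrow> (0 \<le> c \<longrightarrow> d \<le> 1 \<longrightarrow> extendable ({0..1} \<times> {c..d}) h)" for c d
  have "R 0 1"
  proof (rule Bolzano)
    show "(0::real) \<le> 1" by simp
  next
    fix a b c assume abc: "R a b" "R b c" "a \<le> b" "b \<le> (c::real)"
    show "R a c" unfolding R_def
    proof (intro impI)
      assume ac: "0 \<le> a" "c \<le> 1"
      have "{a..c} = {a..b} \<union> {b..c}" using abc by auto
      then have 1: "{0..1::real} \<times> {a..c} = {0..1} \<times> {a..b} \<union> {0..1} \<times> {b..c}" by blast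
      have 2: "{0..1::real} \<times> {a..b} \<inter> {0..1} \<times> {b..c} = {0..1} \<times> {b}" using abc by auto
      have "connected ({0..1::real} \<times> {b})" by (intro connected_Times) auto
      then show "extendable ({0..1} \<times> {a..c}) h"
        unfolding 1 using abc ac 2 unfolding R_def by (intro extendable_Un closed_Times) auto
    qed
  next
    fix y :: real
    show "\<exists>d>0. \<forall>a b. a \<le> y \<and> y \<le> b \<and> b - a < d \<longrightarrow> R a b"
    proof (cases "0 \<le> y \<and> y \<le> 1")
      case False
      then show ?thesis unfolding R_def by (intro exI[of _ 1]) auto
    next
      case True
      then have "P y 0 1" using strip by simp
      then show ?thesis unfolding P_def R_def thin_def by auto
    qed
  qed
  then show ?thesis unfolding R_def by simp
qed

text \<open>The two vertical sides of a free homotopy to a constant path are the same path, and a section along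
  it is determined by its value at the constant end.\<close>

lemma trivial_monodromy:
  assumes sc: "simply_connected S" and p: "path p" "path_image p \<subseteq> S" "pathfinish p = pathstart p"
    and L: "is_section {0..1} p L"
  shows "L 0 = L 1"
proof -
  define q where "q = (\<lambda>x::real. pathstart p)"
  have "pathstart p \<in> S" using p by (metis pathstart_in_path_image subsetD)
  then have "path q \<and> pathfinish q = pathstart q \<and> path_image q \<subseteq> S"
    unfolding q_def path_def path_image_def pathstart_def pathfinish_def by auto
  then have "homotopic_loops S p q" using sc p unfolding simply_connected_def by blast
  then obtain h where h': "continuous_on ({0..1::real} \<times> {0..1::real}) h" "h \<in> ({0..1} \<times> {0..1}) \<rightarrow> S"
      "\<forall>x\<in>{0..1}. h (0, x) = p x" "\<forall>x\<in>{0..1}. h (1, x) = q x"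
      "\<forall>t\<in>{0..1}. pathfinish (h \<circ> Pair t) = pathstart (h \<circ> Pair t)"
    unfolding homotopic_loops by blast
  have h: "continuous_on ({0..1} \<times> {0..1}) h" "h ` ({0..1} \<times> {0..1}) \<subseteq> S"
    and h0: "\<And>x. x \<in> {0..1} \<Longrightarrow> h (0, x) = p x" and h1: "\<And>x. x \<in> {0..1} \<Longrightarrow> h (1, x) = q x"
    and hl: "\<And>t. t \<in> {0..1} \<Longrightarrow> h (t, 0) = h (t, 1)"
    using h' by (auto simp: pathstart_def pathfinish_def)
  have Lfib: "L 0 \<in> fib (car (h (0, 0)))" using is_section_fib[OF L, of 0] h0[of 0] by simp
  obtain M where M: "is_section ({0..1} \<times> {0..1}) h M" "M (0, 0) = L 0"
    using extendable_square[OF h] Lfib unfolding extendable_def by force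
  have comp: "is_section {0..1} (h \<circ> f) (M \<circ> f)"
    if "continuous_on {0..1} f" "f ` {0..1} \<subseteq> {0..1} \<times> {0..1}" for f :: "real \<Rightarrow> real \<times> real"
    using is_section_compose[OF M(1)] that by blast
  note conts = continuous_intros
  have bottom: "is_section {0..1} p (\<lambda>x. M (0, x))"
    by (rule is_section_cong[OF comp[of "\<lambda>x. (0, x)"]]) (auto intro!: conts simp: h0)
  have left: "is_section {0..1} (\<lambda>t. h (t, 0)) (\<lambda>t. M (t, 0))"
    by (rule is_section_cong[OF comp[of "\<lambda>x. (x, 0)"]]) (auto intro!: conts)
  have right: "is_section {0..1} (\<lambda>t. h (t, 0)) (\<lambda>t. M (t, 1))"
    by (rule is_section_cong[OF comp[of "\<lambda>x. (x, 1)"]]) (auto intro!: conts simp: hl)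
  have top: "is_section {0..1} q (\<lambda>x. M (1, x))"
    by (rule is_section_cong[OF comp[of "\<lambda>x. (1, x)"]]) (auto intro!: conts simp: h1)
  have M10: "M (1, 0) \<in> fib (car (q 0))" using is_section_fib[OF M(1), of "(1, 0)"] h1[of 0] by simp
  have refl: "le (car (q 0)) (car (q 0))" using open_star[of "q 0"] \<open>pathstart p \<in> S\<close> q_def by auto
  have const: "is_section {0..1} q (\<lambda>x. M (1, 0))"
    using M10 refl res_id[OF M10] unfolding is_section_def q_def by (auto intro!: exI[of _ UNIV])
  have conn: "connected {0..1::real}" by simp
  have "M (1, 0) = M (1, 1)" by (rule is_section_unique[OF conn const top, of 0 1]) auto
  then have "M (0, 0) = M (0, 1)" by (intro is_section_unique[OF conn left right, of 1 0]) auto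
  moreover have "M (0, 1) = L 1" by (rule is_section_unique[OF conn bottom L, of 0 1]) (auto simp: M(2))
  ultimately show ?thesis using M(2) by simp
qed

end

section \<open>Cubes of dimension at most two\<close>

text \<open>Facts about edges refer to the dimension as \<open>1\<close>; rewritten to \<open>Suc 0\<close> they would not apply.\<close>

declare One_nat_def [simp del]

definition point1 :: "real \<Rightarrow> nat \<Rightarrow> real" where
  "point1 s = (\<lambda>i. if i = 0 then s else 0)"

definition point2 :: "real \<Rightarrow> real \<Rightarrow> nat \<Rightarrow> real" where
  "point2 s t = (\<lambda>i. if i = 0 then s else if i = 1 then t else 0)"

lemma cube_0: "cube 0 = {\<lambda>_. 0}" "open_cube 0 = {\<lambda>_. 0}"
  unfolding cube_def open_cube_def by auto

lemma cube_1: "cube 1 = point1 ` {0..1}" "open_cube 1 = point1 ` {0<..<1}"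
proof -
  have "x = point1 (x 0)" if "\<forall>i\<ge>1. x i = 0" for x :: "nat \<Rightarrow> real"
    using that unfolding point1_def by (intro ext) auto
  then show "cube 1 = point1 ` {0..1}" "open_cube 1 = point1 ` {0<..<1}"
    unfolding cube_def open_cube_def by (force simp: point1_def)+
qed

lemma cube_2: "cube 2 = (\<lambda>(s, t). point2 s t) ` ({0..1} \<times> {0..1})"
    "open_cube 2 = (\<lambda>(s, t). point2 s t) ` ({0<..<1} \<times> {0<..<1})"
proof -
  have *: "x = point2 (x 0) (x 1)" if "\<forall>i\<ge>2. x i = 0" for x :: "nat \<Rightarrow> real"
  proof
    fix i show "x i = point2 (x 0) (x 1) i"
      using that unfolding point2_def by (cases "i = 0"; cases "i = 1") auto
  qed
  have less2: "i < 2 \<longleftrightarrow> i = 0 \<or> i = 1" for i :: nat by auto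
  show "cube 2 = (\<lambda>(s, t). point2 s t) ` ({0..1} \<times> {0..1})"
  proof (intro equalityI subsetI)
    fix x assume "x \<in> cube 2"
    then show "x \<in> (\<lambda>(s, t). point2 s t) ` ({0..1} \<times> {0..1})"
      using * by (intro image_eqI[of _ _ "(x 0, x 1)"]) (auto simp: cube_def)
  qed (auto simp: cube_def point2_def)
  show "open_cube 2 = (\<lambda>(s, t). point2 s t) ` ({0<..<1} \<times> {0<..<1})"
  proof (intro equalityI subsetI)
    fix x assume "x \<in> open_cube 2"
    then show "x \<in> (\<lambda>(s, t). point2 s t) ` ({0<..<1} \<times> {0<..<1})"
      using * by (intro image_eqI[of _ _ "(x 0, x 1)"]) (auto simp: open_cube_def)
  qed (auto simp: open_cube_def point2_def)
qed

lemma point_apply [simp]: "point1 s 0 = s" "point2 s t 0 = s" "point2 s t 1 = t"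
  unfolding point1_def point2_def by auto

lemma point1_eq [simp]: "point1 s = point1 t \<longleftrightarrow> s = t"
  by (metis point_apply(1))

lemma point2_eq [simp]: "point2 s t = point2 s' t' \<longleftrightarrow> s = s' \<and> t = t'"
  by (metis point_apply(2,3))

lemma continuous_point1: "continuous_on A point1"
proof (rule continuous_on_coordinatewise_then_product)
  fix i
  show "continuous_on A (\<lambda>x. point1 x i)"
    by (cases "i = 0") (auto simp: point1_def intro!: continuous_intros)
qed

lemma continuous_point2: "continuous_on A (\<lambda>(s, t). point2 s t)"
proof (rule continuous_on_coordinatewise_then_product)
  fix i
  show "continuous_on A (\<lambda>x. (case x of (s, t) \<Rightarrow> point2 s t) i)"
    by (cases "i = 0"; cases "i = 1") (auto simp: point2_def case_prod_unfold intro!: continuous_intros)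
qed

lemma compact_cube: "n \<le> 2 \<Longrightarrow> compact (cube n)"
proof -
  assume "n \<le> 2"
  then consider "n = 0" | "n = 1" | "n = 2" by linarith
  then show ?thesis
    by cases (auto simp: cube_0 cube_1[unfolded One_nat_def] cube_1 cube_2
        intro!: compact_continuous_image continuous_point1 continuous_point2 compact_Times)
qed

section \<open>The cells of a finite CAT(0) square complex\<close>

locale finite_CAT0_square_complex =
  fixes X :: "('c, 'a::t2_space) cube_data"
  assumes CAT0: "CAT0_cube_complex X" and finite_cells: "finite (cells X)" and top_dim: "top_dim X \<le> 2"
begin

abbreviation "face \<equiv> face_of_cell X"
abbreviation "C0 \<equiv> cells_of_dim X 0"
abbreviation "C1 \<equiv> cells_of_dim X 1"
abbreviation "C2 \<equiv> cells_of_dim X 2"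

lemma cc: "cube_complex X"
  using CAT0[unfolded CAT0_cube_complex_def] by (rule conjunct1)

lemma cdim_le: "c \<in> cells X \<Longrightarrow> cdim X c \<le> 2"
  using Max_ge[of "cdim X ` cells X" "cdim X c"] finite_cells top_dim unfolding top_dim_def
  by (metis finite_imageI imageI order_trans)

lemma cdim_cases:
  assumes "c \<in> cells X"
  obtains "c \<in> C0" | "c \<in> C1" | "c \<in> C2"
proof -
  consider "cdim X c = 0" | "cdim X c = 1" | "cdim X c = 2" using cdim_le[OF assms] by linarith
  then show ?thesis using that assms unfolding cells_of_dim_def by cases blast+
qed

lemma dim_cells: "c \<in> cells_of_dim X n \<Longrightarrow> c \<in> cells X" "c \<in> cells_of_dim X n \<Longrightarrow> cdim X c = n"
  unfolding cells_of_dim_def by auto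

lemma chart_continuous: "c \<in> cells X \<Longrightarrow> continuous_on (cube (cdim X c)) (chart X c)"
  and chart_inj: "c \<in> cells X \<Longrightarrow> inj_on (chart X c) (cube (cdim X c))"
  using cc[unfolded cube_complex_def, THEN conjunct1] by blast+

lemma open_cell_disjoint:
  assumes "c \<in> cells X" "d \<in> cells X" "x \<in> open_cell X c" "x \<in> open_cell X d"
  shows "c = d"
proof -
  have "\<forall>c\<in>cells X. \<forall>d\<in>cells X. c \<noteq> d \<longrightarrow> open_cell X c \<inter> open_cell X d = {}"
    by (rule cc[unfolded cube_complex_def, THEN conjunct2, THEN conjunct1])
  then show ?thesis using assms by blast
qed

lemma cube_face_cell:
  assumes "c \<in> cells X" "I \<subseteq> {..<cdim X c}" "a ` I \<subseteq> {0, 1}"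
  obtains d where "d \<in> cells_of_dim X (cdim X c - card I)"
    "closed_cell X d = chart X c ` cube_face (cdim X c) I a"
proof -
  have "\<forall>c\<in>cells X. \<forall>I a. I \<subseteq> {..<cdim X c} \<longrightarrow> a ` I \<subseteq> {0, 1} \<longrightarrow>
        (\<exists>d\<in>cells X. cdim X d = cdim X c - card I \<and>
           (\<exists>g. cube_isometry (cdim X d) (cdim X c) (cube_face (cdim X c) I a) g \<and>
                (\<forall>x\<in>cube (cdim X d). chart X d x = chart X c (g x))))"
    by (rule cc[unfolded cube_complex_def, THEN conjunct2, THEN conjunct2, THEN conjunct1])
  from this[rule_format, OF assms] obtain d g where d: "d \<in> cells X" "cdim X d = cdim X c - card I"
    "cube_isometry (cdim X d) (cdim X c) (cube_face (cdim X c) I a) g"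
    "\<forall>x\<in>cube (cdim X d). chart X d x = chart X c (g x)"
    by (elim bexE conjE exE) (rule that, assumption+)
  have "g ` cube (cdim X d) = cube_face (cdim X c) I a" using d(3) unfolding cube_isometry_def by blast
  moreover have "closed_cell X d = chart X c ` g ` cube (cdim X d)"
    unfolding closed_cell_def image_image using d(4) by (intro image_cong) auto
  ultimately show ?thesis using that[of d] d(1,2) unfolding cells_of_dim_def by simp
qed

definition pt :: "'c \<Rightarrow> 'a" where
  "pt v = chart X v (\<lambda>_. 0)"

lemma vertex_cell: "v \<in> C0 \<Longrightarrow> closed_cell X v = {pt v}" "v \<in> C0 \<Longrightarrow> open_cell X v = {pt v}"
  unfolding closed_cell_def open_cell_def pt_def by (simp_all add: dim_cells cube_0)

lemma edge_cell: "e \<in> C1 \<Longrightarrow> closed_cell X e = (\<lambda>t. chart X e (point1 t)) ` {0..1}"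
    "e \<in> C1 \<Longrightarrow> open_cell X e = (\<lambda>t. chart X e (point1 t)) ` {0<..<1}"
  unfolding closed_cell_def open_cell_def by (simp_all add: dim_cells(2) cube_1 image_image)

lemma square_cell:
  "f \<in> C2 \<Longrightarrow> closed_cell X f = (\<lambda>(s, t). chart X f (point2 s t)) ` ({0..1} \<times> {0..1})"
  "f \<in> C2 \<Longrightarrow> open_cell X f = (\<lambda>(s, t). chart X f (point2 s t)) ` ({0<..<1} \<times> {0<..<1})"
  unfolding closed_cell_def open_cell_def
  by (simp_all add: dim_cells(2) cube_2 image_image case_prod_unfold)

lemma open_cell_nonempty: "c \<in> cells X \<Longrightarrow> \<exists>x. x \<in> open_cell X c"
proof (erule cdim_cases)
  assume "c \<in> C1"
  then show ?thesis by (intro exI[of _ "chart X c (point1 (1/2))"]) (auto simp: edge_cell)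
next
  assume "c \<in> C2"
  then show ?thesis
    by (intro exI[of _ "chart X c (point2 (1/2) (1/2))"]) 
      (auto simp: square_cell intro!: image_eqI[of _ _ "(1/2, 1/2)"])
qed (auto simp: vertex_cell)

lemma open_subset_closed: "c \<in> cells X \<Longrightarrow> open_cell X c \<subseteq> closed_cell X c"
  unfolding open_cell_def closed_cell_def by (intro image_mono) (auto simp: cube_def open_cube_def less_imp_le)

lemma face_refl: "c \<in> cells X \<Longrightarrow> face c c"
  and face_trans: "face b c \<Longrightarrow> face c d \<Longrightarrow> face b d"
  and face_cells: "face c d \<Longrightarrow> c \<in> cells X \<and> d \<in> cells X"
  unfolding face_of_cell_def by auto

text \<open>The open cells are disjoint and nonempty, so a face has to be one of the cells whose open cells cover
  the closed cell.\<close>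

lemma faces_eq:
  assumes F: "\<And>d. d \<in> F \<Longrightarrow> face d c" and cov: "closed_cell X c \<subseteq> (\<Union>d\<in>F. open_cell X d)"
  shows "{d. face d c} = F"
proof (intro equalityI subsetI)
  fix d assume "d \<in> {d. face d c}"
  then have d: "d \<in> cells X" "closed_cell X d \<subseteq> closed_cell X c" unfolding face_of_cell_def by auto
  obtain x where x: "x \<in> open_cell X d" using open_cell_nonempty d by blast
  then have "x \<in> closed_cell X c" using open_subset_closed d by blast
  then obtain d' where "d' \<in> F" "x \<in> open_cell X d'" using cov by blast
  then show "d \<in> F" using open_cell_disjoint[OF d(1) _ x] F face_cells by metis
qed (use F in blast)

lemma vertex_faces: "v \<in> C0 \<Longrightarrow> {d. face d v} = {v}"
  by (rule faces_eq) (simp_all add: vertex_cell dim_cells(1) face_refl)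

lemma edge_structure:
  assumes e: "e \<in> C1"
  obtains u v where "u \<in> C0" "v \<in> C0" "u \<noteq> v" "pt u = chart X e (point1 0)" "pt v = chart X e (point1 1)"
    "{d. face d e} = {e, u, v}" "closed_cell X e \<subseteq> (\<Union>d\<in>{e, u, v}. open_cell X d)"
proof -
  have eX: "e \<in> cells X" and dim: "cdim X e = 1" using e dim_cells by auto
  have end_vertex: "\<exists>v\<in>C0. pt v = chart X e (point1 b)" if b: "b \<in> {0, 1}" for b
  proof -
    have "cube_face 1 {0} (\<lambda>_. b) = {point1 b}"
      unfolding cube_face_def cube_1 using b by auto
    moreover obtain d where "d \<in> cells_of_dim X (cdim X e - card {0::nat})"
      "closed_cell X d = chart X e ` cube_face (cdim X e) {0} (\<lambda>_. b)"
      using cube_face_cell[OF eX, of "{0}" "\<lambda>_. b"] dim b by auto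
    ultimately show ?thesis using dim vertex_cell by (intro bexI[of _ d]) auto
  qed
  obtain u where u: "u \<in> C0" "pt u = chart X e (point1 0)" using end_vertex[of 0] by auto
  obtain v where v: "v \<in> C0" "pt v = chart X e (point1 1)" using end_vertex[of 1] by auto
  have "chart X e (point1 0) \<noteq> chart X e (point1 1)"
    using inj_onD[OF chart_inj[OF eX], of "point1 0" "point1 1"] unfolding dim cube_1 by force
  then have "u \<noteq> v" using u v by auto
  moreover have cov: "closed_cell X e \<subseteq> (\<Union>d\<in>{e, u, v}. open_cell X d)"
  proof -
    have "chart X e (point1 t) \<in> (\<Union>d\<in>{e, u, v}. open_cell X d)" if t: "t \<in> {0..1}" for t
    proof -
      consider "t = 0" | "t = 1" | "t \<in> {0<..<1}" using t by fastforce
      then show ?thesis by cases (use u v e in \<open>auto simp: vertex_cell edge_cell\<close>)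
    qed
    then show ?thesis unfolding edge_cell(1)[OF e] by blast
  qed
  moreover have "{d. face d e} = {e, u, v}"
  proof (rule faces_eq[OF _ cov])
    fix d assume "d \<in> {e, u, v}"
    then show "face d e"
      using u v e eX unfolding face_of_cell_def by (auto simp: vertex_cell edge_cell dim_cells)
  qed
  ultimately show ?thesis using that u v by blast
qed

definition verts :: "'c \<Rightarrow> 'c set" where
  "verts c = {v \<in> C0. face v c}"

lemma dim_distinct: "v \<in> C0 \<Longrightarrow> v \<notin> C1 \<and> v \<notin> C2" "e \<in> C1 \<Longrightarrow> e \<notin> C2"
  unfolding cells_of_dim_def by auto

lemma verts_vertex: "v \<in> C0 \<Longrightarrow> verts v = {v}"
  unfolding verts_def using vertex_faces[of v] by blast

lemma edge_verts:
  assumes e: "e \<in> C1"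
  obtains u v where "u \<noteq> v" "verts e = {u, v}" "{d. face d e} = {e, u, v}"
    "pt u = chart X e (point1 0)" "pt v = chart X e (point1 1)"
proof -
  obtain u v where uv: "u \<in> C0" "v \<in> C0" "u \<noteq> v" "pt u = chart X e (point1 0)"
    "pt v = chart X e (point1 1)" "{d. face d e} = {e, u, v}"
    by (rule edge_structure[OF e])
  moreover have "verts e = {u, v}" 
  proof -
    have "face w e \<longleftrightarrow> w \<in> {e, u, v}" for w using uv(6) by blast
    then show ?thesis unfolding verts_def using uv(1,2) dim_distinct e by auto
  qed
  ultimately show ?thesis using that[of u v] by blast
qed

lemma edge_verts_eq:
  assumes "e \<in> C1" "u \<in> verts e" "v \<in> verts e" "u \<noteq> v"
  shows "verts e = {u, v}"
proof -
  obtain a b where "verts e = {a, b}" by (rule edge_verts[OF assms(1)])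
  then show ?thesis using assms(2-4) by auto
qed

text \<open>By rotation and reflection of cyclic enumerations, statements about the edges of a square need
  only be checked for one of them.\<close>

definition square_cycle :: "'c \<Rightarrow> 'c \<Rightarrow> 'c \<Rightarrow> 'c \<Rightarrow> 'c \<Rightarrow> 'c \<Rightarrow> 'c \<Rightarrow> 'c \<Rightarrow> 'c \<Rightarrow> bool" where
  "square_cycle f v0 v1 v2 v3 e0 e1 e2 e3 \<longleftrightarrow>
     {v0, v1, v2, v3} \<subseteq> C0 \<and> {e0, e1, e2, e3} \<subseteq> C1 \<and> distinct [v0, v1, v2, v3] \<and>
     verts e0 = {v0, v1} \<and> verts e1 = {v1, v2} \<and> verts e2 = {v2, v3} \<and> verts e3 = {v3, v0} \<and>
     {d. face d f} = {f, e0, e1, e2, e3, v0, v1, v2, v3}"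

lemma square_cycle_rotate: "square_cycle f v0 v1 v2 v3 e0 e1 e2 e3 \<Longrightarrow> square_cycle f v1 v2 v3 v0 e1 e2 e3 e0"
  unfolding square_cycle_def by (simp add: insert_commute, metis)

lemma square_cycle_reflect: "square_cycle f v0 v1 v2 v3 e0 e1 e2 e3 \<Longrightarrow> square_cycle f v1 v0 v3 v2 e0 e3 e2 e1"
  unfolding square_cycle_def by (simp add: insert_commute, metis)

text \<open>The sides of the square are cells by the gluing condition.  A corner on a side is a vertex in the
  closed cell of that side, and so an end of it.\<close>

lemma square_cycle_exists:
  assumes f: "f \<in> C2"
  obtains v0 v1 v2 v3 e0 e1 e2 e3 where "square_cycle f v0 v1 v2 v3 e0 e1 e2 e3"
    "closed_cell X f \<subseteq> (\<Union>d\<in>{f, e0, e1, e2, e3, v0, v1, v2, v3}. open_cell X d)"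
proof -
  have fX: "f \<in> cells X" and dim: "cdim X f = 2" using f dim_cells by auto
  let ?c = "\<lambda>s t. chart X f (point2 s t)"
  have inj: "?c s t = ?c s' t' \<longleftrightarrow> s = s' \<and> t = t'"
    if "s \<in> {0..1}" "t \<in> {0..1}" "s' \<in> {0..1}" "t' \<in> {0..1}" for s t s' t'
    using inj_onD[OF chart_inj[OF fX], of "point2 s t" "point2 s' t'"] that
    unfolding dim cube_2 by (auto simp: image_iff)
  have vertex: "\<exists>v\<in>C0. pt v = ?c a b" if ab: "a \<in> {0, 1}" "b \<in> {0, 1}" for a b
  proof -
    let ?a = "\<lambda>i::nat. if i = 0 then a else b"
    have "cube_face 2 {0, 1} ?a = {point2 a b}"
      unfolding cube_face_def cube_2 using ab by (auto simp: image_iff)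
    moreover obtain d where "d \<in> cells_of_dim X (cdim X f - card {0, 1::nat})"
      "closed_cell X d = chart X f ` cube_face (cdim X f) {0, 1} ?a"
      using cube_face_cell[OF fX, of "{0, 1}" ?a] dim ab by auto
    ultimately show ?thesis using dim vertex_cell by (intro bexI[of _ d]) auto
  qed
  have edge: "\<exists>e\<in>C1. closed_cell X e = chart X f ` cube_face 2 {i} (\<lambda>_. a)"
    if a: "a \<in> {0, 1}" "i < 2" for a i
  proof -
    obtain d where "d \<in> cells_of_dim X (cdim X f - card {i})"
      "closed_cell X d = chart X f ` cube_face (cdim X f) {i} (\<lambda>_. a)"
      using cube_face_cell[OF fX, of "{i}" "\<lambda>_. a"] dim a by auto
    then show ?thesis using dim by auto
  qed
  have side0: "cube_face 2 {0} (\<lambda>_. a) = point2 a ` {0..1}" if "a \<in> {0, 1}" for a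
    unfolding cube_face_def cube_2 using that by (auto simp: image_iff)
  have side1: "cube_face 2 {1} (\<lambda>_. a) = (\<lambda>t. point2 t a) ` {0..1}" if "a \<in> {0, 1}" for a
    unfolding cube_face_def cube_2 using that by (auto simp: image_iff)
  obtain v0 where v0: "v0 \<in> C0" "pt v0 = ?c 0 0" using vertex[of 0 0] by auto
  obtain v1 where v1: "v1 \<in> C0" "pt v1 = ?c 1 0" using vertex[of 1 0] by auto
  obtain v2 where v2: "v2 \<in> C0" "pt v2 = ?c 1 1" using vertex[of 1 1] by auto
  obtain v3 where v3: "v3 \<in> C0" "pt v3 = ?c 0 1" using vertex[of 0 1] by auto
  obtain e0 where e0: "e0 \<in> C1" "closed_cell X e0 = (\<lambda>t. ?c t 0) ` {0..1}"
    using edge[of 0 1] side1[of 0] by (auto simp: image_image)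
  obtain e1 where e1: "e1 \<in> C1" "closed_cell X e1 = (\<lambda>t. ?c 1 t) ` {0..1}"
    using edge[of 1 0] side0[of 1] by (auto simp: image_image)
  obtain e2 where e2: "e2 \<in> C1" "closed_cell X e2 = (\<lambda>t. ?c t 1) ` {0..1}"
    using edge[of 1 1] side1[of 1] by (auto simp: image_image)
  obtain e3 where e3: "e3 \<in> C1" "closed_cell X e3 = (\<lambda>t. ?c 0 t) ` {0..1}"
    using edge[of 0 0] side0[of 0] by (auto simp: image_image)
  have dist: "distinct [v0, v1, v2, v3]" using v0 v1 v2 v3 inj by auto
  have on_edge: "v \<in> verts e" if "v \<in> C0" "e \<in> C1" "pt v \<in> closed_cell X e" for v e
    using that dim_cells unfolding verts_def face_of_cell_def by (auto simp: vertex_cell)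
  have ve: "verts e0 = {v0, v1}" "verts e1 = {v1, v2}" "verts e2 = {v2, v3}" "verts e3 = {v3, v0}"
    using edge_verts_eq[OF e0(1) on_edge[OF v0(1) e0(1)] on_edge[OF v1(1) e0(1)]]
      edge_verts_eq[OF e1(1) on_edge[OF v1(1) e1(1)] on_edge[OF v2(1) e1(1)]]
      edge_verts_eq[OF e2(1) on_edge[OF v2(1) e2(1)] on_edge[OF v3(1) e2(1)]]
      edge_verts_eq[OF e3(1) on_edge[OF v3(1) e3(1)] on_edge[OF v0(1) e3(1)]]
      dist unfolding e0(2) e1(2) e2(2) e3(2) v0(2) v1(2) v2(2) v3(2) by auto
  have edge_cover: "x \<in> (\<Union>d\<in>{f, e0, e1, e2, e3, v0, v1, v2, v3}. open_cell X d)"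
    if x: "x \<in> closed_cell X e" and e: "e \<in> {e0, e1, e2, e3}" for x e
  proof -
    have eC: "e \<in> C1" using e e0(1) e1(1) e2(1) e3(1) by blast
    obtain u v where uv: "verts e = {u, v}" "pt u = chart X e (point1 0)" "pt v = chart X e (point1 1)"
      by (rule edge_verts[OF eC])
    obtain t where t: "t \<in> {0..1}" "x = chart X e (point1 t)" using x edge_cell(1)[OF eC] by auto
    have "verts e \<subseteq> {v0, v1, v2, v3}" using e ve by auto
    then have u: "u \<in> C0" "u \<in> {v0, v1, v2, v3}" and v: "v \<in> C0" "v \<in> {v0, v1, v2, v3}"
      using uv(1) unfolding verts_def by blast+
    consider "t = 0" | "t = 1" | "t \<in> {0<..<1}" using t by fastforce
    then show ?thesis
    proof cases
      case 1
      then have "x \<in> open_cell X u" using t uv vertex_cell u by simp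
      then show ?thesis using u by blast
    next
      case 2
      then have "x \<in> open_cell X v" using t uv vertex_cell v by simp
      then show ?thesis using v by blast
    next
      case 3
      then have "x \<in> open_cell X e" using t edge_cell(2)[OF eC] by blast
      then show ?thesis using e by blast
    qed
  qed
  have cov: "closed_cell X f \<subseteq> (\<Union>d\<in>{f, e0, e1, e2, e3, v0, v1, v2, v3}. open_cell X d)"
  proof
    fix x assume "x \<in> closed_cell X f"
    then obtain s t where st: "s \<in> {0..1}" "t \<in> {0..1}" "x = ?c s t" using square_cell(1)[OF f] by auto
    consider "t = 0" | "s = 1" | "t = 1" | "s = 0" | "s \<in> {0<..<1}" "t \<in> {0<..<1}" using st by fastforce
    then show "x \<in> (\<Union>d\<in>{f, e0, e1, e2, e3, v0, v1, v2, v3}. open_cell X d)"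
    proof cases
      case 1
      then have "x \<in> closed_cell X e0" unfolding e0(2) using st by auto
      then show ?thesis by (rule edge_cover) simp
    next
      case 2
      then have "x \<in> closed_cell X e1" unfolding e1(2) using st by auto
      then show ?thesis by (rule edge_cover) simp
    next
      case 3
      then have "x \<in> closed_cell X e2" unfolding e2(2) using st by auto
      then show ?thesis by (rule edge_cover) simp
    next
      case 4
      then have "x \<in> closed_cell X e3" unfolding e3(2) using st by auto
      then show ?thesis by (rule edge_cover) simp
    next
      case 5
      then have "x \<in> open_cell X f" using st square_cell(2)[OF f] by auto
      then show ?thesis by blast
    qed
  qed
  have faces: "{d. face d f} = {f, e0, e1, e2, e3, v0, v1, v2, v3}"
  proof (rule faces_eq[OF _ cov])
    have sub: "?c s t \<in> closed_cell X f" if "s \<in> {0..1}" "t \<in> {0..1}" for s t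
      unfolding square_cell(1)[OF f] using that by (intro image_eqI[of _ _ "(s, t)"]) auto
    have "closed_cell X e0 \<subseteq> closed_cell X f" unfolding e0(2) using sub by auto
    then have fe0: "face e0 f" unfolding face_of_cell_def using f e0(1) dim_cells(1) by blast
    have "closed_cell X v0 \<subseteq> closed_cell X f" unfolding vertex_cell(1)[OF v0(1)] v0(2) using sub by simp
    then have fv0: "face v0 f" unfolding face_of_cell_def using f v0(1) dim_cells(1) by blast
    have "closed_cell X e1 \<subseteq> closed_cell X f" unfolding e1(2) using sub by auto
    then have fe1: "face e1 f" unfolding face_of_cell_def using f e1(1) dim_cells(1) by blast
    have "closed_cell X v1 \<subseteq> closed_cell X f" unfolding vertex_cell(1)[OF v1(1)] v1(2) using sub by simp
    then have fv1: "face v1 f" unfolding face_of_cell_def using f v1(1) dim_cells(1) by blast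
    have "closed_cell X e2 \<subseteq> closed_cell X f" unfolding e2(2) using sub by auto
    then have fe2: "face e2 f" unfolding face_of_cell_def using f e2(1) dim_cells(1) by blast
    have "closed_cell X v2 \<subseteq> closed_cell X f" unfolding vertex_cell(1)[OF v2(1)] v2(2) using sub by simp
    then have fv2: "face v2 f" unfolding face_of_cell_def using f v2(1) dim_cells(1) by blast
    have "closed_cell X e3 \<subseteq> closed_cell X f" unfolding e3(2) using sub by auto
    then have fe3: "face e3 f" unfolding face_of_cell_def using f e3(1) dim_cells(1) by blast
    have "closed_cell X v3 \<subseteq> closed_cell X f" unfolding vertex_cell(1)[OF v3(1)] v3(2) using sub by simp
    then have fv3: "face v3 f" unfolding face_of_cell_def using f v3(1) dim_cells(1) by blast
    show "face d f" if "d \<in> {f, e0, e1, e2, e3, v0, v1, v2, v3}" for d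
      using that fe0 fe1 fe2 fe3 fv0 fv1 fv2 fv3 face_refl[OF fX] by blast
  qed
  show ?thesis
    by (rule that[of v0 v1 v2 v3 e0 e1 e2 e3, OF _ cov], unfold square_cycle_def faces ve)
      (use v0(1) v1(1) v2(1) v3(1) e0(1) e1(1) e2(1) e3(1) dist in simp)
qed

end

context finite_CAT0_square_complex
begin

section \<open>The carrier of a point\<close>

lemma closed_cell_cover:
  assumes "c \<in> cells X" "x \<in> closed_cell X c"
  obtains d where "face d c" "x \<in> open_cell X d"
proof -
  have "closed_cell X c \<subseteq> (\<Union>d\<in>{d. face d c}. open_cell X d)"
  proof (cases rule: cdim_cases[OF assms(1)])
    case 1
    then show ?thesis using vertex_cell vertex_faces by simp
  next
    case 2
    obtain u v where "{d. face d c} = {c, u, v}" "closed_cell X c \<subseteq> (\<Union>d\<in>{c, u, v}. open_cell X d)"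
      by (rule edge_structure[OF 2])
    then show ?thesis by (simp only:)
  next
    case 3
    obtain v0 v1 v2 v3 e0 e1 e2 e3 where s: "square_cycle c v0 v1 v2 v3 e0 e1 e2 e3"
      and "closed_cell X c \<subseteq> (\<Union>d\<in>{c, e0, e1, e2, e3, v0, v1, v2, v3}. open_cell X d)"
      by (rule square_cycle_exists[OF 3])
    moreover have "{d. face d c} = {c, e0, e1, e2, e3, v0, v1, v2, v3}"
      using s unfolding square_cycle_def by (elim conjE)
    ultimately show ?thesis by (simp only:)
  qed
  then show ?thesis using that assms(2) by blast
qed

definition carrier :: "'a \<Rightarrow> 'c" where
  "carrier x = (THE c. c \<in> cells X \<and> x \<in> open_cell X c)"

lemma carrier_eq:
  assumes "c \<in> cells X" "x \<in> open_cell X c"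
  shows "carrier x = c"
  unfolding carrier_def using assms open_cell_disjoint by (intro the_equality) blast+

lemma carrier_face:
  assumes "c \<in> cells X" "x \<in> closed_cell X c"
  shows "face (carrier x) c"
proof -
  obtain d where d: "face d c" "x \<in> open_cell X d" by (rule closed_cell_cover[OF assms])
  then have "carrier x = d" using carrier_eq face_cells by blast
  then show ?thesis using d by simp
qed

lemma in_closed_carrier:
  assumes "x \<in> realization X"
  shows "carrier x \<in> cells X" "x \<in> closed_cell X (carrier x)"
proof -
  obtain c where c: "c \<in> cells X" "x \<in> closed_cell X c" using assms unfolding realization_def by blast
  obtain d where d: "face d c" "x \<in> open_cell X d" by (rule closed_cell_cover[OF c])
  have "d \<in> cells X" using d(1) face_cells by blast
  then show "carrier x \<in> cells X" "x \<in> closed_cell X (carrier x)"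
    using carrier_eq[OF _ d(2)] open_subset_closed d(2) by auto
qed

lemma carrier_pt: "v \<in> C0 \<Longrightarrow> carrier (pt v) = v"
  by (rule carrier_eq) (simp_all add: dim_cells(1) vertex_cell(2))

lemma pt_realization: "v \<in> C0 \<Longrightarrow> pt v \<in> realization X"
  unfolding realization_def using vertex_cell(1) dim_cells(1) by blast

lemma closed_closed_cell: "c \<in> cells X \<Longrightarrow> closed (closed_cell X c)"
  unfolding closed_cell_def
  by (intro compact_imp_closed compact_continuous_image chart_continuous compact_cube cdim_le)

text \<open>The complement is the union of the closed cells that do not have \<open>carrier x\<close> as a face.\<close>

lemma open_star_carrier:
  assumes x: "x \<in> realization X"
  shows "\<exists>U. open U \<and> x \<in> U \<and> (\<forall>y\<in>U \<inter> realization X. face (carrier x) (carrier y))"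
proof -
  define Z where "Z = (\<Union>c\<in>{c \<in> cells X. \<not> face (carrier x) c}. closed_cell X c)"
  have "closed Z" unfolding Z_def using finite_cells closed_closed_cell by (intro closed_UN) auto
  then have "open (- Z)" by (rule open_Compl)
  moreover have "x \<in> - Z" unfolding Z_def using carrier_face by blast
  moreover have "face (carrier x) (carrier y)" if "y \<in> - Z \<inter> realization X" for y
    using that in_closed_carrier[of y] unfolding Z_def by blast
  ultimately show ?thesis by blast
qed

lemma verts_mono: "face c d \<Longrightarrow> verts c \<subseteq> verts d"
  unfolding verts_def using face_trans by blast

lemma verts_C0: "verts c \<subseteq> C0"
  unfolding verts_def by blast

section \<open>Darts and squares\<close>

definition darts :: "('c \<times> 'c \<times> 'c) set" where
  "darts = {(u, e, v). e \<in> C1 \<and> verts e = {u, v} \<and> u \<noteq> v}"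

abbreviation source :: "'c \<times> 'c \<times> 'c \<Rightarrow> 'c" where "source d \<equiv> fst d"
abbreviation edge :: "'c \<times> 'c \<times> 'c \<Rightarrow> 'c" where "edge d \<equiv> fst (snd d)"
abbreviation target :: "'c \<times> 'c \<times> 'c \<Rightarrow> 'c" where "target d \<equiv> snd (snd d)"

definition reverse :: "'c \<times> 'c \<times> 'c \<Rightarrow> 'c \<times> 'c \<times> 'c" where
  "reverse d = (target d, edge d, source d)"

lemma reverse_simps [simp]: "source (reverse d) = target d" "target (reverse d) = source d"
  "edge (reverse d) = edge d" "reverse (reverse d) = d"
  unfolding reverse_def by simp_all

lemma reverse_darts: "d \<in> darts \<Longrightarrow> reverse d \<in> darts"
  unfolding darts_def reverse_def by (auto simp: insert_commute)

lemma darts_D: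
  assumes "d \<in> darts"
  shows "edge d \<in> C1" "verts (edge d) = {source d, target d}" "source d \<noteq> target d"
    "source d \<in> C0" "target d \<in> C0" "face (source d) (edge d)" "face (target d) (edge d)"
proof -
  obtain u e v where d: "d = (u, e, v)" "e \<in> C1" "verts e = {u, v}" "u \<noteq> v"
    using assms unfolding darts_def by blast
  have "u \<in> verts e" "v \<in> verts e" using d(3) by simp_all
  then have "u \<in> C0" "v \<in> C0" "face u e" "face v e" unfolding verts_def by blast+
  then show "edge d \<in> C1" "verts (edge d) = {source d, target d}" "source d \<noteq> target d"
    "source d \<in> C0" "target d \<in> C0" "face (source d) (edge d)" "face (target d) (edge d)"
    using d by simp_all
qed

lemma darts_eq: "d \<in> darts \<Longrightarrow> d' \<in> darts \<Longrightarrow> source d = source d' \<Longrightarrow> edge d = edge d' \<Longrightarrow> d = d'"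
  unfolding darts_def by (auto simp: doubleton_eq_iff)

lemma dart_exists:
  assumes "e \<in> C1" "u \<in> verts e"
  obtains d where "d \<in> darts" "source d = u" "edge d = e"
proof -
  obtain a b where ab: "a \<noteq> b" "verts e = {a, b}" by (rule edge_verts[OF assms(1)])
  then have "(u, e, if u = a then b else a) \<in> darts" using assms unfolding darts_def by auto
  then show ?thesis using that by force
qed

definition sq :: "'c \<times> 'c \<times> 'c \<Rightarrow> 'c \<times> 'c \<times> 'c \<Rightarrow> 'c \<times> 'c \<times> 'c \<Rightarrow> 'c \<times> 'c \<times> 'c \<Rightarrow> bool" where
  "sq p a q b \<longleftrightarrow> {p, a, q, b} \<subseteq> darts \<and>
     source p = source q \<and> target p = source a \<and> target q = source b \<and> target a = target b \<and>
     p \<noteq> q \<and> source p \<noteq> target a \<and> (\<exists>f\<in>C2. \<forall>d\<in>{p, a, q, b}. face (edge d) f)"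

lemma sq_darts:
  assumes "sq p a q b"
  shows "p \<in> darts" "a \<in> darts" "q \<in> darts" "b \<in> darts"
    "source p = source q" "target p = source a" "target q = source b" "target a = target b"
    "p \<noteq> q" "source p \<noteq> target a"
  using assms unfolding sq_def by auto

lemma square_cycle_at:
  assumes f: "f \<in> C2" and d: "(u, e, w) \<in> darts" "face e f"
  obtains v2 v3 e1 e2 e3 where "square_cycle f u w v2 v3 e e1 e2 e3"
proof -
  define p where "p = (u, e, w)"
  have p: "p \<in> darts" "face (edge p) f" and uew: "source p = u" "edge p = e" "target p = w"
    using d unfolding p_def by simp_all
  note thesisI = that
  obtain v0 v1 v2 v3 e0 e1 e2 e3 where s: "square_cycle f v0 v1 v2 v3 e0 e1 e2 e3"
    by (rule square_cycle_exists[OF f])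
  have F: "{d. face d f} = {f, e0, e1, e2, e3, v0, v1, v2, v3}" "{v0, v1, v2, v3} \<subseteq> C0"
    using s unfolding square_cycle_def by (simp_all only:)
  have "edge p \<in> {f, e0, e1, e2, e3, v0, v1, v2, v3}" using p(2) F(1) by blast
  then have e: "edge p \<in> {e0, e1, e2, e3}"
    using darts_D(1)[OF p(1)] f dim_distinct F(2) by blast
  have *: ?thesis if s: "square_cycle f w0 w1 w2 w3 g0 g1 g2 g3" and g: "edge p = g0"
    for w0 w1 w2 w3 g0 g1 g2 g3
  proof -
    have "verts g0 = {w0, w1}" using s unfolding square_cycle_def by (elim conjE)
    then have "{source p, target p} = {w0, w1}" using darts_D(2)[OF p(1)] g by simp
    then consider "source p = w0" "target p = w1" | "source p = w1" "target p = w0"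
      by (auto simp: doubleton_eq_iff)
    then show ?thesis
    proof cases
      case 1
      show ?thesis using s unfolding g[symmetric] 1[symmetric] uew by (rule thesisI)
    next
      case 2
      show ?thesis using square_cycle_reflect[OF s] unfolding g[symmetric] 2[symmetric] uew by (rule thesisI)
    qed
  qed
  note s1 = square_cycle_rotate[OF s] 
  note s2 = square_cycle_rotate[OF s1]
  note s3 = square_cycle_rotate[OF s2]
  from e consider "edge p = e0" | "edge p = e1" | "edge p = e2" | "edge p = e3" by blast
  then show ?thesis by cases (erule *[OF s] *[OF s1] *[OF s2] *[OF s3])+
qed

lemma square_cycle_D:
  assumes "square_cycle f v0 v1 v2 v3 e0 e1 e2 e3" "f \<in> C2"
  shows "(v0, e0, v1) \<in> darts" "(v1, e1, v2) \<in> darts" "(v2, e2, v3) \<in> darts" "(v3, e3, v0) \<in> darts"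
    "(v0, e3, v3) \<in> darts" "(v3, e2, v2) \<in> darts" "(v2, e1, v1) \<in> darts" "(v1, e0, v0) \<in> darts"
    "face e0 f" "face e1 f" "face e2 f" "face e3 f"
    "d \<in> darts \<Longrightarrow> face (edge d) f \<Longrightarrow> d \<in> {(v0, e0, v1), (v1, e1, v2), (v2, e2, v3), (v3, e3, v0),
      (v0, e3, v3), (v3, e2, v2), (v2, e1, v1), (v1, e0, v0)}"
    "distinct [v0, v1, v2, v3]" "distinct [e0, e1, e2, e3]" "verts f = {v0, v1, v2, v3}"
proof -
  have s: "{v0, v1, v2, v3} \<subseteq> C0" "{e0, e1, e2, e3} \<subseteq> C1" and dv: "distinct [v0, v1, v2, v3]"
    and v: "verts e0 = {v0, v1}" "verts e1 = {v1, v2}" "verts e2 = {v2, v3}" "verts e3 = {v3, v0}"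
    and F: "{d. face d f} = {f, e0, e1, e2, e3, v0, v1, v2, v3}"
    using assms(1) unfolding square_cycle_def by (simp_all only:)
  have C: "v0 \<in> C0" "v1 \<in> C0" "v2 \<in> C0" "v3 \<in> C0" "e0 \<in> C1" "e1 \<in> C1" "e2 \<in> C1" "e3 \<in> C1"
    using s by simp_all
  have ne: "v0 \<noteq> v1" "v1 \<noteq> v2" "v2 \<noteq> v3" "v3 \<noteq> v0" "v0 \<noteq> v3" "v3 \<noteq> v2" "v2 \<noteq> v1" "v1 \<noteq> v0"
    using dv by auto
  show "(v0, e0, v1) \<in> darts" "(v1, e1, v2) \<in> darts" "(v2, e2, v3) \<in> darts" "(v3, e3, v0) \<in> darts"
    "(v0, e3, v3) \<in> darts" "(v3, e2, v2) \<in> darts" "(v2, e1, v1) \<in> darts" "(v1, e0, v0) \<in> darts"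
    unfolding darts_def using C v ne by (simp_all add: insert_commute)
  show "face e0 f" "face e1 f" "face e2 f" "face e3 f" using F by blast+
  show "distinct [v0, v1, v2, v3]" by (rule dv)
  show "distinct [e0, e1, e2, e3]"
    using v dv by (auto simp: doubleton_eq_iff)
  show "verts f = {v0, v1, v2, v3}"
  proof -
    have "face v f \<longleftrightarrow> v \<in> {f, e0, e1, e2, e3, v0, v1, v2, v3}" for v using F by blast
    then show ?thesis unfolding verts_def using C dim_distinct assms(2) by auto
  qed
  assume d: "d \<in> darts" "face (edge d) f"
  have "edge d \<in> {f, e0, e1, e2, e3, v0, v1, v2, v3}" using d(2) F by blast
  then have "edge d \<in> {e0, e1, e2, e3}" using darts_D(1)[OF d(1)] assms(2) dim_distinct C by blast
  moreover have "d = (x, g, y) \<or> d = (y, g, x)" if "edge d = g" "verts g = {x, y}" for g x y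
    using darts_D(2)[OF d(1)] that by (cases d) (auto simp: doubleton_eq_iff)
  note this[OF _ v(1)] this[OF _ v(2)] this[OF _ v(3)] this[OF _ v(4)]
  ultimately show "d \<in> {(v0, e0, v1), (v1, e1, v2), (v2, e2, v3), (v3, e3, v0),
      (v0, e3, v3), (v3, e2, v2), (v2, e1, v1), (v1, e0, v0)}"
    by blast
qed

lemma square_dart_unique:
  assumes "f \<in> C2" "d \<in> darts" "d' \<in> darts" "face (edge d) f" "face (edge d') f"
    "source d = source d'" "target d = target d'"
  shows "d = d'"
proof -
  obtain u e w where d: "d = (u, e, w)" by (cases d)
  obtain v2 v3 e1 e2 e3 where s: "square_cycle f u w v2 v3 e e1 e2 e3"
    using square_cycle_at[OF assms(1)] assms(2,4) d by (metis fst_conv snd_conv)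
  show ?thesis using square_cycle_D(13)[OF s assms(1,3,5)] square_cycle_D(14)[OF s assms(1)] assms(6,7)
    unfolding d by (cases d') auto
qed

lemma square_next_unique:
  assumes "f \<in> C2" "p \<in> darts" "a \<in> darts" "a' \<in> darts"
    "face (edge p) f" "face (edge a) f" "face (edge a') f"
    "source a = target p" "source a' = target p" "target a \<noteq> source p" "target a' \<noteq> source p"
  shows "a = a'"
proof -
  obtain u e w where p: "p = (u, e, w)" by (cases p)
  obtain v2 v3 e1 e2 e3 where s: "square_cycle f u w v2 v3 e e1 e2 e3"
    using square_cycle_at[OF assms(1)] assms(2,5) p by (metis fst_conv snd_conv)
  show ?thesis
    using square_cycle_D(13)[OF s assms(1,3,6)] square_cycle_D(13)[OF s assms(1,4,7)]
      square_cycle_D(14)[OF s assms(1)] assms(8-11)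
    unfolding p by (cases a; cases a') auto
qed

lemma square_at_dart:
  assumes "f \<in> C2" "p \<in> darts" "face (edge p) f"
  obtains a q b where "sq p a q b" "face (edge q) f" "corner X (source p) f = {edge p, edge q}"
    "\<And>q'. q' \<in> darts \<Longrightarrow> face (edge q') f \<Longrightarrow> source q' = source p \<Longrightarrow> q' = p \<or> q' = q"
proof -
  obtain u e w where p: "p = (u, e, w)" by (cases p)
  obtain v2 v3 e1 e2 e3 where s: "square_cycle f u w v2 v3 e e1 e2 e3"
    using square_cycle_at[OF assms(1)] assms(2,3) p by (metis fst_conv snd_conv)
  note D = square_cycle_D[OF s assms(1)]
  have "sq (u, e, w) (w, e1, v2) (u, e3, v3) (v3, e2, v2)"
    unfolding sq_def using D(1-12,14) assms(1) by (auto intro!: bexI[of _ f])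
  moreover have q': "q' = (u, e, w) \<or> q' = (u, e3, v3)"
    if "q' \<in> darts" "face (edge q') f" "source q' = u" for q'
    using D(13)[OF that(1,2)] D(14) that(3) by (cases q') auto
  moreover have "corner X u f = {e, e3}"
  proof (intro equalityI subsetI)
    fix g assume "g \<in> corner X u f"
    then have g: "g \<in> C1" "u \<in> verts g" "face g f"
      using darts_D(4)[OF D(1)] unfolding corner_def edges_at_def verts_def by auto
    obtain d where "d \<in> darts" "source d = u" "edge d = g" by (rule dart_exists[OF g(1,2)])
    then show "g \<in> {e, e3}" using q'[of d] g(3) by (cases d) auto
  next
    fix g assume "g \<in> {e, e3}"
    moreover have "e \<in> C1" "face u e" "e3 \<in> C1" "face u e3"
      using darts_D(1,6)[OF D(5)] darts_D(1,6)[OF D(1)] by auto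
    ultimately show "g \<in> corner X u f"
      unfolding corner_def edges_at_def using D(9,12) by auto
  qed
  ultimately show ?thesis using that[of "(w, e1, v2)" "(u, e3, v3)" "(v3, e2, v2)"] D(12) p by simp
qed

lemma sq_square:
  assumes "sq p a q b"
  obtains f where "f \<in> C2" "face (edge p) f" "face (edge a) f" "face (edge q) f" "face (edge b) f"
    "corner X (source p) f = {edge p, edge q}"
proof -
  obtain f where f: "f \<in> C2" "\<forall>d\<in>{p, a, q, b}. face (edge d) f" and pq: "p \<in> darts" "q \<in> darts"
      "p \<noteq> q" "source p = source q"
    using assms unfolding sq_def by auto
  obtain a' q' b' where "corner X (source p) f = {edge p, edge q'}"
    "\<And>q''. q'' \<in> darts \<Longrightarrow> face (edge q'') f \<Longrightarrow> source q'' = source p \<Longrightarrow> q'' = p \<or> q'' = q'"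
    using square_at_dart[OF f(1) pq(1)] f(2) by (metis insertI1)
  moreover from this(2)[of q] have "q = q'" using f(2) pq by auto
  ultimately show ?thesis using that[of f] f by simp
qed

lemma link_inj: "v \<in> C0 \<Longrightarrow> inj_on (corner X v) (cells_at X v)"
  and link_flag: "v \<in> C0 \<Longrightarrow> flag (edges_at X v) (link X v)"
  using CAT0[unfolded CAT0_cube_complex_def] by blast+

lemma square_at: "f \<in> C2 \<Longrightarrow> face v f \<Longrightarrow> f \<in> cells_at X v"
  unfolding cells_at_def cells_of_dim_def by auto

lemma corner_unique:
  assumes "f \<in> C2" "f' \<in> C2" "v \<in> C0" "face v f" "face v f'" "corner X v f = corner X v f'"
  shows "f = f'"
  using inj_onD[OF link_inj[OF assms(3)] assms(6)] square_at assms by blast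

lemma corner_card:
  assumes "c \<in> cells_at X v" "v \<in> C0"
  shows "finite (corner X v c) \<and> card (corner X v c) \<le> 2"
proof -
  have c: "c \<in> cells X" "1 \<le> cdim X c" "face v c" using assms unfolding cells_at_def by auto
  from c(1) show ?thesis
  proof (cases rule: cdim_cases)
    case 1
    then show ?thesis using c(2) unfolding cells_of_dim_def by simp
  next
    case 2
    obtain a b where ab: "a \<noteq> b" "verts c = {a, b}" "{d. face d c} = {c, a, b}" by (rule edge_verts[OF 2])
    then have "a \<notin> C1" "b \<notin> C1" using verts_C0[of c] dim_distinct(1) by auto
    then have "corner X v c \<subseteq> {c}"
      using ab(3) unfolding corner_def edges_at_def by auto
    then show ?thesis using card_mono[of "{c}" "corner X v c"] finite_subset[of "corner X v c" "{c}"] by simp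
  next
    case 3
    then show ?thesis
    proof (cases "corner X v c = {}")
      case False
      then obtain e where e: "e \<in> C1" "v \<in> verts e" "face e c"
        using assms unfolding corner_def edges_at_def verts_def by auto
      obtain p where p: "p \<in> darts" "source p = v" "edge p = e" by (rule dart_exists[OF e(1,2)])
      then obtain a q b where "corner X (source p) c = {edge p, edge q}"
        using square_at_dart[OF 3 p(1)] e(3) by metis
      then show ?thesis using p by (simp add: card_insert_if)
    qed simp
  qed
qed

text \<open>A corner determines the square because different cells at a vertex give different simplices of
  the link; three squares that meet pairwise at a vertex would, by the flag condition, give a cell
  with three edges at that vertex.\<close>

lemma sq_square_complex: "square_complex C0 darts (\<lambda>d. source d) (\<lambda>d. target d) reverse sq"
proof
  fix d :: "'c \<times> 'c \<times> 'c" assume "d \<in> darts"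
  then show "source d \<in> C0" "reverse d \<in> darts" "reverse (reverse d) = d" "source (reverse d) = target d"
    using darts_D reverse_darts by auto
next
  fix p a q b assume sq: "sq p a q b"
  then show "p \<in> darts \<and> a \<in> darts \<and> q \<in> darts \<and> b \<in> darts" "p \<noteq> q"
    "source p = source q \<and> target p = source a \<and> target q = source b \<and> target a = target b"
    unfolding sq_def by auto
  show "sq q b p a" using sq unfolding sq_def by auto
  obtain f where f: "f \<in> C2" "face (edge p) f" "face (edge a) f" "face (edge q) f" "face (edge b) f"
    using sq_square[OF sq] by metis
  have "target p \<noteq> target q" using square_dart_unique[OF f(1) _ _ f(2,4)] sq unfolding sq_def by auto
  moreover have "reverse p \<noteq> a" using sq reverse_simps(2)[of p] unfolding sq_def by metis
  ultimately show "sq (reverse p) q a (reverse b)"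
    using sq f unfolding sq_def by (auto simp: reverse_darts intro!: bexI[of _ f])
  fix a' b' assume sq': "sq p a' q b'"
  obtain f' where f': "f' \<in> C2" "face (edge p) f'" "face (edge a') f'" "face (edge q) f'"
    "face (edge b') f'" "corner X (source p) f' = {edge p, edge q}" by (rule sq_square[OF sq'])
  obtain f where f: "f \<in> C2" "face (edge p) f" "face (edge a) f" "face (edge q) f"
    "face (edge b) f" "corner X (source p) f = {edge p, edge q}" by (rule sq_square[OF sq])
  have D: "p \<in> darts" "q \<in> darts" "a \<in> darts" "b \<in> darts" "a' \<in> darts" "b' \<in> darts"
    using sq_darts(1-4)[OF sq] sq_darts(2,4)[OF sq'] by auto
  have "f' = f"
    by (rule corner_unique[OF f'(1) f(1) darts_D(4)[OF D(1)]])
      (use face_trans[OF darts_D(6)[OF D(1)]] f f' in auto)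
  note f' = f'[unfolded this] and S = sq_darts[OF sq] and S' = sq_darts[OF sq']
  have "a = a'"
    by (rule square_next_unique[OF f(1) D(1,3,5) f(2,3) f'(3)]) (use S S' in simp_all)
  moreover have "b = b'"
    by (rule square_next_unique[OF f(1) D(2,4,6) f(4,5) f'(5)]) (use S S' in simp_all)
  ultimately show "a = a' \<and> b = b'" by blast
next
  fix p a q b c r d e f assume s: "sq p a q b" "sq q c r d" "sq p e r f"
  have D: "p \<in> darts" "q \<in> darts" "r \<in> darts" "source p = source q" "source p = source r"
    "p \<noteq> q" "q \<noteq> r" "p \<noteq> r" using sq_darts[OF s(1)] sq_darts[OF s(2)] sq_darts[OF s(3)] by auto
  let ?v = "source p"
  have v: "?v \<in> C0" using darts_D D by blast
  have in_link: "{edge p, edge q} \<in> link X (source p)" if s: "sq p a q b" for p a q b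
  proof -
    obtain f where f: "f \<in> C2" "face (edge p) f" "corner X (source p) f = {edge p, edge q}"
      using sq_square[OF s] by metis
    have "p \<in> darts" using sq_darts(1)[OF s] .
    then have "f \<in> cells_at X (source p)" using square_at f face_trans darts_D(6) by blast
    then show ?thesis unfolding link_def using f(3) by (intro image_eqI[of _ _ f]) simp_all
  qed
  have l: "{edge p, edge q} \<in> link X ?v" "{edge q, edge r} \<in> link X ?v"
    "{edge p, edge r} \<in> link X ?v" using in_link[OF s(1)] in_link[OF s(2)] in_link[OF s(3)] D by auto
  let ?s = "{edge p, edge q, edge r}"
  have "?s \<subseteq> edges_at X ?v" 
    using darts_D(1,6)[OF D(1)] darts_D(1,6)[OF D(2)] darts_D(1,6)[OF D(3)] D(4,5)
    unfolding edges_at_def by simp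
  moreover have "{x, y} \<in> link X ?v" if "x \<in> ?s" "y \<in> ?s" "x \<noteq> y" for x y
    using l that by (auto simp: insert_commute)
  ultimately have "?s \<in> link X ?v"
    using link_flag[OF v, unfolded flag_def, rule_format, of ?s] by simp
  then obtain c where "c \<in> cells_at X ?v" "corner X ?v c = ?s" unfolding link_def by auto
  then have "card ?s \<le> 2" using corner_card v by metis
  moreover have "edge p \<noteq> edge q" "edge q \<noteq> edge r" "edge p \<noteq> edge r"
    using darts_eq D by metis+
  then have "card ?s = 3" by simp
  ultimately show False by simp
qed

end

context finite_CAT0_square_complex
begin

lemma square_cycle_from:
  assumes "f \<in> C2" "v \<in> verts f"
  obtains v1 v2 v3 e0 e1 e2 e3 where "square_cycle f v v1 v2 v3 e0 e1 e2 e3"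
proof -
  obtain v0 v1 v2 v3 e0 e1 e2 e3 where s: "square_cycle f v0 v1 v2 v3 e0 e1 e2 e3"
    by (rule square_cycle_exists[OF assms(1)])
  note s1 = square_cycle_rotate[OF s]
  note s2 = square_cycle_rotate[OF s1]
  note s3 = square_cycle_rotate[OF s2]
  have "v \<in> {v0, v1, v2, v3}" using square_cycle_D(16)[OF s assms(1)] assms(2) by simp
  then consider "v = v0" | "v = v1" | "v = v2" | "v = v3" by blast
  then show ?thesis
  proof cases
    case 1
    show ?thesis using s unfolding 1[symmetric] by (rule that)
  next
    case 2
    show ?thesis using s1 unfolding 2[symmetric] by (rule that)
  next
    case 3
    show ?thesis using s2 unfolding 3[symmetric] by (rule that)
  next
    case 4
    show ?thesis using s3 unfolding 4[symmetric] by (rule that)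
  qed
qed

lemma square_cycle_sq:
  assumes "square_cycle f v0 v1 v2 v3 e0 e1 e2 e3" "f \<in> C2"
  shows "sq (v0, e0, v1) (v1, e1, v2) (v0, e3, v3) (v3, e2, v2)"
  unfolding sq_def using square_cycle_D[OF assms] assms(2) by (auto intro!: bexI[of _ f])

lemma verts_nonempty: "c \<in> cells X \<Longrightarrow> verts c \<noteq> {}"
proof (erule cdim_cases)
  assume "c \<in> C1"
  then obtain u v where "verts c = {u, v}" using edge_verts by metis
  then show ?thesis by blast
next
  assume c: "c \<in> C2"
  then obtain v0 v1 v2 v3 e0 e1 e2 e3 where s: "square_cycle c v0 v1 v2 v3 e0 e1 e2 e3"
    using square_cycle_exists by metis
  show ?thesis using square_cycle_D(16)[OF s c] by simp
qed (simp add: verts_vertex)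

lemma dart_verts: "d \<in> darts \<Longrightarrow> face (edge d) c \<Longrightarrow> source d \<in> verts c \<and> target d \<in> verts c"
  using darts_D[of d] verts_mono[of "edge d" c] by auto

end

section \<open>Local systems on a square complex\<close>

text \<open>The data of a monodromy problem in the complex, with states of an arbitrary type.\<close>

locale flat_transport = finite_CAT0_square_complex X
  for X :: "('c, 'a::t2_space) cube_data" +
  fixes \<Omega> :: "'c \<Rightarrow> 's set" and T :: "'c \<times> 'c \<times> 'c \<Rightarrow> 's \<Rightarrow> 's"
  assumes T_state: "d \<in> darts \<Longrightarrow> s \<in> \<Omega> (source d) \<Longrightarrow> T d s \<in> \<Omega> (target d) \<and> T (reverse d) (T d s) = s"
    and T_square: "sq p a q b \<Longrightarrow> s \<in> \<Omega> (source p) \<Longrightarrow> T a (T p s) = T b (T q s)"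
begin

text \<open>A state on a cell is a compatible family of states at its vertices.  The value off the vertices is
  fixed so that families are determined by their restrictions to the vertices.\<close>

definition family :: "'c \<Rightarrow> ('c \<Rightarrow> 's) set" where
  "family c = {\<sigma>. (\<forall>v\<in>verts c. \<sigma> v \<in> \<Omega> v) \<and> (\<forall>v. v \<notin> verts c \<longrightarrow> \<sigma> v = undefined) \<and>
     (\<forall>d\<in>darts. face (edge d) c \<longrightarrow> \<sigma> (target d) = T d (\<sigma> (source d)))}"

definition restrict_family :: "'c \<Rightarrow> ('c \<Rightarrow> 's) \<Rightarrow> 'c \<Rightarrow> 's" where
  "restrict_family c \<sigma> = (\<lambda>v. if v \<in> verts c then \<sigma> v else undefined)"

lemma family_D:
  assumes "\<sigma> \<in> family c"
  shows "v \<in> verts c \<Longrightarrow> \<sigma> v \<in> \<Omega> v" "v \<notin> verts c \<Longrightarrow> \<sigma> v = undefined"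
    "d \<in> darts \<Longrightarrow> face (edge d) c \<Longrightarrow> \<sigma> (target d) = T d (\<sigma> (source d))"
  using assms unfolding family_def by blast+

lemma restrict_family:
  assumes "face c d" "\<tau> \<in> family d"
  shows "restrict_family c \<tau> \<in> family c"
proof -
  have "restrict_family c \<tau> (target p) = T p (restrict_family c \<tau> (source p))"
    if p: "p \<in> darts" "face (edge p) c" for p
    using dart_verts[OF p] family_D(3)[OF assms(2) p(1) face_trans[OF p(2) assms(1)]]
    unfolding restrict_family_def by simp
  then show ?thesis
    using family_D(1)[OF assms(2)] verts_mono[OF assms(1)] unfolding family_def restrict_family_def by auto
qed

lemma family_unique:
  assumes c: "c \<in> cells X" "v \<in> verts c" and fam: "\<sigma> \<in> family c" "\<tau> \<in> family c" and v: "\<sigma> v = \<tau> v"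
  shows "\<sigma> = \<tau>"
proof -
  have step: "\<sigma> (target d) = \<tau> (target d)" if "d \<in> darts" "face (edge d) c" "\<sigma> (source d) = \<tau> (source d)" for d
    using family_D(3)[OF fam(1) that(1,2)] family_D(3)[OF fam(2) that(1,2)] that(3) by simp
  have "\<sigma> w = \<tau> w" if w: "w \<in> verts c" for w
  proof (cases rule: cdim_cases[OF c(1)])
    case 1
    then show ?thesis using w c v verts_vertex by simp
  next
    case 2
    obtain d where d: "d \<in> darts" "source d = v" "edge d = c" by (rule dart_exists[OF 2 c(2)])
    then have "w = v \<or> w = target d" using darts_D(2)[OF d(1)] w by auto
    then show ?thesis using step[OF d(1)] d v face_refl[OF c(1)] by auto
  next
    case 3
    obtain v1 v2 v3 e0 e1 e2 e3 where s: "square_cycle c v v1 v2 v3 e0 e1 e2 e3"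
      by (rule square_cycle_from[OF 3 c(2)])
    note D = square_cycle_D[OF s 3]
    have "\<sigma> v1 = \<tau> v1" "\<sigma> v3 = \<tau> v3" using step[OF D(1)] step[OF D(5)] D(9,12) v by simp_all
    moreover have "\<sigma> v2 = \<tau> v2" using step[OF D(2)] D(10) calculation by simp
    ultimately show ?thesis using D(16) w v by auto
  qed
  moreover have "\<sigma> w = \<tau> w" if "w \<notin> verts c" for w using family_D(2)[OF fam(1) that] family_D(2)[OF fam(2) that] by simp
  ultimately show ?thesis by blast
qed

lemma family_exists:
  assumes c: "c \<in> cells X" "v \<in> verts c" and s: "s \<in> \<Omega> v"
  obtains \<sigma> where "\<sigma> \<in> family c" "\<sigma> v = s"
proof (cases rule: cdim_cases[OF c(1)])
  case 1
  then have v: "verts c = {v}" using verts_vertex c(2) by simp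
  have "\<not> face (edge d) c" if "d \<in> darts" for d
    using vertex_faces[OF 1] darts_D(1)[OF that] dim_distinct(1)[OF 1] by auto
  then have "(\<lambda>w. if w = v then s else undefined) \<in> family c" unfolding family_def v using s by auto
  then show ?thesis using that by simp
next
  case 2
  obtain d where d: "d \<in> darts" "source d = v" "edge d = c" by (rule dart_exists[OF 2 c(2)])
  obtain w where dw: "d = (v, c, w)" using d by (cases d) auto
  have vw: "verts c = {v, w}" "v \<noteq> w" using darts_D[OF d(1)] dw by auto
  have two: "d' = (v, c, w) \<or> d' = (w, c, v)" if d': "d' \<in> darts" "face (edge d') c" for d'
  proof -
    have "{e. face e c} \<inter> C1 \<subseteq> {c}"
    proof -
      obtain a b where "verts c = {a, b}" "{e. face e c} = {c, a, b}" by (rule edge_verts[OF 2])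
      then show ?thesis using verts_C0[of c] dim_distinct(1) by auto
    qed
    then have "edge d' = c" using d' darts_D(1) by blast
    then show ?thesis using darts_D(2)[OF d'(1)] vw by (cases d') (auto simp: doubleton_eq_iff)
  qed
  have T: "T (v, c, w) s \<in> \<Omega> w" "T (w, c, v) (T (v, c, w) s) = s"
    using T_state[OF d(1), of s] s unfolding dw reverse_def by simp_all
  define \<sigma> where "\<sigma> = (\<lambda>x. if x = v then s else if x = w then T (v, c, w) s else undefined)"
  have val: "\<sigma> v = s" "\<sigma> w = T (v, c, w) s" unfolding \<sigma>_def using vw(2) by simp_all
  have "\<sigma> \<in> family c" unfolding family_def
  proof (intro CollectI conjI ballI allI impI)
    fix x assume "x \<in> verts c"
    then consider "x = v" | "x = w" using vw(1) by blast
    then show "\<sigma> x \<in> \<Omega> x" using val s T(1) by cases simp_all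
  next
    fix x assume "x \<notin> verts c"
    then show "\<sigma> x = undefined" using vw(1) unfolding \<sigma>_def by auto
  next
    fix d' assume "d' \<in> darts" "face (edge d') c"
    from two[OF this] show "\<sigma> (target d') = T d' (\<sigma> (source d'))"
      by (elim disjE) (simp_all add: val T(2))
  qed
  then show ?thesis using that val by blast
next
  case 3
  obtain v1 v2 v3 e0 e1 e2 e3 where cyc: "square_cycle c v v1 v2 v3 e0 e1 e2 e3"
    by (rule square_cycle_from[OF 3 c(2)])
  note D = square_cycle_D[OF cyc 3]
  have ne: "v \<noteq> v1" "v \<noteq> v2" "v \<noteq> v3" "v1 \<noteq> v2" "v1 \<noteq> v3" "v2 \<noteq> v3"
    "v1 \<noteq> v" "v2 \<noteq> v" "v3 \<noteq> v" "v2 \<noteq> v1" "v3 \<noteq> v1" "v3 \<noteq> v2" using D(14) by auto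
  define s1 where "s1 = T (v, e0, v1) s"
  define s3 where "s3 = T (v, e3, v3) s"
  define s2 where "s2 = T (v1, e1, v2) s1"
  have s1: "s1 \<in> \<Omega> v1" "T (v1, e0, v) s1 = s"
    using T_state[OF D(1), of s] s unfolding s1_def reverse_def by simp_all
  have s3: "s3 \<in> \<Omega> v3" "T (v3, e3, v) s3 = s"
    using T_state[OF D(5), of s] s unfolding s3_def reverse_def by simp_all
  have s2: "s2 \<in> \<Omega> v2" "T (v2, e1, v1) s2 = s1"
    using T_state[OF D(2), of s1] s1 unfolding s2_def reverse_def by simp_all
  have s2': "T (v3, e2, v2) s3 = s2"
    using T_square[OF square_cycle_sq[OF cyc 3], of s] s unfolding s1_def s2_def s3_def by simp
  have s2'': "T (v2, e2, v3) s2 = s3"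
    using T_state[OF D(6), of s3] s3 s2' unfolding reverse_def by simp
  define \<sigma> where "\<sigma> = (\<lambda>x. if x = v then s else if x = v1 then s1 else if x = v2 then s2
    else if x = v3 then s3 else undefined)"
  have val: "\<sigma> v = s" "\<sigma> v1 = s1" "\<sigma> v2 = s2" "\<sigma> v3 = s3" unfolding \<sigma>_def using ne by simp_all
  have "\<sigma> \<in> family c" unfolding family_def
  proof (intro CollectI conjI ballI allI impI)
    fix w assume "w \<in> verts c"
    then show "\<sigma> w \<in> \<Omega> w" using D(16) val s s1 s2 s3 by auto
  next
    fix w assume "w \<notin> verts c"
    then show "\<sigma> w = undefined" using D(16) unfolding \<sigma>_def by auto
  next
    fix d assume "d \<in> darts" "face (edge d) c"
    from D(13)[OF this] show "\<sigma> (target d) = T d (\<sigma> (source d))"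
      by (elim insertE emptyE)
        (simp_all add: val s1(2) s2(2) s3(2) s2' s2'' s1_def[symmetric] s2_def[symmetric] s3_def[symmetric])
  qed
  then show ?thesis using that val by blast
qed

sublocale local_system "realization X" carrier face family restrict_family
proof
  fix c d \<tau> assume cd: "face c d" and \<tau>: "\<tau> \<in> family d"
  show "restrict_family c \<tau> \<in> family c" by (rule restrict_family[OF cd \<tau>])
  fix \<tau>' assume \<tau>': "\<tau>' \<in> family d" "restrict_family c \<tau> = restrict_family c \<tau>'"
  obtain v where v: "v \<in> verts c" using verts_nonempty face_cells cd by blast
  have "\<tau> v = \<tau>' v" using fun_cong[OF \<tau>'(2), of v] v unfolding restrict_family_def by simp
  moreover have "v \<in> verts d" using verts_mono[OF cd] v by blast
  ultimately show "\<tau> = \<tau>'" using family_unique[of d v] face_cells cd \<tau> \<tau>'(1) by blast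
next
  fix c d \<sigma> assume cd: "face c d" and \<sigma>: "\<sigma> \<in> family c"
  obtain v where v: "v \<in> verts c" using verts_nonempty face_cells cd by blast
  have vd: "v \<in> verts d" using verts_mono[OF cd] v by blast
  have cX: "c \<in> cells X" and dX: "d \<in> cells X" using cd face_cells by blast+
  obtain \<tau> where \<tau>: "\<tau> \<in> family d" "\<tau> v = \<sigma> v"
    by (rule family_exists[OF dX vd family_D(1)[OF \<sigma> v]])
  have "restrict_family c \<tau> v = \<sigma> v" using \<tau> v unfolding restrict_family_def by simp
  then have "restrict_family c \<tau> = \<sigma>" using family_unique[OF cX v restrict_family[OF cd \<tau>(1)] \<sigma>] by blast
  then show "\<exists>\<tau>\<in>family d. restrict_family c \<tau> = \<sigma>" using \<tau> by blast
next
  fix b c d \<tau> assume "face b c"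
  then show "restrict_family b (restrict_family c \<tau>) = restrict_family b \<tau>"
    using verts_mono[of b c] unfolding restrict_family_def by (intro ext) auto
next
  fix \<tau> c assume "\<tau> \<in> family c"
  then show "restrict_family c \<tau> = \<tau>" 
    using family_D(2)[of \<tau> c] unfolding restrict_family_def by (intro ext) simp
qed (use open_star_carrier in blast)

text \<open>A family on the edge restricts to a section along its characteristic map, and its values at
  the ends differ by the transport.\<close>

lemma edge_section:
  assumes d: "d \<in> darts"
  obtains \<gamma> where "path \<gamma>" "path_image \<gamma> \<subseteq> realization X" "pathstart \<gamma> = pt (source d)"
    "pathfinish \<gamma> = pt (target d)"
    "\<And>s. s \<in> \<Omega> (source d) \<Longrightarrow> \<exists>L. is_section {0..1} \<gamma> L \<and> L 0 (source d) = s \<and> L 1 (target d) = T d s"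
proof -
  let ?e = "edge d"
  have e: "?e \<in> C1" and eX: "?e \<in> cells X" using darts_D(1)[OF d] dim_cells by auto
  have dim: "cdim X ?e = 1" using e dim_cells by blast
  define g where "g = (\<lambda>t. chart X ?e (point1 t))"
  have gc: "continuous_on {0..1} g" unfolding g_def
    by (rule continuous_on_compose2[OF chart_continuous[OF eX] continuous_point1]) (auto simp: dim cube_1)
  have gi: "g ` {0..1} = closed_cell X ?e" unfolding g_def edge_cell(1)[OF e] ..
  obtain u v where uv: "u \<noteq> v" "verts ?e = {u, v}" "pt u = g 0" "pt v = g 1"
    using edge_verts[OF e] unfolding g_def by metis
  define \<gamma> where "\<gamma> = (if source d = u then g else (\<lambda>t. g (1 - t)))"
  have ends: "source d = u \<and> target d = v \<or> source d = v \<and> target d = u"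
    using darts_D(2)[OF d] uv by (auto simp: doubleton_eq_iff)
  have gc': "continuous_on {0..1} (\<lambda>t. g (1 - t))"
    by (rule continuous_on_compose2[OF gc]) (auto intro!: continuous_intros)
  have gi': "(\<lambda>t. g (1 - t)) ` {0..1} \<subseteq> closed_cell X ?e" unfolding gi[symmetric] by auto
  have \<gamma>: "continuous_on {0..1} \<gamma>" "\<gamma> ` {0..1} \<subseteq> closed_cell X ?e"
    using gc gc' gi gi' unfolding \<gamma>_def by auto
  have st: "\<gamma> 0 = pt (source d)" "\<gamma> 1 = pt (target d)" using ends uv unfolding \<gamma>_def by auto
  have real: "\<gamma> ` {0..1} \<subseteq> realization X" using \<gamma>(2) eX unfolding realization_def by blast
  have sec: "\<exists>L. is_section {0..1} \<gamma> L \<and> L 0 (source d) = s \<and> L 1 (target d) = T d s"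
    if s: "s \<in> \<Omega> (source d)" for s
  proof -
    have sv: "source d \<in> verts ?e" "target d \<in> verts ?e" using dart_verts[OF d face_refl[OF eX]] by auto
    obtain \<tau> where \<tau>: "\<tau> \<in> family ?e" "\<tau> (source d) = s" by (rule family_exists[OF eX sv(1) s])
    have "is_section {0..1} \<gamma> (\<lambda>t. restrict_family (carrier (\<gamma> t)) \<tau>)"
      using \<gamma>(2) carrier_face[OF eX] by (intro is_section_restrict[OF \<gamma>(1) real _ \<tau>(1)]) blast
    moreover have "\<tau> (target d) = T d s" using family_D(3)[OF \<tau>(1) d face_refl[OF eX]] \<tau>(2) by simp
    moreover have "carrier (\<gamma> 0) = source d" "carrier (\<gamma> 1) = target d"
      using st carrier_pt darts_D[OF d] by simp_all
    ultimately show ?thesis using \<tau>(2) verts_vertex darts_D[OF d] unfolding restrict_family_def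
      by (intro exI[of _ "\<lambda>t. restrict_family (carrier (\<gamma> t)) \<tau>"]) (simp add: restrict_family_def)
  qed
  show ?thesis
    by (rule that[of \<gamma>]) (use \<gamma> real st sec in \<open>simp_all add: path_def path_image_def pathstart_def pathfinish_def\<close>)
qed

lemma section_value_unique:
  assumes "is_section A \<gamma> L" "is_section B \<gamma>' M" "t \<in> A" "t' \<in> B" "\<gamma> t = pt v" "\<gamma>' t' = pt v"
    "v \<in> C0" "L t v = M t' v"
  shows "L t = M t'"
proof (rule family_unique[of v v])
  show "L t \<in> family v" "M t' \<in> family v"
    using is_section_fib[OF assms(1,3)] is_section_fib[OF assms(2,4)] assms(5-7) carrier_pt by simp_all
qed (use assms verts_vertex dim_cells in auto)

end

context finite_CAT0_square_complex
begin

sublocale sqc: square_complex C0 darts fst "\<lambda>d. snd (snd d)" reverse sq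
  by (rule sq_square_complex)

end

context flat_transport
begin

lemma walk_section:
  assumes "sqc.walk w x y"
  shows "\<exists>\<gamma>. path \<gamma> \<and> path_image \<gamma> \<subseteq> realization X \<and> pathstart \<gamma> = pt x \<and> pathfinish \<gamma> = pt y \<and>
    (\<forall>s\<in>\<Omega> x. \<exists>L. is_section {0..1} \<gamma> L \<and> L 0 x = s \<and> L 1 y = transport T w s)"
  using assms
proof (induction w arbitrary: y)
  case Nil
  then have xy: "y = x" "x \<in> C0" by auto
  have "\<exists>L. is_section {0..1} (\<lambda>t. pt x) L \<and> L 0 x = s \<and> L 1 x = s" if s: "s \<in> \<Omega> x" for s
  proof -
    have x: "x \<in> cells X" "x \<in> verts x" using xy verts_vertex dim_cells by auto
    obtain \<tau> where \<tau>: "\<tau> \<in> family x" "\<tau> x = s" by (rule family_exists[OF x s])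
    have "is_section {0..1} (\<lambda>t. pt x) (\<lambda>t. restrict_family (carrier (pt x)) \<tau>)"
      by (rule is_section_restrict[OF _ _ _ \<tau>(1)])
        (use xy carrier_pt face_refl[OF x(1)] pt_realization in auto)
    then show ?thesis using \<tau> res_id[OF \<tau>(1)] carrier_pt[OF xy(2)] by auto
  qed
  then show ?case using xy pt_realization
    by (intro exI[of _ "\<lambda>t. pt x"]) (auto simp: path_def path_image_def pathstart_def pathfinish_def)
next
  case (Cons a w)
  then have a: "a \<in> darts" "target a = y" and w: "sqc.walk w x (source a)" by auto
  from Cons.IH[OF w] obtain p where p: "path p" "path_image p \<subseteq> realization X" "pathstart p = pt x"
    "pathfinish p = pt (source a)"
    "\<forall>s\<in>\<Omega> x. \<exists>L. is_section {0..1} p L \<and> L 0 x = s \<and> L 1 (source a) = transport T w s" by blast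
  obtain q where q: "path q" "path_image q \<subseteq> realization X" "pathstart q = pt (source a)"
    "pathfinish q = pt (target a)"
    "\<And>s. s \<in> \<Omega> (source a) \<Longrightarrow> \<exists>L. is_section {0..1} q L \<and> L 0 (source a) = s \<and> L 1 (target a) = T a s"
    by (rule edge_section[OF a(1)]) blast
  have aC: "source a \<in> C0" using darts_D[OF a(1)] by blast
  have "\<exists>L. is_section {0..1} (p +++ q) L \<and> L 0 x = s \<and> L 1 y = transport T (a # w) s" if s: "s \<in> \<Omega> x" for s
  proof -
    obtain L where L: "is_section {0..1} p L" "L 0 x = s" "L 1 (source a) = transport T w s" using p(5) s by blast
    have p1: "p 1 = pt (source a)" and q0: "q 0 = pt (source a)"
      using p(4) q(3) unfolding pathfinish_def pathstart_def by auto
    have "L 1 \<in> family (source a)" using is_section_fib[OF L(1), of 1] p1 carrier_pt[OF aC] by simp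
    then have "transport T w s \<in> \<Omega> (source a)"
      using family_D(1)[of "L 1" "source a" "source a"] L(3) verts_vertex[OF aC] by simp
    then obtain M where M: "is_section {0..1} q M" "M 0 (source a) = transport T w s"
      "M 1 (target a) = T a (transport T w s)" using q(5) by blast
    have "L 1 = M 0"
      by (rule section_value_unique[OF L(1) M(1) _ _ p1 q0 aC]) (use L M in auto)
    then have "is_section {0..1} (p +++ q) (\<lambda>t. if t \<le> 1/2 then L (2 * t) else M (2 * t - 1))"
      using is_section_join[OF L(1) M(1)] p q by simp
    then show ?thesis using L M a by (intro exI[of _ "\<lambda>t. if t \<le> 1/2 then L (2 * t) else M (2 * t - 1)"]) simp
  qed
  then show ?case using p q a
    by (intro exI[of _ "p +++ q"]) (auto simp: path_image_join)
qed

lemma transport_closed_walk: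
  assumes w: "sqc.walk w x x" and s: "s \<in> \<Omega> x"
  shows "transport T w s = s"
proof -
  obtain \<gamma> L where g: "path \<gamma>" "path_image \<gamma> \<subseteq> realization X" "pathstart \<gamma> = pt x" "pathfinish \<gamma> = pt x"
    and L: "is_section {0..1} \<gamma> L" "L 0 x = s" "L 1 x = transport T w s"
    using walk_section[OF w] s by blast
  have "simply_connected (realization X)" using CAT0 unfolding CAT0_cube_complex_def by blast
  then have "L 0 = L 1" using trivial_monodromy[OF _ g(1,2) _ L(1)] g(3,4) by simp
  then show ?thesis using L by simp
qed

end

context finite_CAT0_square_complex
begin

text \<open>The closed cells whose vertices can be reached from \<open>x\<close>, and the others, form two closed sets that
  cover the realization; they are disjoint as the vertices of the carrier of a common
  point belong to cells of both kinds.\<close>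

lemma walk_connected:
  assumes x: "x \<in> C0" and y: "y \<in> C0"
  shows "\<exists>w. sqc.walk w x y"
proof (rule ccontr)
  assume no: "\<not> ?thesis"
  define R where "R = {v. \<exists>w. sqc.walk w x v}"
  have step: "target d \<in> R" if d: "d \<in> darts" "source d \<in> R" for d
  proof -
    obtain w where "sqc.walk w x (source d)" using d(2) unfolding R_def by blast
    then have "sqc.walk (d # w) x (target d)" using d(1) by simp
    then show ?thesis unfolding R_def by blast
  qed
  have step': "source d \<in> R" if "d \<in> darts" "target d \<in> R" for d
    using step[of "reverse d"] reverse_darts that by simp
  have spread: "verts c \<subseteq> R" if c: "c \<in> cells X" "v \<in> verts c" "v \<in> R" for c v
  proof (cases rule: cdim_cases[OF c(1)])
    case 1
    then show ?thesis using c verts_vertex by auto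
  next
    case 2
    obtain d where d: "d \<in> darts" "source d = v" "edge d = c" by (rule dart_exists[OF 2 c(2)])
    then show ?thesis using step[OF d(1)] darts_D(2)[OF d(1)] c by auto
  next
    case 3
    obtain v1 v2 v3 e0 e1 e2 e3 where cyc: "square_cycle c v v1 v2 v3 e0 e1 e2 e3"
      by (rule square_cycle_from[OF 3 c(2)])
    note D = square_cycle_D[OF cyc 3]
    have "v1 \<in> R" "v3 \<in> R" using step[OF D(1)] step[OF D(5)] c by auto
    moreover have "v2 \<in> R" using step[OF D(2)] \<open>v1 \<in> R\<close> by auto
    ultimately show ?thesis using D(16) c by auto
  qed
  define A where "A = (\<Union>c\<in>{c \<in> cells X. verts c \<subseteq> R}. closed_cell X c)"
  define B where "B = (\<Union>c\<in>{c \<in> cells X. \<not> verts c \<subseteq> R}. closed_cell X c)"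
  have "closed A" "closed B"
    unfolding A_def B_def using finite_cells closed_closed_cell by (auto intro!: closed_UN)
  moreover have "realization X \<subseteq> A \<union> B" unfolding A_def B_def realization_def by blast
  moreover have "A \<inter> B \<inter> realization X = {}"
  proof (rule ccontr)
    assume "A \<inter> B \<inter> realization X \<noteq> {}"
    then obtain z c d where z: "z \<in> realization X" "c \<in> cells X" "verts c \<subseteq> R" "z \<in> closed_cell X c"
      "d \<in> cells X" "\<not> verts d \<subseteq> R" "z \<in> closed_cell X d" unfolding A_def B_def by blast
    obtain v where v: "v \<in> verts (carrier z)" using verts_nonempty in_closed_carrier(1)[OF z(1)] by blast
    have "v \<in> verts c" "v \<in> verts d"
      using v verts_mono carrier_face[OF z(2,4)] carrier_face[OF z(5,7)] by blast+
    then show False using spread[OF z(5)] z(3,6) by blast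
  qed
  moreover have "pt x \<in> A \<inter> realization X"
  proof -
    have "x \<in> R" unfolding R_def using x by (auto intro!: exI[of _ "[]"])
    then have "x \<in> {c \<in> cells X. verts c \<subseteq> R}" "pt x \<in> closed_cell X x"
      using x vertex_cell(1) verts_vertex dim_cells(1) by simp_all
    then show ?thesis unfolding A_def using pt_realization[OF x] by blast
  qed
  moreover have "pt y \<in> B \<inter> realization X"
  proof -
    have "y \<notin> R" unfolding R_def using no by simp
    then have "y \<in> {c \<in> cells X. \<not> verts c \<subseteq> R}" "pt y \<in> closed_cell X y"
      using y vertex_cell(1) verts_vertex dim_cells(1) by simp_all
    then show ?thesis unfolding B_def using pt_realization[OF y] by blast
  qed
  moreover have "connected (realization X)"
    using CAT0 simply_connected_imp_connected_general unfolding CAT0_cube_complex_def by blast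
  ultimately show False unfolding connected_closed by blast
qed

sublocale sqc: sc_square_complex C0 darts fst "\<lambda>d. snd (snd d)" reverse sq
proof
  show "\<exists>w. sqc.walk w x y" if "x \<in> C0" "y \<in> C0" for x y using walk_connected[OF that] .
  fix \<Omega> :: "'c \<Rightarrow> ('c \<times> 'c \<times> 'c) list set set" and T w x s
  assume 1: "\<And>d s. d \<in> darts \<Longrightarrow> s \<in> \<Omega> (fst d) \<Longrightarrow> T d s \<in> \<Omega> (snd (snd d)) \<and> T (reverse d) (T d s) = s"
    and 2: "\<And>p a q b s. sq p a q b \<Longrightarrow> s \<in> \<Omega> (fst p) \<Longrightarrow> T a (T p s) = T b (T q s)"
    and w: "sqc.walk w x x" "s \<in> \<Omega> x"
  interpret flat_transport X \<Omega> T by unfold_locales (use 1 2 in auto)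
  show "transport T w s = s" by (rule transport_closed_walk[OF w])
qed

end

section \<open>The graph determines the complex\<close>

context finite_CAT0_square_complex
begin

definition adjacent :: "'c \<Rightarrow> 'c \<Rightarrow> bool" where
  "adjacent u v \<longleftrightarrow> (\<exists>d\<in>darts. source d = u \<and> target d = v)"

lemma adjacent_iff: "u \<in> C0 \<Longrightarrow> v \<in> C0 \<Longrightarrow> adjacent u v \<longleftrightarrow> sqc.distance u v = 1"
  unfolding adjacent_def using sqc.distance_dart sqc.distance_1[of u v] by metis

lemma adjacent_sym: "adjacent u v \<Longrightarrow> adjacent v u"
  unfolding adjacent_def using reverse_darts reverse_simps by metis

lemma adjacent_C0: "adjacent u v \<Longrightarrow> u \<in> C0 \<and> v \<in> C0"
  unfolding adjacent_def using darts_D by blast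

lemma skeleton_adj_iff: "(u, v) \<in> skeleton_adj X \<longleftrightarrow> adjacent u v"
proof
  assume "(u, v) \<in> skeleton_adj X"
  then obtain e where e: "u \<in> C0" "v \<in> C0" "u \<noteq> v" "e \<in> C1" "face u e" "face v e"
    unfolding skeleton_adj_def by blast
  then have "u \<in> verts e" "v \<in> verts e" unfolding verts_def by blast+
  then have "(u, e, v) \<in> darts" using edge_verts_eq[of e u v] e unfolding darts_def by blast
  then show "adjacent u v" unfolding adjacent_def by force
next
  assume "adjacent u v"
  then obtain d where d: "d \<in> darts" "source d = u" "target d = v" unfolding adjacent_def by blast
  then show "(u, v) \<in> skeleton_adj X" unfolding skeleton_adj_def using darts_D[OF d(1)] by auto
qed

lemma relpow_walk: "u \<in> C0 \<Longrightarrow> (u, v) \<in> skeleton_adj X ^^ n \<longleftrightarrow> (\<exists>w. sqc.walk w u v \<and> length w = n)"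
proof (induction n arbitrary: v)
  case 0
  then show ?case by auto
next
  case (Suc n)
  have "(u, v) \<in> skeleton_adj X ^^ Suc n \<longleftrightarrow> (\<exists>y. (\<exists>w. sqc.walk w u y \<and> length w = n) \<and> adjacent y v)"
    using Suc skeleton_adj_iff by auto
  also have "\<dots> \<longleftrightarrow> (\<exists>w. sqc.walk w u v \<and> length w = Suc n)"
  proof
    assume "\<exists>y. (\<exists>w. sqc.walk w u y \<and> length w = n) \<and> adjacent y v"
    then obtain w d where "sqc.walk w u (source d)" "length w = n" "d \<in> darts" "target d = v"
      unfolding adjacent_def by blast
    then have "sqc.walk (d # w) u v \<and> length (d # w) = Suc n" by simp
    then show "\<exists>w. sqc.walk w u v \<and> length w = Suc n" by blast
  next
    assume "\<exists>w. sqc.walk w u v \<and> length w = Suc n"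
    then obtain d w where "sqc.walk (d # w) u v" "length w = n" by (auto simp: length_Suc_conv)
    then show "\<exists>y. (\<exists>w. sqc.walk w u y \<and> length w = n) \<and> adjacent y v"
      unfolding adjacent_def by auto
  qed
  finally show ?case .
qed

lemma graph_dist_eq: "u \<in> C0 \<Longrightarrow> graph_dist X u v = sqc.distance u v"
  unfolding graph_dist_def sqc.distance_def using relpow_walk by simp

lemma square_diagonal:
  assumes s: "square_cycle f v0 v1 v2 v3 e0 e1 e2 e3" and f: "f \<in> C2"
  shows "sqc.distance v0 v2 = 2"
proof -
  note D = square_cycle_D[OF s f]
  have C: "v0 \<in> C0" "v2 \<in> C0" using darts_D(4)[OF D(1)] darts_D(5)[OF D(2)] by simp_all
  have "sqc.distance v0 v1 = 1" using sqc.distance_dart[OF D(1)] by simp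
  moreover have "sqc.distance v0 v2 \<noteq> 0" using sqc.distance_0 C D(14) by auto
  ultimately show ?thesis using sqc.distance_step[OF D(2) C(1)] by auto
qed

text \<open>An edge between two vertices of a square is a side, because opposite vertices are at distance two
  and there are no multiple edges.\<close>

lemma edge_face:
  assumes e: "e \<in> C1" and f: "f \<in> C2" and sub: "verts e \<subseteq> verts f"
  shows "face e f"
proof -
  obtain u v where uv: "u \<noteq> v" "verts e = {u, v}" using edge_verts[OF e] by metis
  then have d: "(u, e, v) \<in> darts" using e unfolding darts_def by blast
  obtain v1 v2 v3 e0 e1 e2 e3 where s: "square_cycle f u v1 v2 v3 e0 e1 e2 e3"
    using square_cycle_from[OF f, of u] uv sub by blast
  note D = square_cycle_D[OF s f]
  have "v \<in> {v1, v2, v3}" using D(16) uv sub by auto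
  then consider "v = v1" | "v = v2" | "v = v3" by blast
  then show ?thesis
  proof cases
    case 1
    then have "e = e0" using sqc.dart_unique[OF d D(1)] by simp
    then show ?thesis using D by simp
  next
    case 2
    then show ?thesis using square_diagonal[OF s f] sqc.distance_dart[OF d] by simp
  next
    case 3
    then have "e = e3" using sqc.dart_unique[OF d D(5)] by simp
    then show ?thesis using D by simp
  qed
qed

lemma edge_verts_inj: "e \<in> C1 \<Longrightarrow> e' \<in> C1 \<Longrightarrow> verts e = verts e' \<Longrightarrow> e = e'"
proof -
  assume e: "e \<in> C1" "e' \<in> C1" "verts e = verts e'"
  obtain u v where "u \<noteq> v" "verts e = {u, v}" using edge_verts[OF e(1)] by metis
  then have "(u, e, v) \<in> darts" "(u, e', v) \<in> darts" using e unfolding darts_def by auto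
  then show "e = e'" using sqc.dart_unique by fastforce
qed

lemma square_verts_inj:
  assumes f: "f \<in> C2" "f' \<in> C2" and eq: "verts f = verts f'"
  shows "f = f'"
proof -
  obtain v where v: "v \<in> verts f" using verts_nonempty f dim_cells by blast
  have "corner X v g = {e \<in> edges_at X v. verts e \<subseteq> verts g}" if "g \<in> C2" for g
    unfolding corner_def edges_at_def using edge_face[OF _ that] verts_mono by blast
  then have "corner X v f = corner X v f'" using f eq by simp
  moreover have "v \<in> C0" "face v f" "face v f'" using v eq unfolding verts_def by blast+
  ultimately show ?thesis using corner_unique f by blast
qed

lemma card_verts: "c \<in> C0 \<Longrightarrow> card (verts c) = 1" "c \<in> C1 \<Longrightarrow> card (verts c) = 2"
  "c \<in> C2 \<Longrightarrow> card (verts c) = 4"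
proof -
  show "card (verts c) = 1" if "c \<in> C0" using verts_vertex[OF that] by simp
  show "card (verts c) = 2" if c: "c \<in> C1"
  proof -
    obtain u v where "u \<noteq> v" "verts c = {u, v}" using edge_verts[OF c] by metis
    then show ?thesis by simp
  qed
  show "card (verts c) = 4" if c: "c \<in> C2"
  proof -
    obtain v0 v1 v2 v3 e0 e1 e2 e3 where s: "square_cycle c v0 v1 v2 v3 e0 e1 e2 e3"
      using square_cycle_exists[OF c] by metis
    show ?thesis using square_cycle_D(14,16)[OF s c] by simp
  qed
qed

lemma finite_verts: "finite (verts c)"
  using finite_cells finite_subset[of "verts c" "cells X"] dim_cells unfolding verts_def by blast

lemma face_iff_verts:
  assumes c: "c \<in> cells X" and d: "d \<in> cells X"
  shows "face c d \<longleftrightarrow> verts c \<subseteq> verts d"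
proof
  assume sub: "verts c \<subseteq> verts d"
  then have card: "card (verts c) \<le> card (verts d)" using card_mono finite_verts by blast
  from c show "face c d"
  proof (cases rule: cdim_cases)
    case 1
    then have "c \<in> verts d" using sub verts_vertex by blast
    then show ?thesis unfolding verts_def by blast
  next
    case c: 2
    from d show ?thesis
    proof (cases rule: cdim_cases)
      case 1
      then show ?thesis using card card_verts c by simp
    next
      case 2
      then have "verts c = verts d" using card_subset_eq[OF finite_verts sub] card_verts c by simp
      then show ?thesis using edge_verts_inj[OF c 2] face_refl[OF d] by simp
    next
      case 3
      then show ?thesis using edge_face[OF c 3 sub] by simp
    qed
  next
    case c: 3
    from d show ?thesis
    proof (cases rule: cdim_cases)
      case 3
      then have "verts c = verts d" using card_subset_eq[OF finite_verts sub] card_verts c by simp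
      then show ?thesis using square_verts_inj[OF c 3] face_refl[OF d] by simp
    qed (use card card_verts c in simp_all)
  qed
qed (rule verts_mono)

lemma verts_inj: "inj_on verts (cells_of_dim X i)"
proof (rule inj_onI)
  fix c d assume c: "c \<in> cells_of_dim X i" and d: "d \<in> cells_of_dim X i" and eq: "verts c = verts d"
  have "i \<le> 2" using c cdim_le dim_cells by blast
  then consider "i = 0" | "i = 1" | "i = 2" by linarith
  then show "c = d"
  proof cases
    case 1
    then show ?thesis using c d eq verts_vertex by auto
  next
    case 2
    then show ?thesis using c d eq edge_verts_inj by simp
  next
    case 3
    then show ?thesis using c d eq square_verts_inj by simp
  qed
qed

end

definition edge_sets :: "('v \<Rightarrow> 'v \<Rightarrow> bool) \<Rightarrow> 'v set set" where
  "edge_sets A = {{u, v} |u v. A u v}"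

definition cycle_sets :: "('v \<Rightarrow> 'v \<Rightarrow> bool) \<Rightarrow> 'v set set" where
  "cycle_sets A = {{a, b, c, d} |a b c d. distinct [a, b, c, d] \<and> A a b \<and> A b c \<and> A c d \<and> A d a}"

context finite_CAT0_square_complex
begin

lemma verts_C0_image: "verts ` C0 = (\<lambda>v. {v}) ` C0"
  using verts_vertex by (intro image_cong) auto

lemma verts_C1_image: "verts ` C1 = edge_sets adjacent"
proof (intro equalityI subsetI)
  fix S assume "S \<in> verts ` C1"
  then obtain e where e: "e \<in> C1" "S = verts e" by blast
  obtain u v where uv: "u \<noteq> v" "verts e = {u, v}" using edge_verts[OF e(1)] by metis
  then have "(u, e, v) \<in> darts" using e unfolding darts_def by blast
  then have "adjacent u v" unfolding adjacent_def by force
  then show "S \<in> edge_sets adjacent" unfolding edge_sets_def e(2) uv(2) by blast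
next
  fix S assume "S \<in> edge_sets adjacent"
  then obtain d where "d \<in> darts" "S = {source d, target d}" unfolding edge_sets_def adjacent_def by blast
  then show "S \<in> verts ` C1" using darts_D(1,2) by blast
qed

text \<open>Seen from a vertex of a four-cycle in the graph, both edges at the opposite vertex descend, so the
  quadrangle condition fills the cycle with a square.\<close>

lemma verts_C2_image: "verts ` C2 = cycle_sets adjacent"
proof (intro equalityI subsetI)
  fix S assume "S \<in> verts ` C2"
  then obtain f where f: "f \<in> C2" "S = verts f" by blast
  obtain v0 v1 v2 v3 e0 e1 e2 e3 where s: "square_cycle f v0 v1 v2 v3 e0 e1 e2 e3"
    using square_cycle_exists[OF f(1)] by metis
  note D = square_cycle_D[OF s f(1)]
  have "adjacent v0 v1" "adjacent v1 v2" "adjacent v2 v3" "adjacent v3 v0"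
    unfolding adjacent_def using D(1-4) by force+
  then show "S \<in> cycle_sets adjacent" unfolding cycle_sets_def f(2) D(16) using D(14) by blast
next
  fix S assume "S \<in> cycle_sets adjacent"
  then obtain a b c d where S: "S = {a, b, c, d}" "distinct [a, b, c, d]"
    and A: "adjacent a b" "adjacent b c" "adjacent c d" "adjacent d a" unfolding cycle_sets_def by blast
  have C: "a \<in> C0" "b \<in> C0" "c \<in> C0" "d \<in> C0" using A adjacent_C0 by blast+
  obtain e where e: "e \<in> darts" "source e = b" "target e = a"
    using adjacent_sym[OF A(1)] unfolding adjacent_def by blast
  obtain f where f: "f \<in> darts" "source f = d" "target f = a"
    using A(4) unfolding adjacent_def by blast
  have cb: "sqc.distance c b = 1" "sqc.distance c d = 1"
    using adjacent_iff adjacent_sym[OF A(2)] A(3) C by blast+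
  have "sqc.distance c a \<noteq> 0" using sqc.distance_0 C S by auto
  then have ca: "sqc.distance c a = 2" using sqc.distance_step[OF e(1) C(3)] e cb by auto
  have ef: "target e = target f" "e \<noteq> f" using e f S by auto
  have desc: "sqc.distance c (target e) = Suc (sqc.distance c (source e))"
    "sqc.distance c (target f) = Suc (sqc.distance c (source f))" using e f ca cb by simp_all
  obtain p q where pq: "sq p e q f" "sqc.distance c (source e) = Suc (sqc.distance c (source p))"
    using sqc.quadrangle[OF C(3) e(1) f(1) ef desc] by blast
  note Q = sq_darts[OF pq(1)]
  have "sqc.distance c (source p) = 0" using pq(2) e cb by simp
  then have pc: "source p = c" using sqc.distance_0[OF C(3) darts_D(4)[OF Q(1)]] by simp
  obtain g where g: "g \<in> C2" "face (edge p) g" "face (edge e) g" "face (edge q) g" "face (edge f) g"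
    by (rule sq_square[OF pq(1)])
  have "S \<subseteq> verts g"
    unfolding S(1) using dart_verts[OF Q(1) g(2)] dart_verts[OF e(1) g(3)] dart_verts[OF f(1) g(5)] pc e f by simp
  moreover have "card S = card (verts g)" using S card_verts(3)[OF g(1)] by simp
  ultimately have "S = verts g" using card_subset_eq[OF finite_verts] by blast
  then show "S \<in> verts ` C2" using g by blast
qed

lemma high_cells_empty: "i > 2 \<Longrightarrow> cells_of_dim X i = {}"
  using cdim_le dim_cells by fastforce

end

lemma edge_sets_image:
  assumes g: "g ` V = V'" and A: "\<And>u v. A u v \<Longrightarrow> u \<in> V \<and> v \<in> V" and A': "\<And>u v. A' u v \<Longrightarrow> u \<in> V' \<and> v \<in> V'"
    and iff: "\<And>u v. u \<in> V \<Longrightarrow> v \<in> V \<Longrightarrow> A u v \<longleftrightarrow> A' (g u) (g v)"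
  shows "(`) g ` edge_sets A = edge_sets A'"
proof (intro equalityI subsetI)
  fix S assume "S \<in> (`) g ` edge_sets A"
  then obtain u v where "A u v" "S = {g u, g v}" unfolding edge_sets_def by auto
  then show "S \<in> edge_sets A'" unfolding edge_sets_def using A iff by blast
next
  fix S assume "S \<in> edge_sets A'"
  then obtain u v where uv: "A' u v" "S = {u, v}" unfolding edge_sets_def by auto
  then obtain x y where "x \<in> V" "y \<in> V" "u = g x" "v = g y" using A' g by blast
  then have "{x, y} \<in> edge_sets A" "S = g ` {x, y}" using uv iff unfolding edge_sets_def by auto
  then show "S \<in> (`) g ` edge_sets A" by blast
qed

lemma cycle_sets_image:
  assumes g: "g ` V = V'" "inj_on g V" and A: "\<And>u v. A u v \<Longrightarrow> u \<in> V \<and> v \<in> V"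
    and A': "\<And>u v. A' u v \<Longrightarrow> u \<in> V' \<and> v \<in> V'"
    and iff: "\<And>u v. u \<in> V \<Longrightarrow> v \<in> V \<Longrightarrow> A u v \<longleftrightarrow> A' (g u) (g v)"
  shows "(`) g ` cycle_sets A = cycle_sets A'"
proof (intro equalityI subsetI)
  fix S assume "S \<in> (`) g ` cycle_sets A"
  then obtain a b c d where S: "S = {g a, g b, g c, g d}" "distinct [a, b, c, d]"
    "A a b" "A b c" "A c d" "A d a" unfolding cycle_sets_def by auto
  then have V: "a \<in> V" "b \<in> V" "c \<in> V" "d \<in> V" using A by blast+
  have "distinct [g a, g b, g c, g d]" using S(2) V inj_on_eq_iff[OF g(2)] by simp
  moreover have "A' (g a) (g b)" "A' (g b) (g c)" "A' (g c) (g d)" "A' (g d) (g a)" using S V iff by blast+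
  ultimately show "S \<in> cycle_sets A'" unfolding cycle_sets_def S(1) by blast
next
  fix S assume "S \<in> cycle_sets A'"
  then obtain a b c d where S: "S = {a, b, c, d}" "distinct [a, b, c, d]"
    "A' a b" "A' b c" "A' c d" "A' d a" unfolding cycle_sets_def by auto
  then have in_V': "a \<in> V'" "b \<in> V'" "c \<in> V'" "d \<in> V'" using A' by blast+
  obtain w where w: "w \<in> V" "a = g w" using in_V'(1) g(1) by blast
  obtain x where x: "x \<in> V" "b = g x" using in_V'(2) g(1) by blast
  obtain y where y: "y \<in> V" "c = g y" using in_V'(3) g(1) by blast
  obtain z where z: "z \<in> V" "d = g z" using in_V'(4) g(1) by blast
  note V = w x y z
  have "distinct [w, x, y, z]" using S(2) V by auto
  moreover have "A w x" "A x y" "A y z" "A z w" using S V iff by simp_all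
  ultimately have "{w, x, y, z} \<in> cycle_sets A" unfolding cycle_sets_def by blast
  moreover have "S = g ` {w, x, y, z}" using S V by simp
  ultimately show "S \<in> (`) g ` cycle_sets A" by blast
qed

text \<open>Cells are determined by their sets of vertices, and incidence is inclusion of these sets.\<close>

lemma same_type_if_graphs_isomorphic:
  assumes X: "finite_CAT0_square_complex X" and Y: "finite_CAT0_square_complex Y"
    and g: "bij_betw g (cells_of_dim X 0) (cells_of_dim Y 0)"
    and adj: "\<And>u v. u \<in> cells_of_dim X 0 \<Longrightarrow> v \<in> cells_of_dim X 0 \<Longrightarrow>
      finite_CAT0_square_complex.adjacent X u v \<longleftrightarrow> finite_CAT0_square_complex.adjacent Y (g u) (g v)"
  shows "same_combinatorial_type X Y"
proof -
  interpret X: finite_CAT0_square_complex X by (rule X)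
  interpret Y: finite_CAT0_square_complex Y by (rule Y)
  have im: "g ` X.C0 = Y.C0" and inj: "inj_on g X.C0" using g unfolding bij_betw_def by auto
  have sub: "X.verts c \<subseteq> X.C0" for c by (rule X.verts_C0)
  have images: "(`) g ` X.verts ` cells_of_dim X i = Y.verts ` cells_of_dim Y i" for i
  proof -
    consider "i = 0" | "i = 1" | "i = 2" | "i > 2" by linarith
    then show ?thesis
    proof cases
      case 1
      have "(`) g ` X.verts ` X.C0 = (\<lambda>v. {v}) ` g ` X.C0" unfolding X.verts_C0_image by (auto simp: image_image)
      then show ?thesis unfolding 1 Y.verts_C0_image im .
    next
      case 2
      show ?thesis unfolding 2 X.verts_C1_image Y.verts_C1_image
        by (rule edge_sets_image[OF im]) (use X.adjacent_C0 Y.adjacent_C0 adj in blast)+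
    next
      case 3
      show ?thesis unfolding 3 X.verts_C2_image Y.verts_C2_image
        by (rule cycle_sets_image[OF im inj]) (use X.adjacent_C0 Y.adjacent_C0 adj in blast)+
    qed (simp add: X.high_cells_empty Y.high_cells_empty)
  qed
  define f where "f i c = inv_into (cells_of_dim Y i) Y.verts (g ` X.verts c)" for i c
  have f: "f i c \<in> cells_of_dim Y i \<and> Y.verts (f i c) = g ` X.verts c" if c: "c \<in> cells_of_dim X i" for i c
  proof -
    have "g ` X.verts c \<in> Y.verts ` cells_of_dim Y i" using images[of i] c by blast
    then show ?thesis unfolding f_def using inv_into_into f_inv_into_f by metis
  qed
  have img: "g ` X.verts c \<subseteq> g ` X.verts d \<longleftrightarrow> X.verts c \<subseteq> X.verts d" for c d
    by (rule inj_on_image_subset_iff[OF inj sub sub])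
  have bij: "bij_betw (f i) (cells_of_dim X i) (cells_of_dim Y i)" for i
  proof (rule bij_betwI')
    fix c d assume cd: "c \<in> cells_of_dim X i" "d \<in> cells_of_dim X i"
    have "X.verts c = X.verts d" if "f i c = f i d"
      using f[OF cd(1)] f[OF cd(2)] that img[of c d] img[of d c] by simp
    then show "f i c = f i d \<longleftrightarrow> c = d" using inj_onD[OF X.verts_inj _ cd] by blast
  next
    fix c assume "c \<in> cells_of_dim X i"
    then show "f i c \<in> cells_of_dim Y i" using f by blast
  next
    fix d assume d: "d \<in> cells_of_dim Y i"
    then have "Y.verts d \<in> (`) g ` X.verts ` cells_of_dim X i" unfolding images by blast
    then obtain c where c: "c \<in> cells_of_dim X i" "Y.verts d = g ` X.verts c" by blast
    then have "d = f i c" using f[OF c(1)] inj_onD[OF Y.verts_inj _ d] by metis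
    then show "\<exists>c\<in>cells_of_dim X i. d = f i c" using c by blast
  qed
  have inc: "incident X c d \<longleftrightarrow> incident Y (f i c) (f j d)"
    if c: "c \<in> cells_of_dim X i" and d: "d \<in> cells_of_dim X j" for i j c d
  proof -
    have "face_of_cell X c d \<longleftrightarrow> face_of_cell Y (f i c) (f j d)"
      if c: "c \<in> cells_of_dim X i" and d: "d \<in> cells_of_dim X j" for i j c d
      using X.face_iff_verts[of c d] Y.face_iff_verts[of "f i c" "f j d"] f[OF c] f[OF d] img[of c d]
        X.dim_cells(1)[OF c] X.dim_cells(1)[OF d]
        Y.dim_cells(1)[OF conjunct1[OF f[OF c]]] Y.dim_cells(1)[OF conjunct1[OF f[OF d]]] by simp
    from this[OF c d] this[OF d c] show ?thesis unfolding incident_def by simp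
  qed
  show ?thesis unfolding same_combinatorial_type_def using bij inc by blast
qed

section \<open>The combinatorial boundary\<close>

definition adjacent_orientations ::
    "'i set \<Rightarrow> ('i \<Rightarrow> 'i \<Rightarrow> nat) \<Rightarrow> ('i \<times> 'i) set \<Rightarrow> ('i \<times> 'i) set \<Rightarrow> bool" where
  "adjacent_orientations I \<delta> S S' \<longleftrightarrow> S \<noteq> S' \<and>
    (\<forall>(i, j)\<in>S - S'. \<forall>(k, l)\<in>S - S'. \<forall>t\<in>I. \<delta> t i < \<delta> t j \<longleftrightarrow> \<delta> t k < \<delta> t l)"

lemma ball_pairs_iff:
  "(\<forall>(i, j)\<in>S. \<forall>(k, l)\<in>S. P i j k l) \<longleftrightarrow>
    (\<forall>i j k l. (i, j) \<in> S \<longrightarrow> (k, l) \<in> S \<longrightarrow> P i j k l)"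
  by fast

lemma orientations_cong:
  assumes eq: "\<And>i j. i \<in> I \<Longrightarrow> j \<in> I \<Longrightarrow> \<delta> i j = \<delta>' i j"
  shows "orientations I \<delta> = orientations I \<delta>'"
proof -
  have A: "{(i, j). i \<in> I \<and> j \<in> I \<and> \<delta> i j = 1} = {(i, j). i \<in> I \<and> j \<in> I \<and> \<delta>' i j = 1}"
    using eq by auto
  have "S \<in> orientations I \<delta> \<longleftrightarrow> S \<in> orientations I \<delta>'" for S
  proof (cases "S \<subseteq> I \<times> I")
    case True
    then have 1: "(\<exists>t\<in>I. \<delta> t i < \<delta> t j \<and> \<delta> t k < \<delta> t l) \<longleftrightarrow> (\<exists>t\<in>I. \<delta>' t i < \<delta>' t j \<and> \<delta>' t k < \<delta>' t l)"
      if "(i, j) \<in> S" "(k, l) \<in> S" for i j k l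
      using that eq by (intro bex_cong refl) auto
    have "(\<forall>(i, j)\<in>S. \<forall>(k, l)\<in>S. \<exists>t\<in>I. \<delta> t i < \<delta> t j \<and> \<delta> t k < \<delta> t l) \<longleftrightarrow>
        (\<forall>(i, j)\<in>S. \<forall>(k, l)\<in>S. \<exists>t\<in>I. \<delta>' t i < \<delta>' t j \<and> \<delta>' t k < \<delta>' t l)"
      unfolding ball_pairs_iff using 1 by blast
    then show ?thesis unfolding orientations_def A using eq by simp
  next
    case False
    then show ?thesis unfolding orientations_def by blast
  qed
  then show ?thesis by blast
qed

lemma tree_codes_cong:
  assumes "\<And>i j. i \<in> I \<Longrightarrow> j \<in> I \<Longrightarrow> \<delta> i j = \<delta>' i j"
  shows "tree_codes I \<delta> = tree_codes I \<delta>'"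
proof -
  have "tree_codes I \<delta> \<subseteq> tree_codes I \<delta>'" if eq: "\<And>i j. i \<in> I \<Longrightarrow> j \<in> I \<Longrightarrow> \<delta> i j = \<delta>' i j" for \<delta> \<delta>'
  proof
    fix c assume "c \<in> tree_codes I \<delta>"
    then obtain i j k where I: "i \<in> I" "j \<in> I" "k \<le> \<delta> i j"
      "c = (\<lambda>t. if t \<in> I then max (\<delta> t i - k) (\<delta> t j - (\<delta> i j - k)) else 0)"
      unfolding tree_codes_def by blast
    have "c = (\<lambda>t. if t \<in> I then max (\<delta>' t i - k) (\<delta>' t j - (\<delta>' i j - k)) else 0)"
      unfolding I(4) using eq I(1,2) by (intro ext) simp
    then show "c \<in> tree_codes I \<delta>'" unfolding tree_codes_def using I eq by auto
  qed
  from this[of \<delta> \<delta>'] this[of \<delta>' \<delta>] show ?thesis using assms by force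
qed

context finite_CAT0_square_complex
begin

lemma C0_nonempty: "C0 \<noteq> {}"
proof -
  have "realization X \<noteq> {}" using CAT0 unfolding CAT0_cube_complex_def by blast
  then obtain c where "c \<in> cells X" unfolding realization_def by blast
  then show ?thesis using verts_nonempty verts_C0 by blast
qed

lemma top_cell: "\<exists>c\<in>cells X. cdim X c = top_dim X"
proof -
  have "cells X \<noteq> {}" using C0_nonempty dim_cells by blast
  then have "top_dim X \<in> cdim X ` cells X"
    unfolding top_dim_def using Max_in[of "cdim X ` cells X"] finite_cells by simp
  then show ?thesis by (metis imageE)
qed

lemma cdim_le_top_dim: "c \<in> cells X \<Longrightarrow> cdim X c \<le> top_dim X"
  unfolding top_dim_def using Max_ge[of "cdim X ` cells X" "cdim X c"] finite_cells by simp

lemma cells_above_top_dim: "top_dim X < n \<Longrightarrow> cells_of_dim X n = {}"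
  using cdim_le_top_dim unfolding cells_of_dim_def by force

lemma boundary_C0: "boundary_vertices X \<subseteq> C0"
  unfolding boundary_vertices_def by blast

lemma not_boundary:
  assumes "v \<in> C0" "v \<notin> boundary_vertices X" "b \<in> cells X" "cdim X b < top_dim X" "face v b"
  obtains t t' where "t \<in> cells_of_dim X (top_dim X)" "t' \<in> cells_of_dim X (top_dim X)"
    "face b t" "face b t'" "t \<noteq> t'"
proof -
  have "\<not> (\<exists>\<^sub>\<le>\<^sub>1 t. t \<in> cells_of_dim X (top_dim X) \<and> face b t)"
  proof
    assume "\<exists>\<^sub>\<le>\<^sub>1 t. t \<in> cells_of_dim X (top_dim X) \<and> face b t"
    then have "v \<in> comb_boundary X"
      unfolding comb_boundary_def mem_Collect_eq using assms(3-5) by (intro bexI[of _ b] conjI)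
    then show False using assms(1,2) unfolding boundary_vertices_def by blast
  qed
  then show ?thesis using that unfolding Uniq_def by blast
qed

lemma no_edges_single:
  assumes "C1 = {}"
  shows "\<exists>x. C0 = {x}"
proof -
  obtain x where x: "x \<in> C0" using C0_nonempty by blast
  have "y = x" if y: "y \<in> C0" for y
  proof -
    obtain w where w: "sqc.walk w x y" using walk_connected[OF x y] by blast
    have no: "d \<notin> darts" for d using assms unfolding darts_def by blast
    show ?thesis
    proof (cases w)
      case Nil
      then show ?thesis using w by simp
    next
      case (Cons d w')
      then have "d \<in> darts" using w by simp
      then show ?thesis using no by blast
    qed
  qed
  then show ?thesis using x by blast
qed

lemma boundary_empty:
  assumes "top_dim X = 0"
  shows "boundary_vertices X = {}" "C1 = {}"
proof -
  show "boundary_vertices X = {}" unfolding boundary_vertices_def comb_boundary_def using assms by simp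
  show "C1 = {}" using cells_above_top_dim[of 1] assms by simp
qed

text \<open>At a vertex off the boundary all edges are in two squares, and the two edges that span squares with a
  third one do not span a square with each other.\<close>

lemma square_complex_bounded:
  assumes top: "top_dim X = 2" and \<beta>: "\<beta> ` I = boundary_vertices X"
  shows "bounded_square_complex C0 darts fst (\<lambda>d. snd (snd d)) reverse sq I \<beta>"
proof -
  have two: "\<exists>q q'. q \<noteq> q' \<and> sqc.span_square p q \<and> sqc.span_square p q'"
    if p: "p \<in> darts" and v: "v \<in> {source p, target p}" "v \<notin> \<beta> ` I" for p v
  proof -
    have vC: "v \<in> C0" "face v (edge p)" using v darts_D[OF p] by auto
    have e: "edge p \<in> cells X" "cdim X (edge p) < top_dim X"
      using dim_cells[OF darts_D(1)[OF p]] top by simp_all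
    obtain f f' where f: "f \<in> C2" "f' \<in> C2" "face (edge p) f" "face (edge p) f'" "f \<noteq> f'"
      using not_boundary[OF vC(1) v(2)[unfolded \<beta>] e vC(2)] unfolding top by metis
    obtain a q b where q: "sq p a q b" "corner X (source p) f = {edge p, edge q}"
      using square_at_dart[OF f(1) p f(3)] by metis
    obtain a' q' b' where q': "sq p a' q' b'" "corner X (source p) f' = {edge p, edge q'}"
      using square_at_dart[OF f(2) p f(4)] by metis
    have "q \<noteq> q'"
    proof
      assume "q = q'"
      then have "f = f'" using corner_unique[OF f(1,2) darts_D(4)[OF p]] q q'
          face_trans[OF darts_D(6)[OF p]] f by simp
      then show False using f by blast
    qed
    then show ?thesis using q q' unfolding sqc.span_square_def by blast
  qed
  show ?thesis
  proof
    show "finite C0" using finite_cells finite_subset[of C0 "cells X"] dim_cells by blast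
    show "\<beta> i \<in> C0" if "i \<in> I" for i using that \<beta> boundary_C0 by blast
  next
    fix z assume z: "z \<in> C0" "z \<notin> \<beta> ` I"
    have zX: "z \<in> cells X" "cdim X z < top_dim X" using dim_cells[OF z(1)] top by simp_all
    obtain f where f: "f \<in> C2" "face z f"
      using not_boundary[OF z(1) z(2)[unfolded \<beta>] zX face_refl[OF zX(1)]] unfolding top by metis
    obtain v1 v2 v3 e0 e1 e2 e3 where s: "square_cycle f z v1 v2 v3 e0 e1 e2 e3"
      using square_cycle_from[OF f(1), of z] f(2) z(1) unfolding verts_def by blast
    let ?p = "(z, e0, v1)"
    have p: "?p \<in> darts" using square_cycle_D(1)[OF s f(1)] .
    have "\<exists>q q'. q \<noteq> q' \<and> sqc.span_square ?p q \<and> sqc.span_square ?p q'"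
      by (rule two[OF p _ z(2)]) simp
    then obtain q q' where q: "q \<noteq> q'" "sqc.span_square ?p q" "sqc.span_square ?p q'" by blast
    have "\<not> sqc.span_square q q'" using sqc.no_triangle q(2,3) by blast
    moreover have "r \<in> darts \<and> source r = z" if r: "sqc.span_square ?p r" for r
    proof -
      obtain a b where "sq ?p a r b" using r unfolding sqc.span_square_def by blast
      from sq_darts(3,5)[OF this] show ?thesis by simp
    qed
    ultimately show "\<exists>p\<in>darts. \<exists>q\<in>darts. source p = z \<and> source q = z \<and> p \<noteq> q \<and> \<not> sqc.span_square p q"
      using q by blast
  next
    fix p assume p: "p \<in> darts" and n: "\<not> (source p \<in> \<beta> ` I \<and> target p \<in> \<beta> ` I)"
    obtain v where "v \<in> {source p, target p}" "v \<notin> \<beta> ` I" using n by blast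
    from two[OF p this] show "\<exists>q q'. q \<noteq> q' \<and> sqc.span_square p q \<and> sqc.span_square p q'" .
  qed
qed

lemma tree_bounded:
  assumes top: "top_dim X = 1" and \<beta>: "\<beta> ` I = boundary_vertices X"
  shows "bounded_tree C0 darts fst (\<lambda>d. snd (snd d)) reverse sq I \<beta>"
proof
  have no: "C2 = {}" using cells_above_top_dim[of 2] top by simp
  show nosq: "\<not> sq p a q b" for p a q b using sq_square[of p a q b] no by blast
  show "finite C0" using finite_cells finite_subset[of C0 "cells X"] dim_cells by blast
  show "\<beta> i \<in> C0" if "i \<in> I" for i using that \<beta> boundary_C0 by blast
  fix z assume z: "z \<in> C0" "z \<notin> \<beta> ` I"
  have zX: "z \<in> cells X" "cdim X z < top_dim X" using dim_cells[OF z(1)] top by simp_all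
  obtain e e' where e: "e \<in> C1" "e' \<in> C1" "face z e" "face z e'" "e \<noteq> e'"
    using not_boundary[OF z(1) z(2)[unfolded \<beta>] zX face_refl[OF zX(1)]] unfolding top by metis
  then have "z \<in> verts e" "z \<in> verts e'" using z(1) unfolding verts_def by simp_all
  obtain p where p: "p \<in> darts" "source p = z" "edge p = e" by (rule dart_exists[OF e(1) \<open>z \<in> verts e\<close>])
  obtain q where q: "q \<in> darts" "source q = z" "edge q = e'" by (rule dart_exists[OF e(2) \<open>z \<in> verts e'\<close>])
  have "p \<noteq> q" using p q e(5) by blast
  then show "\<exists>p\<in>darts. \<exists>q\<in>darts. source p = z \<and> source q = z \<and> p \<noteq> q \<and> \<not> sqc.span_square p q"
    using p(1,2) q(1,2) nosq unfolding sqc.span_square_def by blast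
qed

lemma leaf_dart_unique:
  assumes top: "top_dim X = 1" and z: "z \<in> boundary_vertices X"
    and p: "p \<in> darts" "source p = z" and q: "q \<in> darts" "source q = z"
  shows "p = q"
proof -
  obtain b where b: "b \<in> cells X" "cdim X b < 1" "\<exists>\<^sub>\<le>\<^sub>1 t. t \<in> C1 \<and> face b t" "face z b" and zC: "z \<in> C0"
    using z top unfolding boundary_vertices_def comb_boundary_def by auto
  have "b \<in> C0" using b(1,2) unfolding cells_of_dim_def by simp
  then have "z = b" using vertex_faces[of b] b(4) by blast
  then have "edge p = edge q" using b(3) darts_D[OF p(1)] darts_D[OF q(1)] p(2) q(2) unfolding Uniq_def by auto
  then show ?thesis using darts_eq p q by simp
qed

text \<open>A geodesic from \<open>w\<close> to a leaf arrives through the other one if the two are adjacent, so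
  each of them would be closer to \<open>w\<close> than the other.\<close>

lemma tree_adjacent_leaves:
  assumes top: "top_dim X = 1" and B: "u \<in> boundary_vertices X" "v \<in> boundary_vertices X" "w \<in> boundary_vertices X"
    and uv: "graph_dist X u v = 1" and w: "w \<noteq> u" "w \<noteq> v"
  shows False
proof -
  have C: "u \<in> C0" "v \<in> C0" "w \<in> C0" using B boundary_C0 by blast+
  then have "adjacent u v" using uv adjacent_iff graph_dist_eq by simp
  then obtain d where d: "d \<in> darts" "source d = u" "target d = v" unfolding adjacent_def by blast
  obtain e where e: "e \<in> darts" "source e = u" "sqc.distance w u = Suc (sqc.distance w (target e))"
    using sqc.separating_dart[OF C(1,3)] w by metis
  obtain f where f: "f \<in> darts" "source f = v" "sqc.distance w v = Suc (sqc.distance w (target f))"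
    using sqc.separating_dart[OF C(2,3)] w by metis
  have "e = d" using leaf_dart_unique[OF top B(1) e(1,2) d(1,2)] .
  moreover have "f = reverse d" using leaf_dart_unique[OF top B(2) f(1,2)] reverse_darts[OF d(1)] d by simp
  ultimately show False using e f d by simp
qed

text \<open>The hyperplanes of a square have four quarters.  Each contains a boundary vertex, so there are two
  on one side of a boundary edge of one of them, and one of the two is not an end of the edge.\<close>

lemma square_complex_boundary:
  assumes top: "top_dim X = 2"
  obtains u v w where "u \<in> boundary_vertices X" "v \<in> boundary_vertices X" "w \<in> boundary_vertices X"
    "graph_dist X u v = 1" "w \<noteq> u" "w \<noteq> v"
proof -
  note thesisI = that
  interpret bounded_square_complex C0 darts fst "\<lambda>d. snd (snd d)" reverse sq "boundary_vertices X" id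
    by (rule square_complex_bounded[OF top]) simp
  obtain f where f: "f \<in> C2" using top_cell top unfolding cells_of_dim_def by auto
  obtain v0 v1 v2 v3 e0 e1 e2 e3 where "square_cycle f v0 v1 v2 v3 e0 e1 e2 e3"
    using square_cycle_exists[OF f] by metis
  then obtain p a q b where sq: "sq p a q b" using square_cycle_sq f by blast
  note S = sq_darts[OF sq]
  obtain g u v where g: "g \<in> darts" "u \<in> boundary_vertices X" "v \<in> boundary_vertices X"
    "source g = id u" "target g = id v" "sqc.half_space g = sqc.half_space p"
    using boundary_representative[OF S(1)] by metis
  have "source p \<in> sqc.half_space p" "source p \<in> sqc.half_space q"
    using sqc.src_half_space[OF S(1)] sqc.src_half_space[OF S(3)] S(5) by simp_all
  then obtain t where t: "t \<in> boundary_vertices X" "id t \<in> sqc.half_space p" "id t \<in> sqc.half_space q"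
    using boundary_meets_quarter[OF S(1,3)] by metis
  have "target q \<in> sqc.half_space p" "target q \<in> sqc.half_space (reverse q)"
    using sqc.src_half_space[OF S(4)] sqc.half_space_sq(1)[OF sq] S(7) sqc.src_half_space[OF reverse_darts[OF S(3)]] by simp_all
  then obtain t' where t': "t' \<in> boundary_vertices X" "id t' \<in> sqc.half_space p" "id t' \<in> sqc.half_space (reverse q)"
    using boundary_meets_quarter[OF S(1) reverse_darts[OF S(3)]] by metis
  have "t \<noteq> t'" using t(3) t'(3) sqc.half_space_rev[OF S(3)] by auto
  have "v \<notin> sqc.half_space p" using sqc.tgt_half_space[OF g(1)] g by simp
  have "u \<in> C0" using g(2) boundary_C0 by blast
  then have "graph_dist X u v = 1"
    using graph_dist_eq[of u v] g(4,5) sqc.distance_dart[OF g(1)] by simp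
  have gen: thesis if "s \<in> boundary_vertices X" "s \<in> sqc.half_space p" "s \<noteq> u" for s
    by (rule thesisI[OF g(2,3)]) (use that \<open>v \<notin> sqc.half_space p\<close> \<open>graph_dist X u v = 1\<close> in auto)
  show ?thesis using gen[of t] gen[of t'] t(1,2) t'(1,2) \<open>t \<noteq> t'\<close> by (cases "t = u") simp_all
qed

lemma boundary_nonempty:
  assumes "top_dim X \<noteq> 0"
  shows "boundary_vertices X \<noteq> {}"
proof -
  obtain x where x: "x \<in> C0" using C0_nonempty by blast
  consider "top_dim X = 1" | "top_dim X = 2" using assms top_dim by linarith
  then show ?thesis
  proof cases
    case 1
    interpret bounded_tree C0 darts fst "\<lambda>d. snd (snd d)" reverse sq "boundary_vertices X" id
      by (rule tree_bounded[OF 1]) simp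
    show ?thesis using extend_to_boundary[OF x x] by blast
  next
    case 2
    then show ?thesis using square_complex_boundary by blast
  qed
qed

text \<open>The set of codes and the adjacency of codes depend only on the boundary distances \<open>\<delta>\<close>, so two
  complexes with the same \<open>\<delta>\<close> have isomorphic graphs.\<close>

lemma square_complex_codes:
  assumes top: "top_dim X = 2" and \<beta>: "\<beta> ` I = boundary_vertices X"
    and \<delta>: "\<And>i j. i \<in> I \<Longrightarrow> j \<in> I \<Longrightarrow> graph_dist X (\<beta> i) (\<beta> j) = \<delta> i j"
  obtains c where "inj_on c C0" "c ` C0 = orientations I \<delta>"
    "\<And>x y. x \<in> C0 \<Longrightarrow> y \<in> C0 \<Longrightarrow> adjacent x y \<longleftrightarrow> adjacent_orientations I \<delta> (c x) (c y)"
proof -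
  interpret bounded_square_complex C0 darts fst "\<lambda>d. snd (snd d)" reverse sq I \<beta>
    by (rule square_complex_bounded[OF top \<beta>])
  have eq: "sqc.distance (\<beta> i) (\<beta> j) = \<delta> i j" if "i \<in> I" "j \<in> I" for i j
    using \<delta>[OF that] graph_dist_eq[OF boundary_V[OF that(1)]] by simp
  have "code ` C0 = orientations I \<delta>"
    using code_image[OF C0_nonempty] orientations_cong[of I "\<lambda>i j. sqc.distance (\<beta> i) (\<beta> j)" \<delta>] eq by simp
  moreover have "adjacent x y \<longleftrightarrow> adjacent_orientations I \<delta> (code x) (code y)" if x: "x \<in> C0" and y: "y \<in> C0" for x y
  proof -
    have "(\<forall>(i, j) \<in> code x - code y. \<forall>(k, l) \<in> code x - code y. \<forall>t\<in>I.
        sqc.distance (\<beta> t) (\<beta> i) < sqc.distance (\<beta> t) (\<beta> j) \<longleftrightarrow>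
        sqc.distance (\<beta> t) (\<beta> k) < sqc.distance (\<beta> t) (\<beta> l)) \<longleftrightarrow>
      (\<forall>(i, j) \<in> code x - code y. \<forall>(k, l) \<in> code x - code y. \<forall>t\<in>I. \<delta> t i < \<delta> t j \<longleftrightarrow> \<delta> t k < \<delta> t l)"
    proof -
      have "i \<in> I \<and> j \<in> I" if "(i, j) \<in> code x - code y" for i j using that unfolding code_def by blast
      then show ?thesis unfolding ball_pairs_iff using eq by (smt (verit, best))
    qed
    then show ?thesis unfolding adjacent_iff[OF x y] adjacent_iff_code[OF x y] adjacent_orientations_def by simp
  qed
  ultimately show ?thesis using that code_inj by blast
qed

lemma tree_complex_codes:
  assumes top: "top_dim X = 1" and \<beta>: "\<beta> ` I = boundary_vertices X"
    and \<delta>: "\<And>i j. i \<in> I \<Longrightarrow> j \<in> I \<Longrightarrow> graph_dist X (\<beta> i) (\<beta> j) = \<delta> i j"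
  obtains c where "inj_on c C0" "c ` C0 = tree_codes I \<delta>"
    "\<And>x y. x \<in> C0 \<Longrightarrow> y \<in> C0 \<Longrightarrow> adjacent x y \<longleftrightarrow> c x \<noteq> c y \<and> (\<forall>t\<in>I. c x t \<le> c y t + 1)"
proof -
  interpret bounded_tree C0 darts fst "\<lambda>d. snd (snd d)" reverse sq I \<beta>
    by (rule tree_bounded[OF top \<beta>])
  have eq: "sqc.distance (\<beta> i) (\<beta> j) = \<delta> i j" if "i \<in> I" "j \<in> I" for i j
    using \<delta>[OF that] graph_dist_eq[OF boundary_V[OF that(1)]] by simp
  have "tree_code ` C0 = tree_codes I \<delta>"
    using tree_code_image[OF C0_nonempty] tree_codes_cong[of I "\<lambda>i j. sqc.distance (\<beta> i) (\<beta> j)" \<delta>] eq by simp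
  then show ?thesis using that[of tree_code] tree_code_inj tree_code_adjacent adjacent_iff by simp
qed

end

lemma bijection_from_codes:
  assumes "inj_on c V" "inj_on c' V'" "c ` V = c' ` V'"
  obtains g where "bij_betw g V V'" "\<And>x. x \<in> V \<Longrightarrow> c' (g x) = c x"
proof -
  have "bij_betw (inv_into V' c' \<circ> c) V V'"
    using assms by (intro bij_betw_trans[of c V "c ` V"] bij_betw_inv_into inj_on_imp_bij_betw)
      (simp_all add: bij_betw_inv_into inj_on_imp_bij_betw)
  moreover have "c' ((inv_into V' c' \<circ> c) x) = c x" if "x \<in> V" for x
    using that assms(3) f_inv_into_f[of "c x" c' V'] by auto
  ultimately show ?thesis using that by blast
qed

theorem theorem3:
  fixes X :: "('c, 'a::t2_space) cube_data"
    and X' :: "('d, 'b::t2_space) cube_data"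
    and \<phi> :: "'c \<Rightarrow> 'd"
  assumes "CAT0_cube_complex X" and "finite (cells X)" and "top_dim X \<le> 2"
    and "CAT0_cube_complex X'" and "finite (cells X')" and "top_dim X' \<le> 2"
    and "bij_betw \<phi> (boundary_vertices X) (boundary_vertices X')"
    and "\<And>u w. u \<in> boundary_vertices X \<Longrightarrow> w \<in> boundary_vertices X \<Longrightarrow>
           graph_dist X u w = graph_dist X' (\<phi> u) (\<phi> w)"
  shows "same_combinatorial_type X X'"
proof -
  have locX: "finite_CAT0_square_complex X" and locX': "finite_CAT0_square_complex X'"
    using assms(1-6) by unfold_locales
  interpret X: finite_CAT0_square_complex X by (rule locX)
  interpret X': finite_CAT0_square_complex X' by (rule locX')
  let ?B = "boundary_vertices X" and ?\<delta> = "graph_dist X"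
  have \<phi>: "\<phi> ` ?B = boundary_vertices X'" "inj_on \<phi> ?B" using assms(7) unfolding bij_betw_def by auto
  note dist = assms(8)
  have \<delta>': "graph_dist X' (\<phi> i) (\<phi> j) = ?\<delta> i j" if "i \<in> ?B" "j \<in> ?B" for i j using dist[OF that] by simp
  have \<delta>: "graph_dist X (id i) (id j) = ?\<delta> i j" for i j by simp
  have id: "id ` ?B = ?B" by simp
  show ?thesis
  proof -
    consider (point) "top_dim X = 0 \<or> top_dim X' = 0" | (tree) "top_dim X = 1" "top_dim X' = 1"
      | (square) "top_dim X = 2" "top_dim X' = 2" | (mixed) "top_dim X = 2" "top_dim X' = 1"
      | (mixed') "top_dim X = 1" "top_dim X' = 2"
      using assms(3,6) by linarith
    then show ?thesis
    proof cases
      case point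
      then have "?B = {} \<or> boundary_vertices X' = {}" using X.boundary_empty X'.boundary_empty by blast
      then have "?B = {}" "boundary_vertices X' = {}" using \<phi>(1) by auto
      then have "top_dim X = 0" "top_dim X' = 0" using X.boundary_nonempty X'.boundary_nonempty by blast+
      then have no: "X.C1 = {}" "X'.C1 = {}" using X.boundary_empty(2) X'.boundary_empty(2) by blast+
      obtain x x' where "X.C0 = {x}" "X'.C0 = {x'}" using X.no_edges_single X'.no_edges_single no by metis
      then have "bij_betw (\<lambda>_. x') X.C0 X'.C0" unfolding bij_betw_def by simp
      moreover have "\<not> X.adjacent u v" "\<not> X'.adjacent u' v'" for u v u' v'
        using no unfolding X.adjacent_def X'.adjacent_def X.darts_def X'.darts_def by blast+
      ultimately show ?thesis by (intro same_type_if_graphs_isomorphic[OF locX locX']) simp_all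
    next
      case tree
      obtain c where c: "inj_on c X.C0" "c ` X.C0 = tree_codes ?B ?\<delta>"
        "\<And>x y. x \<in> X.C0 \<Longrightarrow> y \<in> X.C0 \<Longrightarrow> X.adjacent x y \<longleftrightarrow> c x \<noteq> c y \<and> (\<forall>t\<in>?B. c x t \<le> c y t + 1)"
        using X.tree_complex_codes[OF tree(1) id \<delta>] by metis
      obtain c' where c': "inj_on c' X'.C0" "c' ` X'.C0 = tree_codes ?B ?\<delta>"
        "\<And>x y. x \<in> X'.C0 \<Longrightarrow> y \<in> X'.C0 \<Longrightarrow> X'.adjacent x y \<longleftrightarrow> c' x \<noteq> c' y \<and> (\<forall>t\<in>?B. c' x t \<le> c' y t + 1)"
        using X'.tree_complex_codes[OF tree(2) \<phi>(1) \<delta>'] by metis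
      obtain g where g: "bij_betw g X.C0 X'.C0" "\<And>x. x \<in> X.C0 \<Longrightarrow> c' (g x) = c x"
        using bijection_from_codes[OF c(1) c'(1)] c(2) c'(2) by metis
      have "X.adjacent u v \<longleftrightarrow> X'.adjacent (g u) (g v)" if "u \<in> X.C0" "v \<in> X.C0" for u v
        using c(3)[OF that] c'(3)[OF bij_betwE[OF g(1), rule_format, OF that(1)]
          bij_betwE[OF g(1), rule_format, OF that(2)]] g(2) that by simp
      then show ?thesis by (intro same_type_if_graphs_isomorphic[OF locX locX' g(1)])
    next
      case square
      obtain c where c: "inj_on c X.C0" "c ` X.C0 = orientations ?B ?\<delta>"
        "\<And>x y. x \<in> X.C0 \<Longrightarrow> y \<in> X.C0 \<Longrightarrow> X.adjacent x y \<longleftrightarrow> adjacent_orientations ?B ?\<delta> (c x) (c y)"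
        using X.square_complex_codes[OF square(1) id \<delta>] by metis
      obtain c' where c': "inj_on c' X'.C0" "c' ` X'.C0 = orientations ?B ?\<delta>"
        "\<And>x y. x \<in> X'.C0 \<Longrightarrow> y \<in> X'.C0 \<Longrightarrow> X'.adjacent x y \<longleftrightarrow> adjacent_orientations ?B ?\<delta> (c' x) (c' y)"
        using X'.square_complex_codes[OF square(2) \<phi>(1) \<delta>'] by metis
      obtain g where g: "bij_betw g X.C0 X'.C0" "\<And>x. x \<in> X.C0 \<Longrightarrow> c' (g x) = c x"
        using bijection_from_codes[OF c(1) c'(1)] c(2) c'(2) by metis
      have "X.adjacent u v \<longleftrightarrow> X'.adjacent (g u) (g v)" if "u \<in> X.C0" "v \<in> X.C0" for u v
        using c(3)[OF that] c'(3)[OF bij_betwE[OF g(1), rule_format, OF that(1)]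
          bij_betwE[OF g(1), rule_format, OF that(2)]] g(2) that by simp
      then show ?thesis by (intro same_type_if_graphs_isomorphic[OF locX locX' g(1)])
    next
      case mixed
      obtain u v w where B: "u \<in> ?B" "v \<in> ?B" "w \<in> ?B" "graph_dist X u v = 1" "w \<noteq> u" "w \<noteq> v"
        by (rule X.square_complex_boundary[OF mixed(1)])
      have B': "\<phi> u \<in> boundary_vertices X'" "\<phi> v \<in> boundary_vertices X'" "\<phi> w \<in> boundary_vertices X'"
        using B \<phi>(1) by blast+
      have "\<phi> w \<noteq> \<phi> u" "\<phi> w \<noteq> \<phi> v" using B inj_on_eq_iff[OF \<phi>(2)] by auto
      then show ?thesis using X'.tree_adjacent_leaves[OF mixed(2) B'] dist[OF B(1,2)] B(4) by simp
    next
      case mixed'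
      obtain u' v' w' where B': "u' \<in> \<phi> ` ?B" "v' \<in> \<phi> ` ?B" "w' \<in> \<phi> ` ?B"
        "graph_dist X' u' v' = 1" "w' \<noteq> u'" "w' \<noteq> v'"
        using X'.square_complex_boundary[OF mixed'(2)] unfolding \<phi>(1) by metis
      then obtain u v w where B: "u \<in> ?B" "v \<in> ?B" "w \<in> ?B" "u' = \<phi> u" "v' = \<phi> v" "w' = \<phi> w" by blast
      then have "w \<noteq> u" "w \<noteq> v" using B' by auto
      then show ?thesis using X.tree_adjacent_leaves[OF mixed'(1) B(1-3)] dist[OF B(1,2)] B' B by simp
    qed
  qed
qed

end
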